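(* Let $p\in(0,1]$ and suppose that the tail of $v$ is regularly varying with index $s>2$, in the sense that $$\frac{1-F(tx)}{1-F(x)}\to t^{-s}\quad\text{as }x\to\infty,\ \text{for every }t>0,$$ where $F$ is the distribution function of $v$. Then $$\frac{\log \ell_n}{\log n}\to\frac1{s-1}\quad\text{in probability as }n\to\infty,$$ and the same holds with $\ell_n$ replaced by $h_n$. Furthermore, the fluctuations of $w_{0,n}$ are of larger order than $n^\beta$ for any $\beta<1/(s-1)$, in the sense that for any sequence $y_n$, $$\mathbb{P}\bigl(w_{0,n}\in[y_n,y_n+n^\beta]\bigr)\to0\quad\text{as }n\to\infty.$$ In particular, if $2<s<3$, then $$\frac{\operatorname{Var}(w_{0,n})}{n}\to\infty,$$ and a central limit theorem on the scale $\sqrt n$, such as weak convergence of the process $\left(\frac{w_{0,[nt]}-Cnt}{\kappa\sqrt n},\ t\ge0\right)$ to a standard Brownian motion (with $C$ the almost sure limit of $w_{0,n}/n$ and $\kappa$ a finite positive constant), cannot hold, even for individual values of $t$.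
   Context: Model. Fix $p\in(0,1]$. For integers $i<j$ let $v_{i,j}>0$ be i.i.d. random variables with the law of a random variable $v$. Independently of the weights, each directed edge $(i,j)$, $i<j\in\mathbb{Z}$, is present with probability $p$, independently of the others. A path from $i$ to $j$ is a sequence of present edges $(i_0,i_1),\dots,(i_{l-1},i_l)$, $l\ge0$, with $i=i_0<i_1<\dots<i_l=j$; its weight is the sum of its edge weights. $w_{i,j}$ is the maximal weight of a path from $i$ to $j$, with $w_{i,j}=-\infty$ if there is none. A path achieving the maximum is called a geodesic. $[x]$ is the integer part of $x$. When $\mathbb{E}[v^2]<\infty$ (as is the case here, since $s>2$), $w_{0,n}/n$ converges almost surely to a constant $C\in(0,\infty)$. $\ell_n$ is the length of the longest edge (the length of $(i,j)$ being $j-i$), and $h_n$ the weight of the heaviest edge, used on the geodesic from $0$ to $n$.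
   Formalization: For p<1 there is no path from 0 to n with positive probability, so w_{0,n} = −∞ with positive probability and Var(w_{0,n}) is undefined; the variance is taken conditionally on w_{0,n} being finite, which is the ordinary variance when p=1. *)

theory Defs
  imports "HOL-Probability.Probability"
begin

section \<open>Last passage percolation in a directed graph on the integers\<close>

text \<open>A path is represented by its list of vertices \<open>[i\<^sub>0, \<dots>, i\<^sub>l]\<close>; the set \<open>E\<close> collects the
  edges present, and \<open>wt\<close> gives the edge weights.\<close>

definition path_edges :: "int list \<Rightarrow> (int \<times> int) list" where
  "path_edges xs = zip xs (tl xs)"

definition is_path :: "(int \<times> int) set \<Rightarrow> int \<Rightarrow> int \<Rightarrow> int list \<Rightarrow> bool" where
  "is_path E i j xs \<longleftrightarrow> xs \<noteq> [] \<and> hd xs = i \<and> last xs = j \<and>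
     (\<forall>(a, b) \<in> set (path_edges xs). a < b \<and> (a, b) \<in> E)"

definition path_weight :: "(int \<times> int \<Rightarrow> real) \<Rightarrow> int list \<Rightarrow> real" where
  "path_weight wt xs = sum_list (map wt (path_edges xs))"

text \<open>There are finitely many paths from \<open>i\<close> to \<open>j\<close>, so the supremum is a maximum unless there is
  no path, in which case it is \<open>-\<infinity>\<close>.\<close>

definition max_weight :: "(int \<times> int) set \<Rightarrow> (int \<times> int \<Rightarrow> real) \<Rightarrow> int \<Rightarrow> int \<Rightarrow> ereal" where
  "max_weight E wt i j = (SUP xs \<in> {xs. is_path E i j xs}. ereal (path_weight wt xs))"

definition is_geodesic ::
  "(int \<times> int) set \<Rightarrow> (int \<times> int \<Rightarrow> real) \<Rightarrow> int \<Rightarrow> int \<Rightarrow> int list \<Rightarrow> bool" where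
  "is_geodesic E wt i j xs \<longleftrightarrow>
     is_path E i j xs \<and> ereal (path_weight wt xs) = max_weight E wt i j"

definition longest_edge :: "int list \<Rightarrow> int" where
  "longest_edge xs = Max ((\<lambda>(a, b). b - a) ` set (path_edges xs))"

definition heaviest_edge :: "(int \<times> int \<Rightarrow> real) \<Rightarrow> int list \<Rightarrow> real" where
  "heaviest_edge wt xs = Max (wt ` set (path_edges xs))"

section \<open>The random model\<close>

abbreviation all_edges :: "(int \<times> int) set" where
  "all_edges \<equiv> {(i, j). i < j}"

text \<open>\<open>v e\<close> is the weight of the edge \<open>e\<close>, \<open>pr e\<close> is the event that \<open>e\<close> is present, and \<open>\<mu>\<close> is
  the common law of the weights. The last assumption is the independence of the whole weight
  field from the whole presence field.\<close>

locale random_edge_lpp = prob_space M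
  for M :: "'a measure"
    and p :: real
    and \<mu> :: "real measure"
    and v :: "int \<times> int \<Rightarrow> 'a \<Rightarrow> real"
    and pr :: "int \<times> int \<Rightarrow> 'a \<Rightarrow> bool" +
  assumes p_range: "0 < p" "p \<le> 1"
    and weights_indep: "indep_vars (\<lambda>_. borel) v all_edges"
    and weights_law: "\<And>e. e \<in> all_edges \<Longrightarrow> distr M borel (v e) = \<mu>"
    and weights_pos: "AE x in \<mu>. 0 < x"
    and presence_indep: "indep_vars (\<lambda>_. count_space UNIV) pr all_edges"
    and presence_prob: "\<And>e. e \<in> all_edges \<Longrightarrow> prob {\<omega> \<in> space M. pr e \<omega>} = p"
    and weights_presence_indep:
      "indep_set
         (sets (vimage_algebra (space M) (\<lambda>\<omega>. \<lambda>e\<in>all_edges. v e \<omega>) (PiM all_edges (\<lambda>_. borel))))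
         (sets (vimage_algebra (space M) (\<lambda>\<omega>. \<lambda>e\<in>all_edges. pr e \<omega>)
                  (PiM all_edges (\<lambda>_. count_space UNIV))))"

definition present_edges :: "(int \<times> int \<Rightarrow> 'a \<Rightarrow> bool) \<Rightarrow> 'a \<Rightarrow> (int \<times> int) set" where
  "present_edges pr \<omega> = {e. pr e \<omega>}"

text \<open>The random variable \<open>w\<^sub>i\<^sub>,\<^sub>j\<close>.\<close>

definition max_path_weight ::
  "(int \<times> int \<Rightarrow> 'a \<Rightarrow> real) \<Rightarrow> (int \<times> int \<Rightarrow> 'a \<Rightarrow> bool) \<Rightarrow> int \<Rightarrow> int \<Rightarrow> 'a \<Rightarrow> ereal"
  where "max_path_weight v pr i j \<omega> = max_weight (present_edges pr \<omega>) (\<lambda>e. v e \<omega>) i j"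

text \<open>A measurable choice of a geodesic from \<open>0\<close> to \<open>n\<close> for every \<open>n\<close>. Geodesics need not be
  unique when \<open>\<mu>\<close> has atoms. Where no path exists, the value of \<open>\<gamma>\<close> is arbitrary.\<close>

definition geodesic_choice ::
  "'a measure \<Rightarrow> (int \<times> int \<Rightarrow> 'a \<Rightarrow> real) \<Rightarrow> (int \<times> int \<Rightarrow> 'a \<Rightarrow> bool) \<Rightarrow> (nat \<Rightarrow> 'a \<Rightarrow> int list) \<Rightarrow> bool"
  where "geodesic_choice M v pr \<gamma> \<longleftrightarrow>
    (\<forall>n. \<gamma> n \<in> measurable M (count_space UNIV) \<and>
      (AE \<omega> in M. (\<exists>xs. is_path (present_edges pr \<omega>) 0 (int n) xs) \<longrightarrow>
         is_geodesic (present_edges pr \<omega>) (\<lambda>e. v e \<omega>) 0 (int n) (\<gamma> n \<omega>)))"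

section \<open>Probabilistic notions\<close>

definition regularly_varying_tail :: "real measure \<Rightarrow> real \<Rightarrow> bool" where
  "regularly_varying_tail \<mu> s \<longleftrightarrow>
     (\<forall>t>0. ((\<lambda>x. (1 - cdf \<mu> (t * x)) / (1 - cdf \<mu> x)) \<longlongrightarrow> t powr (- s)) at_top)"

definition converges_in_prob :: "'a measure \<Rightarrow> (nat \<Rightarrow> 'a \<Rightarrow> real) \<Rightarrow> real \<Rightarrow> bool" where
  "converges_in_prob M X c \<longleftrightarrow>
     (\<forall>\<epsilon>>0. (\<lambda>n. measure M {\<omega> \<in> space M. \<bar>X n \<omega> - c\<bar> > \<epsilon>}) \<longlonglongrightarrow> 0)"

text \<open>For \<open>p < 1\<close> the passage time is \<open>-\<infinity>\<close> with (vanishing) positive probability. Its variance is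
  understood as the variance under the conditional law given that it is finite; for an almost
  surely finite variable this is the ordinary variance, as shown below.\<close>

definition ereal_variance :: "'a measure \<Rightarrow> ('a \<Rightarrow> ereal) \<Rightarrow> real" where
  "ereal_variance M X =
     prob_space.variance (uniform_measure M {\<omega> \<in> space M. \<bar>X \<omega>\<bar> \<noteq> \<infinity>}) (\<lambda>\<omega>. real_of_ereal (X \<omega>))"

lemma (in prob_space) ereal_variance_AE_finite:
  assumes [measurable]: "X \<in> borel_measurable M" and fin: "AE \<omega> in M. \<bar>X \<omega>\<bar> \<noteq> \<infinity>"
  shows "ereal_variance M X = variance (\<lambda>\<omega>. real_of_ereal (X \<omega>))"
proof -
  let ?A = "{\<omega> \<in> space M. \<bar>X \<omega>\<bar> \<noteq> \<infinity>}"
  have A: "?A \<in> sets M" by measurable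
  have "prob ?A = 1" using fin A by (simp add: prob_Collect_eq_1)
  then have 1: "emeasure M ?A = 1" by (simp add: emeasure_eq_measure)
  have "uniform_measure M ?A = M"
  proof (rule measure_eqI)
    fix B assume "B \<in> sets (uniform_measure M ?A)"
    then have B: "B \<in> sets M" by simp
    have "emeasure M (?A \<inter> B) = emeasure M B"
      by (rule emeasure_eq_AE) (use fin A B in \<open>auto elim: AE_mp\<close>)
    then show "emeasure (uniform_measure M ?A) B = emeasure M B"
      using A B 1 by (simp add: divide_ennreal_def)
  qed simp
  then show ?thesis by (simp add: ereal_variance_def)
qed

text \<open>Convergence in distribution of \<open>(w\<^sub>0\<^sub>,\<^sub>[\<^sub>n\<^sub>t\<^sub>] - a\<^sub>n) / (\<kappa> \<surd>n)\<close> to the law \<open>N(0, t)\<close> of a standard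
  Brownian motion at time \<open>t\<close>, in terms of distribution functions: this is also meaningful when
  the passage time takes the value \<open>-\<infinity>\<close>.\<close>

definition gaussian_limit_at ::
  "'a measure \<Rightarrow> (int \<times> int \<Rightarrow> 'a \<Rightarrow> real) \<Rightarrow> (int \<times> int \<Rightarrow> 'a \<Rightarrow> bool) \<Rightarrow>
   (nat \<Rightarrow> real) \<Rightarrow> real \<Rightarrow> real \<Rightarrow> bool" where
  "gaussian_limit_at M v pr a \<kappa> t \<longleftrightarrow>
     weak_conv
       (\<lambda>n x. measure M {\<omega> \<in> space M.
          (max_path_weight v pr 0 \<lfloor>real n * t\<rfloor> \<omega> - ereal (a n)) / ereal (\<kappa> * sqrt (real n)) \<le> ereal x})
       (cdf (density lborel (\<lambda>x. ennreal (normal_density 0 (sqrt t) x))))"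

end

theory Submission
  imports Defs "HOL-Real_Asymp.Real_Asymp"
begin

text \<open>
  Write \<open>\<alpha> = 1 / (s - 1)\<close>. With overwhelming probability any two vertices of \<open>[0, n]\<close> at distance
  \<open>L \<ge> n\<^sup>\<delta>\<close> are joined by a path of weight at least of order \<open>L n\<^sup>-\<^sup>\<delta>\<close>, so an edge of length \<open>L\<close>
  on a geodesic must have at least this weight; a union bound excludes such edges of length
  above \<open>n\<close> to the power \<open>\<alpha> + \<epsilon>\<close>.

  Conversely, let \<open>K = n\<^sup>\<beta>\<close> with \<open>\<beta> < \<alpha>\<close> and \<open>H = A K\<close> with a large constant \<open>A\<close>. Fix a set \<open>S\<close> of
  edges of length between \<open>K\<close> and \<open>2 K\<close> whose expected number of weights above \<open>H\<close> is a large
  constant. With high probability some present \<open>e \<in> S\<close> has weight above \<open>H\<close>; conditionally on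
  this weight it is likely that the rest of the environment near \<open>e\<close> is typical: no geodesic
  can jump over the vicinity of \<open>e\<close>, and every path through it that avoids \<open>e\<close> weighs less than \<open>H\<close>.
  Then every geodesic uses \<open>e\<close>. Here \<open>s > 2\<close> enters twice: jumps cover a vanishing fraction of the
  line, and a path over a distance \<open>K\<close> has weight of order \<open>K\<close>.

  If \<open>e = (i, j)\<close> lies on a geodesic, then \<open>w\<^sub>0\<^sub>,\<^sub>n = w\<^sub>0\<^sub>,\<^sub>i + v\<^sub>e + w\<^sub>j\<^sub>,\<^sub>n\<close>, where the other two terms are
  independent of \<open>v\<^sub>e\<close>. By regular variation a weight conditioned to exceed \<open>H\<close> falls into a given
  interval of length \<open>o(H)\<close> with probability \<open>o(1)\<close>; summing over \<open>S\<close> gives the claim on fluctuations.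
  For \<open>s < 3\<close> these fluctuations exceed the scale \<open>\<surd>n\<close>.
\<close>

section \<open>Paths and geodesics\<close>

text \<open>Only the exponent of n is at stake, so a factor n^\<delta> with small \<delta> may be
  lost almost everywhere: crude hops of two edges then do as lower bounds for passage times, and
  absent edges merely restrict attention to distances of at least n^\<delta>. No such loss is
  affordable where a heavy edge is compared with its surroundings. There rival paths must weigh at
  most a constant times K, which is what splitting each weight into the edge length and an excess
  achieves.

  The exponent 1 / (s - 1) is where counts balance: there are about n K edges of length about K,
  each of weight above A K with probability roughly K^(-s), and n K^(1 - s) = 1 for K = n^\<alpha>.
  Below this exponent all candidates together are too many for a union bound over their failures.
  Thinning them to \<open>S\<close> keeps the expected number of heavy ones bounded; each failure is
  estimated jointly with \<open>H < v e\<close>, by \<open>G H\<close> times a small number, and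
  summing over \<open>S\<close> costs only a constant.

  That an edge lies on a geodesic depends on all weights, so this event is never conditioned on; it
  is only enlarged to events where \<open>v e\<close> is independent of the rest.\<close>

lemma path_edges_simps [simp]:
  "path_edges [] = []" "path_edges [x] = []"
  "path_edges (x # y # xs) = (x, y) # path_edges (y # xs)"
  by (simp_all add: path_edges_def)

lemma path_edges_split:
  "path_edges (us @ x # vs) = path_edges (us @ [x]) @ path_edges (x # vs)"
proof (induction us)
  case (Cons u us)
  then show ?case by (cases us) auto
qed simp

lemma path_weight_simps [simp]:
  "path_weight wt [x] = 0"
  "path_weight wt (x # y # xs) = wt (x, y) + path_weight wt (y # xs)"
  by (simp_all add: path_weight_def)

lemma path_weight_split:
  "path_weight wt (us @ x # vs) = path_weight wt (us @ [x]) + path_weight wt (x # vs)"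
  by (simp add: path_weight_def path_edges_split[of us x vs])

lemma is_path_single [simp]: "is_path E i j [x] \<longleftrightarrow> x = i \<and> x = j"
  by (auto simp: is_path_def)

lemma is_path_Cons [simp]:
  "is_path E i j (x # y # xs) \<longleftrightarrow> x = i \<and> i < y \<and> (i, y) \<in> E \<and> is_path E y j (y # xs)"
  by (auto simp: is_path_def)

lemma is_path_split:
  "is_path E i j (us @ x # vs) \<longleftrightarrow> is_path E i x (us @ [x]) \<and> is_path E x j (x # vs)"
  unfolding is_path_def path_edges_split[of us x vs] by (cases us) auto

lemma is_path_E:
  assumes "is_path E i j xs"
  obtains us where "xs = us @ [j]"
  using assms by (metis append_butlast_last_id is_path_def)

lemma is_path_join:
  assumes "is_path E i x xs" "is_path E x j ys"
  obtains zs where "is_path E i j zs"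
    "path_weight wt zs = path_weight wt xs + path_weight wt ys"
proof -
  obtain us where us: "xs = us @ [x]" using is_path_E[OF assms(1)] by metis
  obtain vs where vs: "ys = x # vs" using assms(2) by (cases ys) (auto simp: is_path_def)
  show ?thesis
    by (rule that[of "us @ x # vs"])
      (use assms us vs in \<open>auto simp: is_path_split[of E i j us x vs] path_weight_split[of wt us x vs]\<close>)
qed

lemma is_path_bounds:
  assumes "is_path E i j xs"
  shows "sorted_wrt (<) xs" "set xs \<subseteq> {i..j}" "i \<le> j"
proof -
  have "sorted_wrt (<) xs \<and> set xs \<subseteq> {i..j} \<and> i \<le> j" using assms
  proof (induction xs arbitrary: i rule: induct_list012)
    case (3 x y zs)
    have "sorted_wrt (<) (y # zs) \<and> set (y # zs) \<subseteq> {y..j} \<and> y \<le> j"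
      using 3(3) by (intro 3(2)) simp
    then have "\<forall>u\<in>set zs. y < u" by simp
    with \<open>sorted_wrt (<) (y # zs) \<and> set (y # zs) \<subseteq> {y..j} \<and> y \<le> j\<close> 3(3) show ?case by auto
  qed (auto simp: is_path_def)
  then show "sorted_wrt (<) xs" "set xs \<subseteq> {i..j}" "i \<le> j" by auto
qed

lemma set_path_edgesE:
  assumes "(a, b) \<in> set (path_edges xs)"
  obtains us vs where "xs = us @ a # b # vs"
proof -
  have "\<exists>us vs. xs = us @ a # b # vs" using assms
  proof (induction xs rule: induct_list012)
    case (3 x y zs)
    show ?case
    proof (cases "(a, b) = (x, y)")
      case True then show ?thesis by blast
    next
      case False
      with 3 obtain us vs where "y # zs = us @ a # b # vs" by auto
      then have "x # y # zs = (x # us) @ a # b # vs" by simp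
      then show ?thesis by blast
    qed
  qed auto
  with that show ?thesis by blast
qed

lemma path_edges_append_Cons2: "(a, b) \<in> set (path_edges (us @ a # b # vs))"
  by (subst path_edges_split) simp

lemma distinct_path_edges: "distinct xs \<Longrightarrow> distinct (path_edges xs)"
  unfolding path_edges_def by (rule distinct_zipI1)

lemma is_path_edgeD:
  assumes "is_path E i j xs" "(a, b) \<in> set (path_edges xs)"
  shows "(a, b) \<in> E" "a < b" "i \<le> a" "b \<le> j"
proof -
  obtain us vs where "xs = us @ a # b # vs" using set_path_edgesE assms(2) by metis
  with is_path_bounds(2)[OF assms(1)] show "i \<le> a" "b \<le> j" by auto
  show "(a, b) \<in> E" "a < b" using assms by (auto simp: is_path_def)
qed

text \<open>Vertices increase strictly along a path, so a path is a list without repetitions over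
  the finite set \<open>{i..j}\<close>.\<close>

lemma finite_paths: "finite {xs. is_path E i j xs}"
proof (rule finite_subset)
  show "{xs. is_path E i j xs} \<subseteq> {xs. set xs \<subseteq> {i..j} \<and> length xs \<le> card {i..j}}"
  proof safe
    fix xs assume p: "is_path E i j xs"
    have "distinct xs" using is_path_bounds(1)[OF p] strict_sorted_iff by auto
    then have "length xs = card (set xs)" by (simp add: distinct_card)
    also have "\<dots> \<le> card {i..j}" using is_path_bounds(2)[OF p] by (intro card_mono) auto
    finally show "length xs \<le> card {i..j}" .
  qed (use is_path_bounds(2) in blast)
qed (rule finite_lists_length_le, simp)

section \<open>Maximal weights and optimality of geodesic segments\<close>

lemma path_weight_le_max_weight: "is_path E i j xs \<Longrightarrow> ereal (path_weight wt xs) \<le> max_weight E wt i j"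
  unfolding max_weight_def by (intro SUP_upper) auto

lemma geodesic_exists:
  assumes "is_path E i j xs" obtains ys where "is_geodesic E wt i j ys"
proof -
  let ?S = "{xs. is_path E i j xs}"
  have ne: "?S \<noteq> {}" using assms by auto
  obtain ys where ys: "ys \<in> ?S" "\<forall>zs\<in>?S. path_weight wt zs \<le> path_weight wt ys"
  proof -
    have "Max (path_weight wt ` ?S) \<in> path_weight wt ` ?S"
      using finite_paths ne by (intro Max_in) auto
    then obtain ys where "ys \<in> ?S" "Max (path_weight wt ` ?S) = path_weight wt ys" by blast
    moreover have "\<forall>zs\<in>?S. path_weight wt zs \<le> Max (path_weight wt ` ?S)"
      using finite_paths by (intro ballI Max_ge) auto
    ultimately show ?thesis using that by auto
  qed
  then have "max_weight E wt i j = ereal (path_weight wt ys)"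
    unfolding max_weight_def by (intro antisym SUP_least SUP_upper2[of ys]) auto
  with ys that show ?thesis by (auto simp: is_geodesic_def)
qed

lemma geodesic_max:
  assumes "is_geodesic E wt i j xs" "is_path E i j ys"
  shows "path_weight wt ys \<le> path_weight wt xs"
proof -
  have "ereal (path_weight wt ys) \<le> ereal (path_weight wt xs)"
    using path_weight_le_max_weight[OF assms(2), of wt] assms(1) by (simp add: is_geodesic_def)
  then show ?thesis by simp
qed

text \<open>Cut and paste: exchanging the stretch between \<open>a\<close> and \<open>b\<close> for
  \<open>ys\<close> gives another path from \<open>i\<close> to \<open>j\<close>, which cannot be
  heavier than the geodesic.\<close>

lemma geodesic_segment:
  assumes g: "is_geodesic E wt i j (us @ a # ms @ b # vs)" and p: "is_path E a b ys"
  shows "path_weight wt ys \<le> path_weight wt (a # ms @ [b])"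
proof -
  have "is_path E i j (us @ a # ms @ b # vs)" using g by (simp add: is_geodesic_def)
  then have p1: "is_path E i a (us @ [a])" and "is_path E a j ((a # ms) @ b # vs)"
    by (auto simp: is_path_split[of E i j us a])
  then have p3: "is_path E b j (b # vs)" using is_path_split by blast
  obtain zs where zs: "is_path E i b zs"
    "path_weight wt zs = path_weight wt (us @ [a]) + path_weight wt ys"
    using is_path_join[OF p1 p] by metis
  obtain z' where z': "is_path E i j z'"
    "path_weight wt z' = path_weight wt zs + path_weight wt (b # vs)"
    using is_path_join[OF zs(1) p3] by metis
  have "path_weight wt (us @ a # ms @ b # vs)
      = path_weight wt (us @ [a]) + path_weight wt (a # ms @ [b]) + path_weight wt (b # vs)"
    using path_weight_split[of wt us a "ms @ b # vs"] path_weight_split[of wt "a # ms" b vs] by simp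
  with geodesic_max[OF g z'(1)] z' zs show ?thesis by simp
qed

text \<open>The case of an empty stretch \<open>ms\<close>. It forces long edges of a geodesic to be
  heavy once heavy paths between distant vertices are known.\<close>

lemma geodesic_edge_ge:
  assumes "is_geodesic E wt i j xs" "(a, b) \<in> set (path_edges xs)" "is_path E a b ys"
  shows "path_weight wt ys \<le> wt (a, b)"
proof -
  obtain us vs where "xs = us @ a # [] @ b # vs" using set_path_edgesE assms(2) by (metis append_Nil)
  with geodesic_segment[of E wt i j us a "[]" b vs ys] assms show ?thesis by simp
qed

text \<open>The two other terms read only edges inside \<open>[i, a]\<close> and
  \<open>[b, j]\<close>, so neither involves the weight of \<open>(a, b)\<close>; this is the
  decomposition behind the fluctuations. Here both are finite, and \<open>real_of_ereal\<close>
  changes nothing.\<close>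

lemma max_weight_through_edge:
  assumes g: "is_geodesic E wt i j xs" and e: "(a, b) \<in> set (path_edges xs)"
  shows "max_weight E wt i j = ereal (real_of_ereal (max_weight E wt i a)
           + real_of_ereal (max_weight E wt b j) + wt (a, b))"
proof -
  obtain us vs where xs: "xs = us @ a # b # vs" using set_path_edgesE e by metis
  have "is_path E i j xs" using g by (simp add: is_geodesic_def)
  then have p: "is_path E i a (us @ [a])" "is_path E b j (b # vs)" "(a, b) \<in> E" "a < b"
    unfolding xs by (auto simp: is_path_split[of E i j us a])
  obtain ys where ys: "is_geodesic E wt i a ys" using geodesic_exists[OF p(1)] by metis
  obtain zs where zs: "is_geodesic E wt b j zs" using geodesic_exists[OF p(2)] by metis
  have ab: "is_path E a b [a, b]" using p by simp
  have pw: "is_path E i a ys" "is_path E b j zs" using ys zs by (auto simp: is_geodesic_def)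
  obtain u where u: "is_path E i b u" "path_weight wt u = path_weight wt ys + wt (a, b)"
    using is_path_join[OF pw(1) ab, of wt] by auto
  obtain t where t: "is_path E i j t"
    "path_weight wt t = path_weight wt ys + wt (a, b) + path_weight wt zs"
    using is_path_join[OF u(1) pw(2), of wt] u(2) by metis
  have "path_weight wt xs = path_weight wt (us @ [a]) + wt (a, b) + path_weight wt (b # vs)"
    using path_weight_split[of wt us a "b # vs"] xs by simp
  then have "path_weight wt xs = path_weight wt t"
    using geodesic_max[OF ys p(1)] geodesic_max[OF zs p(2)] geodesic_max[OF g t(1)] t(2) by linarith
  moreover have "max_weight E wt i a = ereal (path_weight wt ys)" "max_weight E wt b j = ereal (path_weight wt zs)"
    "max_weight E wt i j = ereal (path_weight wt xs)"
    using ys zs g by (simp_all add: is_geodesic_def)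
  ultimately show ?thesis using t(2) by simp
qed

text \<open>A deterministic sufficient condition for heavy paths between all distant pairs of vertices; it
  is a finite conjunction of local events and hence very likely.\<close>

definition linked :: "(int \<times> int) set \<Rightarrow> (int \<times> int \<Rightarrow> real) \<Rightarrow> int \<Rightarrow> int \<Rightarrow> bool" where
  "linked E wt n B \<longleftrightarrow> (\<forall>i j. 0 \<le> i \<and> j \<le> n \<and> B \<le> j - i \<longrightarrow>
     (\<exists>m. i < m \<and> m < j \<and> (i, m) \<in> E \<and> (m, j) \<in> E \<and> 1 < wt (i, m)))"

text \<open>Hops of length \<open>B\<close> are chained, each worth at least 1. The last hop absorbs
  a remainder shorter than \<open>B\<close>, which might not be linked by itself, so it may be
  almost \<open>2 * B\<close> long; hence the factor 2.\<close>

lemma linked_path: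
  assumes l: "linked E wt n B" and pos: "\<And>e. e \<in> all_edges \<Longrightarrow> 0 < wt e" and B: "0 < B"
    and ij: "0 \<le> i" "j \<le> n" "B \<le> j - i"
  obtains xs where "is_path E i j xs" "real_of_int (j - i) / (2 * real_of_int B) \<le> path_weight wt xs"
proof -
  have one: "\<exists>xs. is_path E a b xs \<and> 1 \<le> path_weight wt xs" if "0 \<le> a" "b \<le> n" "B \<le> b - a" for a b
  proof -
    obtain m where m: "a < m" "m < b" "(a, m) \<in> E" "(m, b) \<in> E" "1 < wt (a, m)"
      using l \<open>0 \<le> a\<close> \<open>b \<le> n\<close> \<open>B \<le> b - a\<close> unfolding linked_def by blast
    then have "is_path E a b [a, m, b]" "1 \<le> path_weight wt [a, m, b]"
      using pos[of "(m, b)"] by auto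
    then show ?thesis by blast
  qed
  have "\<exists>xs. is_path E i j xs \<and> real_of_int (j - i) / (2 * real_of_int B) \<le> path_weight wt xs"
    using ij
  proof (induction "nat (j - i)" arbitrary: i rule: less_induct)
    case less
    show ?case
    proof (cases "j - i < 2 * B")
      case True
      obtain xs where xs: "is_path E i j xs" "1 \<le> path_weight wt xs" using one less.prems by blast
      have "real_of_int (j - i) / (2 * real_of_int B) \<le> 1"
        using True B by (simp add: field_simps)
      with xs show ?thesis by force
    next
      case False
      obtain xs where xs: "is_path E i (i + B) xs" "1 \<le> path_weight wt xs"
        using one[of i "i + B"] less.prems False B by auto
      obtain ys where ys: "is_path E (i + B) j ys"
        "real_of_int (j - (i + B)) / (2 * real_of_int B) \<le> path_weight wt ys"
        using less.hyps[of "i + B"] less.prems False B by auto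
      obtain zs where "is_path E i j zs" "path_weight wt zs = path_weight wt xs + path_weight wt ys"
        using is_path_join[OF xs(1) ys(1)] by metis
      moreover have "real_of_int (j - i) / (2 * real_of_int B)
          = 1/2 + real_of_int (j - (i + B)) / (2 * real_of_int B)"
        using B by (simp add: field_simps)
      ultimately show ?thesis using xs ys by (intro exI[of _ zs]) auto
    qed
  qed
  with that show ?thesis by blast
qed

lemma linked_geodesic_edge:
  assumes "linked E wt n B" "\<And>e. e \<in> all_edges \<Longrightarrow> 0 < wt e" "0 < B"
    and g: "is_geodesic E wt 0 n xs" and e: "(a, b) \<in> set (path_edges xs)" and "B \<le> b - a"
  shows "real_of_int (b - a) / (2 * real_of_int B) \<le> wt (a, b)"
proof -
  have "is_path E 0 n xs" using g by (simp add: is_geodesic_def)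
  from is_path_edgeD[OF this e] have "0 \<le> a" "b \<le> n" by auto
  then obtain ys where "is_path E a b ys" "real_of_int (b - a) / (2 * real_of_int B) \<le> path_weight wt ys"
    using linked_path assms by metis
  with geodesic_edge_ge[OF g e] show ?thesis by force
qed

section \<open>Excess weights and detours through a heavy edge\<close>

text \<open>A weight is at most the length of its edge plus this excess, and lengths telescope to
  \<open>b - a\<close> along a path. The light part of all paths is thus controlled at once, without
  a maximum over paths.\<close>

definition excess :: "(int \<times> int \<Rightarrow> real) \<Rightarrow> int \<times> int \<Rightarrow> real" where
  "excess wt f = (if real_of_int (snd f - fst f) < wt f then wt f else 0)"

lemma excess_nonneg: "f \<in> all_edges \<Longrightarrow> 0 \<le> excess wt f"
  by (auto simp: excess_def)

text \<open>The excess has summable expectation over the edges starting at a given vertex as soon as the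
  weights have a second moment; hence path weights grow at most linearly in the mean.\<close>

lemma path_weight_le_excess:
  assumes "is_path E a b xs"
  shows "path_weight wt xs \<le> real_of_int (b - a) + (\<Sum>f\<in>set (path_edges xs). excess wt f)"
proof -
  have "distinct xs" using is_path_bounds(1)[OF assms] strict_sorted_iff by auto
  then have "(\<Sum>f\<in>set (path_edges xs). excess wt f) = sum_list (map (excess wt) (path_edges xs))"
    by (simp add: sum_list_distinct_conv_sum_set distinct_path_edges)
  moreover have "path_weight wt xs \<le> real_of_int (b - a) + sum_list (map (excess wt) (path_edges xs))"
    using assms
  proof (induction xs arbitrary: a rule: induct_list012)
    case (3 x y zs)
    have "path_weight wt (y # zs) \<le> real_of_int (b - y) + sum_list (map (excess wt) (path_edges (y # zs)))"
      using 3(3) by (intro 3(2)) simp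
    moreover have "wt (x, y) \<le> real_of_int (y - x) + excess wt (x, y)"
      using 3(3) by (auto simp: excess_def)
    ultimately show ?case using 3(3) by simp
  qed (auto simp: is_path_def)
  ultimately show ?thesis by simp
qed

text \<open>Since no edge of the geodesic jumps over \<open>i - K\<close> or \<open>j + K\<close> by more than \<open>K\<close>, the geodesic visits
  some \<open>a \<in> (i - 2K, i - K]\<close> and \<open>b \<in> [j + K, j + 2K)\<close>. Were \<open>(i, j)\<close> not used, a detour from \<open>a\<close> to \<open>b\<close>
  through \<open>(i, j)\<close> would be heavier.\<close>

lemma geodesic_uses_edge:
  fixes K :: int
  assumes l: "linked E wt n B" and pos: "\<And>e. e \<in> all_edges \<Longrightarrow> 0 < wt e" and B: "0 < B" "B \<le> K"
    and g: "is_geodesic E wt 0 n xs"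
    and e: "(i, j) \<in> E" "i < j" "2 * K \<le> i" "j + 2 * K \<le> n"
    and cross: "\<And>x y. 0 \<le> x \<Longrightarrow> y \<le> n \<Longrightarrow> K \<le> y - x \<Longrightarrow> x \<le> i - K \<and> i - K < y \<or> x < j + K \<and> j + K \<le> y
        \<Longrightarrow> wt (x, y) < real_of_int (y - x) / (2 * real_of_int B)"
    and heavy: "real_of_int (j - i + 4 * K) +
        (\<Sum>f\<in>{(x, y). i - 2 * K \<le> x \<and> x < y \<and> y \<le> j + 2 * K} - {(i, j)}. excess wt f) < wt (i, j)"
  shows "(i, j) \<in> set (path_edges xs)"
proof (rule ccontr)
  assume not: "(i, j) \<notin> set (path_edges xs)"
  have p: "is_path E 0 n xs" using g by (simp add: is_geodesic_def)
  have sorted: "sorted_wrt (<) xs" using is_path_bounds[OF p] by simp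
  have short: "y - x < K" if "(x, y) \<in> set (path_edges xs)"
    "x \<le> i - K \<and> i - K < y \<or> x < j + K \<and> j + K \<le> y" for x y
  proof (rule ccontr)
    assume "\<not> y - x < K"
    moreover have "0 \<le> x" "y \<le> n" using is_path_edgeD[OF p that(1)] by auto
    ultimately show False
      using cross[of x y] that linked_geodesic_edge[OF l pos B(1) g that(1)] B by force
  qed
  have "0 \<in> set xs" "n \<in> set xs" using p unfolding is_path_def using hd_in_set last_in_set by metis+
  have ex1: "\<exists>x\<in>set xs. x \<le> i - K" using \<open>0 \<in> set xs\<close> e B by (intro bexI[of _ 0]) auto
  \<comment> \<open>\<open>a\<close> is the last vertex at or below \<open>i - K\<close>, so the
    edge leaving it crosses this boundary; likewise \<open>b\<close> below is the first later vertex
    at or beyond \<open>j + K\<close>. Crossing edges are shorter than \<open>K\<close>, which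
    confines \<open>a\<close> and \<open>b\<close>.\<close>
  obtain us a rest where xs1: "xs = us @ a # rest" and a: "a \<le> i - K" and rest: "\<forall>x\<in>set rest. \<not> x \<le> i - K"
    using split_list_last_prop[OF ex1] by blast
  have nr: "n \<in> set rest"
    using \<open>n \<in> set xs\<close> sorted a e B unfolding xs1 by (auto simp: sorted_wrt_append)
  obtain a' r' where r': "rest = a' # r'" using nr by (cases rest) auto
  have "(a, a') \<in> set (path_edges xs)" unfolding xs1 r' by (rule path_edges_append_Cons2)
  then have a2: "i - 2 * K < a" using short[of a a'] a rest r' by force
  have ex2: "\<exists>x\<in>set rest. j + K \<le> x" using nr e B by (intro bexI[of _ n]) auto
  obtain ms b vs where rest2: "rest = ms @ b # vs" and b: "j + K \<le> b" and ms: "\<forall>x\<in>set ms. \<not> j + K \<le> x"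
    using split_list_first_prop[OF ex2] by blast
  have xs2: "xs = us @ a # ms @ b # vs" using xs1 rest2 by simp
  have b2: "b < j + 2 * K"
  \<comment> \<open>With no vertex in between, the edge \<open>(a, b)\<close> would cross a boundary
    and be longer than \<open>K\<close>, which is impossible; otherwise the edge entering
    \<open>b\<close> is a short crossing edge.\<close>
  proof (cases "ms = []")
    case True
    then have "(a, b) \<in> set (path_edges xs)" unfolding xs2 by (simp add: path_edges_append_Cons2)
    with short[of a b] a b e B show ?thesis by auto
  next
    case False
    then obtain m' b' where ms': "ms = m' @ [b']" by (metis append_butlast_last_id)
    have "xs = (us @ a # m') @ b' # b # vs" using xs2 ms' by simp
    then have "(b', b) \<in> set (path_edges xs)" using path_edges_append_Cons2 by metis
    with short[of b' b] b ms ms' show ?thesis by auto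
  qed
  have pab: "is_path E a b (a # ms @ [b])"
    using p unfolding xs2 is_path_split[of E 0 n us a] using is_path_split[of E a n "a # ms" b vs] by auto
  have sub: "set (path_edges (a # ms @ [b])) \<subseteq> {(x, y). i - 2 * K \<le> x \<and> x < y \<and> y \<le> j + 2 * K} - {(i, j)}"
  proof (rule subsetI)
    fix f assume f: "f \<in> set (path_edges (a # ms @ [b]))"
    obtain x y where xy: "f = (x, y)" by (cases f)
    have "set (path_edges (a # ms @ [b])) \<subseteq> set (path_edges xs)"
      using path_edges_split[of us a "ms @ b # vs"] path_edges_split[of "a # ms" b vs] xs2 by auto
    then have "f \<noteq> (i, j)" using f not by blast
    moreover have "x < y" "a \<le> x" "y \<le> b" using is_path_edgeD[OF pab] f xy by blast+
    then have "i - 2 * K \<le> x" "x < y" "y \<le> j + 2 * K" using a2 b2 by linarith+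
    ultimately show "f \<in> {(x, y). i - 2 * K \<le> x \<and> x < y \<and> y \<le> j + 2 * K} - {(i, j)}"
      using xy by simp
  qed
  have fin: "finite {(x, y). i - 2 * K \<le> x \<and> x < y \<and> y \<le> j + 2 * K}"
    by (rule finite_subset[of _ "{i - 2*K..j + 2*K} \<times> {i - 2*K..j + 2*K}"]) auto
  have "path_weight wt (a # ms @ [b]) \<le> real_of_int (b - a) + (\<Sum>f\<in>set (path_edges (a # ms @ [b])). excess wt f)"
    by (rule path_weight_le_excess[OF pab])
  also have "\<dots> \<le> real_of_int (j - i + 4 * K) +
        (\<Sum>f\<in>{(x, y). i - 2 * K \<le> x \<and> x < y \<and> y \<le> j + 2 * K} - {(i, j)}. excess wt f)"
    by (intro add_mono sum_mono2) (use sub fin a2 b2 excess_nonneg in auto)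
  also note heavy
  finally have less: "path_weight wt (a # ms @ [b]) < wt (i, j)" .
  have "a < i" "j < b" "0 \<le> a" "b \<le> n"
    using a b B e is_path_bounds(2)[OF p] unfolding xs2 by auto
  \<comment> \<open>Since \<open>i - a\<close> and \<open>b - j\<close> are at least
    \<open>K\<close>, hence at least \<open>B\<close>, linking paths exist; of their weights only
    nonnegativity enters.\<close>
  obtain q1 where q1: "is_path E a i q1" "real_of_int (i - a) / (2 * real_of_int B) \<le> path_weight wt q1"
    using linked_path[OF l pos B(1), of a i] \<open>0 \<le> a\<close> e B a by auto
  obtain q2 where q2: "is_path E j b q2" "real_of_int (b - j) / (2 * real_of_int B) \<le> path_weight wt q2"
    using linked_path[OF l pos B(1), of j b] \<open>b \<le> n\<close> e B b by auto
  have "is_path E i j [i, j]" using e by simp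
  then obtain q3 where q3: "is_path E a j q3" "path_weight wt q3 = path_weight wt q1 + wt (i, j)"
    using is_path_join[OF q1(1), of j "[i, j]" wt] by auto
  obtain q4 where q4: "is_path E a b q4" "path_weight wt q4 = path_weight wt q3 + path_weight wt q2"
    using is_path_join[OF q3(1) q2(1)] by metis
  have "0 \<le> real_of_int (i - a) / (2 * real_of_int B)" "0 \<le> real_of_int (b - j) / (2 * real_of_int B)"
    using \<open>a < i\<close> \<open>j < b\<close> B by auto
  then have "wt (i, j) \<le> path_weight wt q4" using q1 q2 q3 q4 by linarith
  also have "\<dots> \<le> path_weight wt (a # ms @ [b])"
    using geodesic_segment[of E wt 0 n us a ms b vs q4] g q4 xs2 by simp
  finally show False using less by simp
qed

section \<open>Regularly varying tails\<close>

text \<open>Halving a point at or above \<open>2 * x0\<close> keeps it at or above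
  \<open>x0\<close>, and finitely many halvings lead below \<open>2 * x0\<close>. The behaviour of a
  tail under doubling, a single ratio, thus yields bounds on a whole half-line.\<close>

lemma dyadic_induct:
  fixes x x0 :: real
  assumes x0: "0 < x0" and base: "\<And>x. a \<le> x \<Longrightarrow> x < 2 * x0 \<Longrightarrow> P x"
    and step: "\<And>x. a \<le> x \<Longrightarrow> 2 * x0 \<le> x \<Longrightarrow> P (x / 2) \<Longrightarrow> P x"
    and a: "a \<le> x0" "a \<le> x"
  shows "P x"
proof -
  have "\<forall>x. a \<le> x \<longrightarrow> x < 2 ^ Suc k * x0 \<longrightarrow> P x" for k
  proof (induction k)
    case 0 then show ?case using base by auto
  next
    case (Suc k)
    show ?case
    proof (intro allI impI)
      fix x assume x: "a \<le> x" "x < 2 ^ Suc (Suc k) * x0"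
      show "P x"
      proof (cases "x < 2 * x0")
        case False
        then have "P (x / 2)" using Suc x a by auto
        with step x False show ?thesis by auto
      qed (use base x in auto)
    qed
  qed
  moreover obtain k where "x / x0 < 2 ^ k" using real_arch_pow[of 2] by auto
  then have "x < 2 ^ k * x0" using x0 by (simp add: field_simps)
  then have "x < 2 ^ Suc k * x0" using x0 by (smt (verit) mult_less_cancel_right power_strict_increasing_iff lessI)
  ultimately show ?thesis using a by blast
qed

locale regularly_varying =
  fixes G :: "real \<Rightarrow> real" and s :: real
  assumes antimono: "x \<le> y \<Longrightarrow> G y \<le> G x"
    and nonneg: "0 \<le> G x" and le_1: "G x \<le> 1"
    and index_pos: "0 < s"
    and ratio: "0 < t \<Longrightarrow> ((\<lambda>x. G (t * x) / G x) \<longlongrightarrow> t powr (- s)) at_top"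
begin

text \<open>Once zero, \<open>G\<close> stays zero, and then the quotient for \<open>t = 1\<close>
  is eventually \<open>0 / 0 = 0\<close> instead of tending to 1.\<close>

lemma pos: "0 < G x"
proof -
  have "eventually (\<lambda>y. 1/2 < G (1 * y) / G y) at_top"
    using ratio[of 1] by (intro order_tendstoD(1)) auto
  then have "eventually (\<lambda>y. x \<le> y \<and> 1/2 < G (1 * y) / G y) at_top"
    using eventually_ge_at_top eventually_conj by blast
  then obtain y where y: "x \<le> y" "1/2 < G (1 * y) / G y"
    using eventually_happens trivial_limit_at_top_linorder by blast
  then have "G y \<noteq> 0" by auto
  with y antimono[of x y] nonneg[of y] show ?thesis by linarith
qed

text \<open>One half of Potter's bounds. As \<open>2 powr (- s) < 2 powr (- r)\<close>, each
  doubling of a large argument shrinks \<open>G\<close> at least by the factor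
  \<open>2 powr (- r)\<close>. The constant makes the bound at least 1 below \<open>2 * x0\<close>,
  where \<open>G \<le> 1\<close> suffices.\<close>

lemma upper_bound:
  assumes "0 \<le> r" "r < s"
  obtains C where "0 < C" "\<And>x. 0 < x \<Longrightarrow> G x \<le> C * x powr (- r)"
proof -
  have "eventually (\<lambda>y. G (2 * y) / G y < 2 powr (- r)) at_top"
    using ratio[of 2] assms by (intro order_tendstoD(2)) auto
  then obtain x1 where x1: "\<And>y. x1 \<le> y \<Longrightarrow> G (2 * y) / G y < 2 powr (- r)"
    by (auto simp: eventually_at_top_linorder)
  define x0 where "x0 = max x1 1"
  have half: "G (2 * y) \<le> 2 powr (- r) * G y" if "x0 \<le> y" for y
    using x1[of y] that pos[of y] by (simp add: x0_def field_simps)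
  let ?C = "(2 * x0) powr r"
  have x0: "0 < x0" by (simp add: x0_def)
  have "G x \<le> ?C * x powr (- r)" if "0 < x" for x
  \<comment> \<open>The induction starts at \<open>min x x0\<close>, because \<open>x\<close> may be
    smaller than \<open>x0\<close>.\<close>
  proof (rule dyadic_induct[of x0 "min x x0" _ x])
    fix y assume y: "min x x0 \<le> y" "y < 2 * x0"
    then have "y > 0" using \<open>0 < x\<close> x0 by auto
    then have "1 \<le> (2 * x0 / y) powr r" using y assms by (intro ge_one_powr_ge_zero) auto
    also have "\<dots> = ?C * y powr (- r)" using y x0 \<open>0 < y\<close> by (simp add: powr_divide powr_minus field_simps)
    finally show "G y \<le> ?C * y powr (- r)" using le_1[of y] by linarith
  next
    fix y assume y: "2 * x0 \<le> y" "G (y / 2) \<le> ?C * (y / 2) powr (- r)"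
    have "G y \<le> 2 powr (- r) * G (y / 2)" using half[of "y / 2"] y by auto
    also have "\<dots> \<le> 2 powr (- r) * (?C * (y / 2) powr (- r))" using y by simp
    also have "\<dots> = ?C * y powr (- r)" using y x0 by (simp add: powr_divide)
    finally show "G y \<le> ?C * y powr (- r)" .
  qed (use x0 in auto)
  moreover have "0 < ?C" using x0 by simp
  ultimately show ?thesis using that by blast
qed

text \<open>The other half. The range starts at 1 because \<open>x powr (- r)\<close> blows up at 0;
  the constant \<open>G (2 * x0)\<close> is a lower bound of \<open>G\<close> on the initial range,
  where \<open>x powr (- r) \<le> 1\<close>.\<close>

lemma lower_bound:
  assumes "s < r"
  obtains c where "0 < c" "\<And>x. 1 \<le> x \<Longrightarrow> c * x powr (- r) \<le> G x"
proof -
  have "eventually (\<lambda>y. 2 powr (- r) < G (2 * y) / G y) at_top"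
    using ratio[of 2] assms by (intro order_tendstoD(1)) auto
  then obtain x1 where x1: "\<And>y. x1 \<le> y \<Longrightarrow> 2 powr (- r) < G (2 * y) / G y"
    by (auto simp: eventually_at_top_linorder)
  define x0 where "x0 = max x1 1"
  have half: "2 powr (- r) * G y \<le> G (2 * y)" if "x0 \<le> y" for y
    using x1[of y] that pos[of y] by (simp add: x0_def field_simps)
  let ?c = "G (2 * x0)"
  have x0: "0 < x0" "1 \<le> x0" by (simp_all add: x0_def)
  have "?c * x powr (- r) \<le> G x" if "1 \<le> x" for x
  proof (rule dyadic_induct[of x0 1 _ x])
    fix y assume y: "1 \<le> y" "y < 2 * x0"
    have "y powr (- r) \<le> 1" using y assms index_pos powr_mono[of "-r" 0 y] by auto
    then have "?c * y powr (- r) \<le> ?c" using nonneg by (simp add: mult_left_le)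
    also have "\<dots> \<le> G y" using antimono y by simp
    finally show "?c * y powr (- r) \<le> G y" .
  next
    fix y assume y: "2 * x0 \<le> y" "?c * (y / 2) powr (- r) \<le> G (y / 2)"
    have "?c * y powr (- r) = 2 powr (- r) * (?c * (y / 2) powr (- r))"
      using y x0 by (simp add: powr_divide)
    also have "\<dots> \<le> 2 powr (- r) * G (y / 2)" using y by simp
    also have "\<dots> \<le> G y" using half[of "y / 2"] y by auto
    finally show "?c * y powr (- r) \<le> G y" .
  qed (use x0 that in auto)
  moreover have "0 < ?c" by (rule pos)
  ultimately show ?thesis using that by blast
qed

text \<open>Continuity of \<open>t powr (- s)\<close> at \<open>t = 1\<close>: under the law
  conditioned to exceed \<open>x\<close>, a window of relative width \<epsilon> just above
  \<open>x\<close> has mass at most \<tau>. This is the source of all anticoncentration.\<close>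

lemma small_increments:
  assumes "0 < \<tau>"
  obtains \<epsilon> x0 where "0 < \<epsilon>" "\<And>x. x0 \<le> x \<Longrightarrow> G x - G ((1 + \<epsilon>) * x) \<le> \<tau> * G x"
proof -
  have "((\<lambda>e. (1 + e) powr (- s)) \<longlongrightarrow> (1 + 0) powr (- s)) (at_right (0::real))"
    by (intro tendsto_intros) auto
  then have "eventually (\<lambda>e. 1 - \<tau> < (1 + e) powr (- s)) (at_right (0::real))"
    using assms by (intro order_tendstoD(1)) auto
  then have "eventually (\<lambda>e. 0 < e \<and> 1 - \<tau> < (1 + e) powr (- s)) (at_right (0::real))"
    using eventually_at_right_less eventually_conj by blast
  then obtain e where e: "0 < e" "1 - \<tau> < (1 + e) powr (- s)"
    using eventually_happens trivial_limit_at_right_real by blast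
  have "eventually (\<lambda>y. 1 - \<tau> < G ((1 + e) * y) / G y) at_top"
    using ratio[of "1 + e"] e by (intro order_tendstoD(1)) auto
  then obtain x0 where x0: "\<And>y. x0 \<le> y \<Longrightarrow> 1 - \<tau> < G ((1 + e) * y) / G y"
    by (auto simp: eventually_at_top_linorder)
  have "G y - G ((1 + e) * y) \<le> \<tau> * G y" if "x0 \<le> y" for y
    using x0[OF that] pos[of y] by (simp add: field_simps)
  with e that show ?thesis by blast
qed

end

section \<open>Laws on the real line with polynomial tails\<close>

lemma (in real_distribution) cdf_compl: "1 - cdf M x = measure M {x<..}"
proof -
  have "{x<..} = space M - {..x}" by auto
  then show ?thesis unfolding cdf_def using prob_compl[of "{..x}"] by simp
qed

lemma (in real_distribution) regularly_varying_tailI: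
  assumes "0 < s" "regularly_varying_tail M s"
  shows "regularly_varying (\<lambda>x. measure M {x<..}) s"
  using assms by unfold_locales (auto simp: regularly_varying_tail_def cdf_compl intro!: finite_measure_mono)

text \<open>A discrete layer-cake argument: by the sum of odd numbers, \<open>x\<^sup>2\<close> is
  at most the sum of \<open>2 * n + 1\<close> over \<open>n < x\<close>, and the expectations of
  these terms are summable because \<open>r > 2\<close>.\<close>

lemma (in real_distribution) integrable_square:
  assumes r: "2 < r" and C: "\<And>x. 0 < x \<Longrightarrow> measure M {x<..} \<le> C * x powr (- r)"
    and pos: "AE x in M. 0 < x"
  shows "integrable M (\<lambda>x. x\<^sup>2)"
proof (rule integrableI_bounded)
  have bound: "ennreal (x\<^sup>2) \<le> (\<Sum>n. ennreal (2 * real n + 1) * indicator {real n<..} x)" if "0 < x" for x :: real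
  proof -
    define m where "m = nat \<lceil>x\<rceil>"
    have sq: "(\<Sum>n<k. 2 * real n + 1) = (real k)\<^sup>2" for k
      by (induction k) (auto simp: power2_eq_square algebra_simps)
    have "x \<le> real m" using \<open>0 < x\<close> by (simp add: m_def)
    then have "ennreal (x\<^sup>2) \<le> ennreal ((real m)\<^sup>2)" using that by (intro ennreal_leI power_mono) auto
    also have "\<dots> = (\<Sum>n<m. ennreal (2 * real n + 1))" by (subst sq[symmetric], subst sum_ennreal) auto
    also have "\<dots> = (\<Sum>n<m. ennreal (2 * real n + 1) * indicator {real n<..} x)"
    proof (rule sum.cong)
      fix n assume "n \<in> {..<m}"
      then have "real n < x" unfolding m_def by (simp, linarith)
      then show "ennreal (2 * real n + 1) = ennreal (2 * real n + 1) * indicator {real n<..} x" by simp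
    qed simp
    also have "\<dots> \<le> (\<Sum>n. ennreal (2 * real n + 1) * indicator {real n<..} x)"
      by (intro sum_le_suminf) auto
    finally show ?thesis .
  qed
  have C0: "0 \<le> C" using C[of 1] by (simp add: order_trans[OF measure_nonneg])
  \<comment> \<open>The term \<open>n = 0\<close> needs its own bound, since
    \<open>0 powr (1 - r)\<close> is 0.\<close>
  have summand: "(2 * real n + 1) * measure M {real n<..} \<le> indicator {0} n + 3 * C * real n powr (1 - r)" for n
  proof (cases "n = 0")
    case False
    then have "(2 * real n + 1) * measure M {real n<..} \<le> (3 * real n) * (C * real n powr (- r))"
      by (intro mult_mono C) auto
    also have "\<dots> = 3 * C * real n powr (1 - r)" using False by (simp add: powr_diff powr_minus field_simps)
    finally show ?thesis using False by simp
  qed simp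
  have summ: "summable (\<lambda>n. indicator {0::nat} n + 3 * C * real n powr (1 - r))"
    using r by (intro summable_add summable_mult)
      (auto simp: summable_real_powr_iff indicator_def intro!: summable_finite[of "{0}"])
  have "(\<integral>\<^sup>+ x. ennreal (norm (x\<^sup>2)) \<partial>M) \<le> (\<integral>\<^sup>+ x. (\<Sum>n. ennreal (2 * real n + 1) * indicator {real n<..} x) \<partial>M)"
    by (rule nn_integral_mono_AE) (use pos bound in \<open>auto elim!: eventually_mono\<close>)
  also have "\<dots> = (\<Sum>n. \<integral>\<^sup>+ x. ennreal (2 * real n + 1) * indicator {real n<..} x \<partial>M)"
    by (rule nn_integral_suminf) auto
  also have "\<dots> = (\<Sum>n. ennreal ((2 * real n + 1) * measure M {real n<..}))"
    by (simp add: nn_integral_cmult emeasure_eq_measure ennreal_mult'')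
  also have "\<dots> \<le> (\<Sum>n. ennreal (indicator {0} n + 3 * C * real n powr (1 - r)))"
    by (intro suminf_le ennreal_leI summand) auto
  also have "\<dots> < \<infinity>"
    using summ C0 by (subst suminf_ennreal_eq[OF _ summable_sums]) auto
  finally show "(\<integral>\<^sup>+ x. ennreal (norm (x\<^sup>2)) \<partial>M) < \<infinity>" .
qed simp

text \<open>The sum is grouped by length. Of the exponent \<open>d - r\<close> the part
  \<open>- (1 + \<kappa>)\<close> is reserved to make the sum over all lengths converge; the
  remaining power is nonincreasing, so it is largest at \<open>K\<close>. Later \<open>d\<close> is
  0 for edges inside an interval and 1 for edges crossing a point.\<close>

lemma sum_powr_length_le:
  fixes len :: "'b \<Rightarrow> nat" and K :: nat
  assumes fin: "finite F" and len: "\<And>f. f \<in> F \<Longrightarrow> K \<le> len f" and K: "1 \<le> K"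
    and card: "\<And>l. real (card {f \<in> F. len f = l}) \<le> c * real l powr d"
    and \<kappa>: "0 < \<kappa>" "d + 1 + \<kappa> \<le> r" and c: "0 \<le> c"
  shows "(\<Sum>f\<in>F. real (len f) powr (- r))
    \<le> c * real K powr (- (r - d - 1 - \<kappa>)) * (\<Sum>l. real l powr (- (1 + \<kappa>)))"
proof -
  have summ: "summable (\<lambda>l. real l powr (- (1 + \<kappa>)))"
    using \<kappa> by (simp add: summable_real_powr_iff)
  have "(\<Sum>f\<in>F. real (len f) powr (- r)) = (\<Sum>l\<in>len ` F. \<Sum>f\<in>{f \<in> F. len f = l}. real (len f) powr (- r))"
    using fin by (rule sum.image_gen)
  also have "\<dots> = (\<Sum>l\<in>len ` F. real (card {f \<in> F. len f = l}) * real l powr (- r))"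
    by (intro sum.cong) auto
  also have "\<dots> \<le> (\<Sum>l\<in>len ` F. c * real K powr (- (r - d - 1 - \<kappa>)) * real l powr (- (1 + \<kappa>)))"
  proof (rule sum_mono)
    fix l assume "l \<in> len ` F"
    then have l: "K \<le> l" using len by auto
    have "real (card {f \<in> F. len f = l}) * real l powr (- r) \<le> (c * real l powr d) * real l powr (- r)"
      using card by (intro mult_right_mono) auto
    also have "\<dots> = c * real l powr (- (r - d - 1 - \<kappa>)) * real l powr (- (1 + \<kappa>))"
      by (simp add: algebra_simps flip: powr_add)
    also have "\<dots> \<le> c * real K powr (- (r - d - 1 - \<kappa>)) * real l powr (- (1 + \<kappa>))"
      using l K \<kappa> c by (intro mult_right_mono mult_left_mono powr_mono2') auto
    finally show "real (card {f \<in> F. len f = l}) * real l powr (- r)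
      \<le> c * real K powr (- (r - d - 1 - \<kappa>)) * real l powr (- (1 + \<kappa>))" .
  qed
  also have "\<dots> \<le> c * real K powr (- (r - d - 1 - \<kappa>)) * (\<Sum>l. real l powr (- (1 + \<kappa>)))"
    unfolding sum_distrib_left[symmetric]
    using summ fin c by (intro mult_left_mono sum_le_suminf) auto
  finally show ?thesis .
qed

section \<open>Independence in the random model\<close>

definition edges_between :: "int \<Rightarrow> int \<Rightarrow> (int \<times> int) set" where
  "edges_between i j = {(a, b). i \<le> a \<and> a < b \<and> b \<le> j}"

lemma finite_edges_between [simp]: "finite (edges_between i j)"
  by (rule finite_subset[of _ "{i..j} \<times> {i..j}"]) (auto simp: edges_between_def)

lemma edges_between_subset: "edges_between i j \<subseteq> all_edges"
  by (auto simp: edges_between_def)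

lemma path_edges_between:
  "is_path E i j xs \<Longrightarrow> e \<in> set (path_edges xs) \<Longrightarrow> e \<in> edges_between i j"
  using is_path_edgeD by (cases e) (auto simp: edges_between_def)

lemma is_path_iff_all_edges:
  "is_path E i j xs \<longleftrightarrow> is_path all_edges i j xs \<and> set (path_edges xs) \<subseteq> E"
  by (auto simp: is_path_def)

text \<open>Paths from \<open>i\<close> to \<open>j\<close> never leave \<open>[i, j]\<close>. This
  locality makes the passage time independent of all other edges.\<close>

lemma max_weight_cong:
  assumes "\<And>e. e \<in> edges_between i j \<Longrightarrow> (e \<in> E \<longleftrightarrow> e \<in> E') \<and> wt e = wt' e"
  shows "max_weight E wt i j = max_weight E' wt' i j"
proof -
  have "is_path E i j xs \<longleftrightarrow> is_path E' i j xs" for xs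
    unfolding is_path_iff_all_edges[of E] is_path_iff_all_edges[of E']
    using path_edges_between assms by blast
  moreover have "path_weight wt xs = path_weight wt' xs" if "is_path E i j xs" for xs
    unfolding path_weight_def using path_edges_between[OF that] assms
    by (intro arg_cong[of _ _ sum_list] map_cong) auto
  ultimately show ?thesis unfolding max_weight_def by (intro SUP_cong) auto
qed

text \<open>The random set of paths is exchanged for the fixed finite set of all increasing paths,
  absent ones being given the value \<open>- \<infinity>\<close>. Suprema over a fixed countable set
  are measurable.\<close>

lemma max_weight_alt:
  "max_weight E wt i j = (SUP xs\<in>{xs. is_path all_edges i j xs}.
     if \<forall>e\<in>set (path_edges xs). e \<in> E then ereal (path_weight wt xs) else - \<infinity>)" (is "?l = ?r")
proof (rule antisym)
  show "?l \<le> ?r" unfolding max_weight_def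
  proof (rule SUP_least)
    fix xs assume "xs \<in> {xs. is_path E i j xs}"
    then have "is_path all_edges i j xs" "\<forall>e\<in>set (path_edges xs). e \<in> E"
      using is_path_iff_all_edges[of E] by auto
    then show "ereal (path_weight wt xs) \<le> ?r" by (intro SUP_upper2[of xs]) auto
  qed
  show "?r \<le> ?l"
  proof (rule SUP_least)
    fix xs assume "xs \<in> {xs. is_path all_edges i j xs}"
    then show "(if \<forall>e\<in>set (path_edges xs). e \<in> E then ereal (path_weight wt xs) else - \<infinity>) \<le> ?l"
      using is_path_iff_all_edges[of E i j xs] path_weight_le_max_weight[of E i j xs wt] by auto
  qed
qed

text \<open>The space \<open>N\<close> is arbitrary, since this serves both on the probability space
  and on a product space of coordinates.\<close>

lemma measurable_max_weight:
  assumes wt: "\<And>e. e \<in> edges_between i j \<Longrightarrow> (\<lambda>\<omega>. wt \<omega> e) \<in> borel_measurable N"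
    and E: "\<And>e. e \<in> edges_between i j \<Longrightarrow> Measurable.pred N (\<lambda>\<omega>. e \<in> E \<omega>)"
  shows "(\<lambda>\<omega>. max_weight (E \<omega>) (wt \<omega>) i j) \<in> borel_measurable N"
  unfolding max_weight_alt
proof (rule borel_measurable_SUP)
  show "countable {xs. is_path all_edges i j xs}" using finite_paths countable_finite by blast
  fix xs assume "xs \<in> {xs. is_path all_edges i j xs}"
  then have xs: "e \<in> edges_between i j" if "e \<in> set (path_edges xs)" for e
    using path_edges_between that by auto
  have [measurable]: "Measurable.pred N (\<lambda>\<omega>. \<forall>e\<in>set (path_edges xs). e \<in> E \<omega>)"
    using xs E by (intro pred_intros_finite) auto
  have "(\<lambda>\<omega>. sum_list (map (wt \<omega>) es)) \<in> borel_measurable N" if "set es \<subseteq> set (path_edges xs)" for es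
    using that by (induction es) (auto intro!: borel_measurable_add wt xs)
  then have [measurable]: "(\<lambda>\<omega>. path_weight (wt \<omega>) xs) \<in> borel_measurable N"
    unfolding path_weight_def by blast
  show "(\<lambda>\<omega>. if \<forall>e\<in>set (path_edges xs). e \<in> E \<omega> then ereal (path_weight (wt \<omega>) xs) else - \<infinity>)
      \<in> borel_measurable N"
    by measurable
qed

section \<open>Products and sums of independent variables\<close>

lemma sets_Collect_Ball_in:
  assumes "finite J" "\<And>j. j \<in> J \<Longrightarrow> f j \<in> measurable M (N j)" "\<And>j. j \<in> J \<Longrightarrow> A j \<in> sets (N j)"
  shows "{x \<in> space M. \<forall>j\<in>J. f j x \<in> A j} \<in> sets M"
proof (rule sets.sets_Collect_finite_All)
  fix j assume j: "j \<in> J"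
  have "{x \<in> space M. f j x \<in> A j} = f j -` A j \<inter> space M" by auto
  then show "{x \<in> space M. f j x \<in> A j} \<in> sets M"
    using measurable_sets[OF assms(2)[OF j] assms(3)[OF j]] by simp
qed fact

lemma (in prob_space) indep_vars_prob_Ball:
  assumes ind: "indep_vars N X I" and J: "finite J" "J \<subseteq> I" "\<And>j. j \<in> J \<Longrightarrow> A j \<in> sets (N j)"
  shows "prob {\<omega> \<in> space M. \<forall>j\<in>J. X j \<omega> \<in> A j} = (\<Prod>j\<in>J. prob {\<omega> \<in> space M. X j \<omega> \<in> A j})"
proof (cases "J = {}")
  case True then show ?thesis using prob_space by simp
next
  case False
  have "{\<omega> \<in> space M. \<forall>j\<in>J. X j \<omega> \<in> A j} = (\<Inter>j\<in>J. X j -` A j \<inter> space M)"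
    using False by auto
  moreover have "{\<omega> \<in> space M. X j \<omega> \<in> A j} = X j -` A j \<inter> space M" for j by auto
  ultimately show ?thesis using indep_varsD[OF ind False J] by simp
qed

text \<open>The joint law of \<open>X\<close> and \<open>R\<close> is a product, and for each fixed
  value \<open>r\<close> of \<open>R\<close> the section has probability at most \<open>q\<close>;
  Fubini's theorem integrates this over \<open>r\<close>.\<close>

lemma (in prob_space) indep_sum_concentration:
  fixes X R :: "'a \<Rightarrow> real"
  assumes ind: "indep_var borel X borel R" and q: "0 \<le> q"
    and le: "\<And>r. prob {\<omega> \<in> space M. H < X \<omega> \<and> y \<le> r + X \<omega> \<and> r + X \<omega> \<le> y + h} \<le> q"
  shows "prob {\<omega> \<in> space M. H < X \<omega> \<and> y \<le> R \<omega> + X \<omega> \<and> R \<omega> + X \<omega> \<le> y + h} \<le> q"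
proof -
  have rv [measurable]: "random_variable borel X" "random_variable borel R"
    using ind indep_var_rv1 indep_var_rv2 by blast+
  interpret X: prob_space "distr M borel X" by (rule prob_space_distr) simp
  interpret R: prob_space "distr M borel R" by (rule prob_space_distr) simp
  interpret XR: pair_prob_space "distr M borel X" "distr M borel R" ..
  define S where "S = {z :: real \<times> real. H < fst z \<and> y \<le> snd z + fst z \<and> snd z + fst z \<le> y + h}"
  have "Measurable.pred (borel \<Otimes>\<^sub>M borel) (\<lambda>z :: real \<times> real. H < fst z \<and> y \<le> snd z + fst z \<and> snd z + fst z \<le> y + h)"
    by measurable
  from predE[OF this] have S [measurable]: "S \<in> sets (borel \<Otimes>\<^sub>M borel)"
    unfolding S_def space_pair_measure space_borel UNIV_Times_UNIV by (rule back_subst[of "\<lambda>A. A \<in> sets _"]) auto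
  have "emeasure M {\<omega> \<in> space M. H < X \<omega> \<and> y \<le> R \<omega> + X \<omega> \<and> R \<omega> + X \<omega> \<le> y + h}
      = emeasure (distr M (borel \<Otimes>\<^sub>M borel) (\<lambda>\<omega>. (X \<omega>, R \<omega>))) S"
    by (subst emeasure_distr[OF _ S]) (auto intro!: arg_cong[of _ _ "emeasure M"] simp: S_def vimage_def)
  also have "\<dots> = emeasure (distr M borel X \<Otimes>\<^sub>M distr M borel R) S"
    using ind indep_var_distribution_eq by metis
  also have "\<dots> = (\<integral>\<^sup>+ r. emeasure (distr M borel X) ((\<lambda>x. (x, r)) -` S) \<partial>distr M borel R)"
    by (rule XR.emeasure_pair_measure_alt2) simp
  also have "\<dots> \<le> (\<integral>\<^sup>+ r. ennreal q \<partial>distr M borel R)"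
  proof (rule nn_integral_mono)
    fix r
    have "emeasure (distr M borel X) ((\<lambda>x. (x, r)) -` S)
       = emeasure M {\<omega> \<in> space M. H < X \<omega> \<and> y \<le> r + X \<omega> \<and> r + X \<omega> \<le> y + h}"
      by (subst emeasure_distr[OF _ sets_Pair2[OF S]])
        (auto intro!: arg_cong[of _ _ "emeasure M"] simp: S_def vimage_def)
    also have "\<dots> \<le> ennreal q" using le[of r] by (simp add: emeasure_eq_measure q)
    finally show "emeasure (distr M borel X) ((\<lambda>x. (x, r)) -` S) \<le> ennreal q" .
  qed
  also have "\<dots> = ennreal q" using R.emeasure_space_1 by simp
  finally show ?thesis by (simp add: emeasure_eq_measure q)
qed

context random_edge_lpp
begin

text \<open>The weights and the indicators of presence, merged into a single independent family.\<close>

definition field :: "(int \<times> int) \<times> bool \<Rightarrow> 'a \<Rightarrow> real" where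
  "field = (\<lambda>(e, b) \<omega>. if b then of_bool (pr e \<omega>) else v e \<omega>)"

lemma field_simps_bool [simp]:
  "field (e, False) \<omega> = v e \<omega>" "field (e, True) \<omega> = of_bool (pr e \<omega>)"
  by (simp_all add: field_def)

lemma v_measurable [measurable]: "e \<in> all_edges \<Longrightarrow> v e \<in> borel_measurable M"
  using weights_indep by (auto simp: indep_vars_def)

lemma pr_measurable [measurable]: "e \<in> all_edges \<Longrightarrow> pr e \<in> measurable M (count_space UNIV)"
  using presence_indep by (auto simp: indep_vars_def)

lemma field_measurable: "fst k \<in> all_edges \<Longrightarrow> field k \<in> borel_measurable M"
proof (cases k)
  case (Pair e b)
  assume "fst k \<in> all_edges"
  then have e: "e \<in> all_edges" using Pair by simp
  note [measurable] = v_measurable[OF e] pr_measurable[OF e]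
  show ?thesis unfolding Pair field_def by (cases b) (simp_all, measurable)
qed

text \<open>Finitely many conditions on weights form a cylinder event of the weight field, and
  likewise for presence. Independence of the two fields factors the joint event, independence within
  each field does the rest.\<close>

lemma prob_weights_presence:
  assumes J: "finite J" "J \<subseteq> all_edges" "finite J'" "J' \<subseteq> all_edges" and S: "\<And>e. e \<in> J \<Longrightarrow> S e \<in> sets borel"
  shows "prob {\<omega> \<in> space M. (\<forall>e\<in>J. v e \<omega> \<in> S e) \<and> (\<forall>e\<in>J'. pr e \<omega> \<in> S' e)}
    = (\<Prod>e\<in>J. prob {\<omega> \<in> space M. v e \<omega> \<in> S e}) * (\<Prod>e\<in>J'. prob {\<omega> \<in> space M. pr e \<omega> \<in> S' e})"
proof -
  let ?W = "\<lambda>\<omega>. \<lambda>e\<in>all_edges. v e \<omega>" and ?P = "\<lambda>\<omega>. \<lambda>e\<in>all_edges. pr e \<omega>"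
  let ?a = "{\<omega> \<in> space M. \<forall>e\<in>J. v e \<omega> \<in> S e}" and ?b = "{\<omega> \<in> space M. \<forall>e\<in>J'. pr e \<omega> \<in> S' e}"
  let ?A = "{z \<in> space (PiM all_edges (\<lambda>_. borel :: real measure)). \<forall>e\<in>J. z e \<in> S e}"
  let ?B = "{z \<in> space (PiM all_edges (\<lambda>_. count_space (UNIV :: bool set))). \<forall>e\<in>J'. z e \<in> S' e}"
  have comp: "{z \<in> space (PiM all_edges N). \<forall>e\<in>J. z e \<in> T e} \<in> sets (PiM all_edges N)"
    if "finite J" "J \<subseteq> all_edges" "\<And>e. e \<in> J \<Longrightarrow> T e \<in> sets (N e)" for J T and N :: "int \<times> int \<Rightarrow> 'c measure"
    using that by (intro sets_Collect_Ball_in[where N = N]) (auto intro: measurable_component_singleton)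
  have "?W -` ?A \<inter> space M = ?a" "?P -` ?B \<inter> space M = ?b"
    using J by (auto simp: space_PiM subset_iff)
  then have "?a \<in> sets (vimage_algebra (space M) ?W (PiM all_edges (\<lambda>_. borel)))"
    "?b \<in> sets (vimage_algebra (space M) ?P (PiM all_edges (\<lambda>_. count_space UNIV)))"
    using in_vimage_algebra[OF comp[of J S "\<lambda>_. borel"], of ?W "space M"]
      in_vimage_algebra[OF comp[of J' S' "\<lambda>_. count_space UNIV"], of ?P "space M"] J S by auto
  then have "prob (?a \<inter> ?b) = prob ?a * prob ?b"
    by (rule indep_setD[OF weights_presence_indep])
  moreover have "?a \<inter> ?b = {\<omega> \<in> space M. (\<forall>e\<in>J. v e \<omega> \<in> S e) \<and> (\<forall>e\<in>J'. pr e \<omega> \<in> S' e)}" by auto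
  ultimately show ?thesis
    using indep_vars_prob_Ball[OF weights_indep J(1,2) S] indep_vars_prob_Ball[OF presence_indep J(3,4), of S']
    by simp
qed

text \<open>A finite set of coordinates splits into weights and presence indicators, and the product
  formula for such a pair of sets is already available.\<close>

lemma indep_vars_field: "indep_vars (\<lambda>_. borel) field (all_edges \<times> UNIV)"
  unfolding indep_vars_def2
proof (intro conjI ballI indep_setsI)
  fix k assume "k \<in> all_edges \<times> (UNIV :: bool set)"
  then show m: "field k \<in> borel_measurable M" by (intro field_measurable) auto
  then show "{field k -` A \<inter> space M |A. A \<in> sets borel} \<subseteq> events" by (auto intro: measurable_sets)
next
  fix A and J :: "((int \<times> int) \<times> bool) set"
  assume J: "J \<noteq> {}" "J \<subseteq> all_edges \<times> UNIV" "finite J"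
    and A: "\<forall>k\<in>J. A k \<in> {field k -` A \<inter> space M |A. A \<in> sets borel}"
  obtain S where S: "\<And>k. k \<in> J \<Longrightarrow> A k = field k -` S k \<inter> space M" "\<And>k. k \<in> J \<Longrightarrow> S k \<in> sets borel"
    using A by (auto dest!: bchoice)
  let ?J = "\<lambda>b. {e. (e, b) \<in> J}"
  have fin: "finite (?J b)" for b
    by (rule finite_subset[of _ "fst ` J"]) (use J in force)+
  have sub: "?J b \<subseteq> all_edges" for b using J by auto
  have "J = (\<lambda>e. (e, False)) ` ?J False \<union> (\<lambda>e. (e, True)) ` ?J True"
    by (auto simp: image_iff) (metis (full_types))
  then have prod: "(\<Prod>k\<in>J. g k) = (\<Prod>e\<in>?J False. g (e, False)) * (\<Prod>e\<in>?J True. g (e, True))" for g :: "_ \<Rightarrow> real"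
    by (subst (1) \<open>J = _\<close>, subst prod.union_disjoint) (use fin in \<open>auto simp: prod.reindex inj_on_def\<close>)
  let ?T = "\<lambda>e. {b. of_bool b \<in> S (e, True)}"
  have "(\<Inter>k\<in>J. A k) = {\<omega> \<in> space M. (\<forall>e\<in>?J False. v e \<omega> \<in> S (e, False)) \<and> (\<forall>e\<in>?J True. pr e \<omega> \<in> ?T e)}"
    (is "?L = ?R")
  proof (rule set_eqI)
    fix \<omega>
    have "\<omega> \<in> ?L \<longleftrightarrow> \<omega> \<in> space M \<and> (\<forall>k\<in>J. field k \<omega> \<in> S k)" using S J(1) by auto
    also have "(\<forall>k\<in>J. field k \<omega> \<in> S k) \<longleftrightarrow> (\<forall>e. (e, False) \<in> J \<longrightarrow> field (e, False) \<omega> \<in> S (e, False)) \<and>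
       (\<forall>e. (e, True) \<in> J \<longrightarrow> field (e, True) \<omega> \<in> S (e, True))"
      by (metis (full_types) surj_pair)
    finally show "\<omega> \<in> ?L \<longleftrightarrow> \<omega> \<in> ?R" by auto
  qed
  then have "prob (\<Inter>k\<in>J. A k) = (\<Prod>e\<in>?J False. prob {\<omega> \<in> space M. v e \<omega> \<in> S (e, False)}) *
      (\<Prod>e\<in>?J True. prob {\<omega> \<in> space M. pr e \<omega> \<in> ?T e})"
    using prob_weights_presence[OF fin sub fin sub, of False "\<lambda>e. S (e, False)" True ?T] S by simp
  also have "\<dots> = (\<Prod>k\<in>J. prob (A k))"
    unfolding prod
    by (intro arg_cong2[of _ _ _ _ "(*)"] prod.cong arg_cong[of _ _ prob]) (auto simp: S)
  finally show "prob (\<Inter>k\<in>J. A k) = (\<Prod>k\<in>J. prob (A k))" .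
qed

lemma measure_law: "e \<in> all_edges \<Longrightarrow> S \<in> sets borel \<Longrightarrow> prob {\<omega> \<in> space M. v e \<omega> \<in> S} = measure \<mu> S"
  by (subst weights_law[symmetric, of e]) (auto simp: measure_distr vimage_def Int_def conj_commute)

text \<open>Each block is an attempt that succeeds if all its coordinates fall into
  \<open>S\<close>; disjoint blocks make the attempts independent. Attempts will be the midpoints of
  a hop, or the candidates for a present heavy edge.\<close>

lemma prob_blocks:
  assumes L: "finite L" "\<And>l. l \<in> L \<Longrightarrow> finite (K l)" "\<And>l. l \<in> L \<Longrightarrow> K l \<subseteq> all_edges \<times> UNIV"
    and disj: "disjoint_family_on K L" and S: "\<And>k. S k \<in> sets borel"
  shows "prob {\<omega> \<in> space M. \<forall>l\<in>L. \<exists>k\<in>K l. field k \<omega> \<notin> S k}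
    = (\<Prod>l\<in>L. 1 - (\<Prod>k\<in>K l. prob {\<omega> \<in> space M. field k \<omega> \<in> S k}))"
proof -
  let ?A = "\<lambda>l. {z \<in> space (PiM (K l) (\<lambda>_. borel)). \<exists>k\<in>K l. z k \<notin> S k}"
  have A: "?A l \<in> sets (PiM (K l) (\<lambda>_. borel))" if "l \<in> L" for l
  proof -
    have "?A l = space (PiM (K l) (\<lambda>_. borel)) - {z \<in> space (PiM (K l) (\<lambda>_. borel)). \<forall>k\<in>K l. z k \<in> S k}"
      by auto
    then show ?thesis
      using sets_Collect_Ball_in[OF L(2)[OF that], of "\<lambda>k z. z k" _ "\<lambda>_. borel" S] S
      by (simp add: measurable_component_singleton)
  qed
  have "{\<omega> \<in> space M. \<forall>l\<in>L. \<exists>k\<in>K l. field k \<omega> \<notin> S k}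
      = {\<omega> \<in> space M. \<forall>l\<in>L. (\<lambda>k\<in>K l. field k \<omega>) \<in> ?A l}"
    by (auto simp: space_PiM)
  also have "prob \<dots> = (\<Prod>l\<in>L. prob {\<omega> \<in> space M. (\<lambda>k\<in>K l. field k \<omega>) \<in> ?A l})"
    by (rule indep_vars_prob_Ball[OF indep_vars_restrict[OF indep_vars_field L(3) disj]])
      (use L(1) A in auto)
  also have "\<dots> = (\<Prod>l\<in>L. 1 - (\<Prod>k\<in>K l. prob {\<omega> \<in> space M. field k \<omega> \<in> S k}))"
  proof (rule prod.cong)
    fix l assume l: "l \<in> L"
    have ev: "{\<omega> \<in> space M. \<forall>k\<in>K l. field k \<omega> \<in> S k} \<in> events"
      using L(2,3)[OF l] S by (intro sets_Collect_Ball_in[where N = "\<lambda>_. borel"] field_measurable) auto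
    have "{\<omega> \<in> space M. (\<lambda>k\<in>K l. field k \<omega>) \<in> ?A l} = space M - {\<omega> \<in> space M. \<forall>k\<in>K l. field k \<omega> \<in> S k}"
      by (auto simp: space_PiM)
    then have "prob {\<omega> \<in> space M. (\<lambda>k\<in>K l. field k \<omega>) \<in> ?A l} = 1 - prob {\<omega> \<in> space M. \<forall>k\<in>K l. field k \<omega> \<in> S k}"
      using prob_compl[OF ev] by simp
    also have "prob {\<omega> \<in> space M. \<forall>k\<in>K l. field k \<omega> \<in> S k} = (\<Prod>k\<in>K l. prob {\<omega> \<in> space M. field k \<omega> \<in> S k})"
      by (rule indep_vars_prob_Ball[OF indep_vars_field L(2,3)[OF l] S])
    finally show "prob {\<omega> \<in> space M. (\<lambda>k\<in>K l. field k \<omega>) \<in> ?A l}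
      = 1 - (\<Prod>k\<in>K l. prob {\<omega> \<in> space M. field k \<omega> \<in> S k})" .
  qed simp
  finally show ?thesis .
qed

lemma prob_present: "e \<in> all_edges \<Longrightarrow> prob {\<omega> \<in> space M. field (e, True) \<omega> \<in> {1}} = p"
  using presence_prob[of e] by simp

lemma prob_two_weights:
  assumes "e \<in> all_edges" "f \<in> all_edges" "e \<noteq> f" "S \<in> sets borel" "T \<in> sets borel"
  shows "prob {\<omega> \<in> space M. v e \<omega> \<in> S \<and> v f \<omega> \<in> T} = measure \<mu> S * measure \<mu> T"
  using indep_vars_prob_Ball[OF weights_indep, of "{e, f}" "\<lambda>g. if g = e then S else T"] assms
  by (simp add: measure_law)

lemma measurable_max_path_weight [measurable]: "max_path_weight v pr i j \<in> borel_measurable M"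
  unfolding max_path_weight_def[abs_def] present_edges_def
  using edges_between_subset by (intro measurable_max_weight) (auto simp: edges_between_def)

text \<open>The edge \<open>(i, j)\<close> lies neither in \<open>[a, i]\<close> nor in
  \<open>[j, b]\<close>, so the two sides read disjoint sets of coordinates of the field.\<close>

lemma indep_var_weight_rest:
  assumes "i < j"
  shows "indep_var borel (v (i, j)) borel (\<lambda>\<omega>. real_of_ereal (max_path_weight v pr a i \<omega>)
    + real_of_ereal (max_path_weight v pr j b \<omega>))"
proof -
  let ?A = "{((i, j), False)}" and ?B = "(edges_between a i \<union> edges_between j b) \<times> (UNIV :: bool set)"
  \<comment> \<open>\<open>?F\<close> recomputes a passage time from coordinates: an edge counts as
    present if its \<open>True\<close> coordinate equals 1.\<close>
  let ?F = "\<lambda>x y z. max_weight {e. z (e, True) = (1::real)} (\<lambda>e. z (e, False)) x y"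
  have ind: "indep_var (PiM ?A (\<lambda>_. borel)) (\<lambda>\<omega>. \<lambda>k\<in>?A. field k \<omega>) (PiM ?B (\<lambda>_. borel)) (\<lambda>\<omega>. \<lambda>k\<in>?B. field k \<omega>)"
    by (rule indep_var_restrict[OF indep_vars_field]) (use assms in \<open>auto simp: edges_between_def\<close>)
  have F: "?F x y \<in> borel_measurable (PiM ?B (\<lambda>_. borel))"
    if "edges_between x y \<times> UNIV \<subseteq> ?B" for x y
  proof (rule measurable_max_weight)
    fix e assume "e \<in> edges_between x y"
    then have [measurable]: "(\<lambda>z. z (e, b)) \<in> borel_measurable (PiM ?B (\<lambda>_. borel))" for b
      using that by (intro measurable_component_singleton) auto
    show "(\<lambda>z. z (e, False)) \<in> borel_measurable (PiM ?B (\<lambda>_. borel))" by measurable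
    show "Measurable.pred (PiM ?B (\<lambda>_. borel)) (\<lambda>z. e \<in> {e. z (e, True) = (1::real)})"
      unfolding mem_Collect_eq by (rule pred_eq_const1[where N = borel]) auto
  qed
  have eq: "?F x y (\<lambda>k\<in>?B. field k \<omega>) = max_path_weight v pr x y \<omega>"
    if "edges_between x y \<times> UNIV \<subseteq> ?B" for x y \<omega>
    unfolding max_path_weight_def present_edges_def
    by (rule max_weight_cong) (use that in \<open>auto simp: subset_iff\<close>)
  have subs: "edges_between a i \<times> UNIV \<subseteq> ?B" "edges_between j b \<times> UNIV \<subseteq> ?B" by auto
  have "indep_var borel ((\<lambda>z. z ((i, j), False)) \<circ> (\<lambda>\<omega>. \<lambda>k\<in>?A. field k \<omega>)) borel
      ((\<lambda>z. real_of_ereal (?F a i z) + real_of_ereal (?F j b z)) \<circ> (\<lambda>\<omega>. \<lambda>k\<in>?B. field k \<omega>))"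
  proof (rule indep_var_compose[OF ind])
    show "(\<lambda>z. z ((i, j), False)) \<in> borel_measurable (PiM ?A (\<lambda>_. borel))"
      by (rule measurable_component_singleton) simp
    show "(\<lambda>z. real_of_ereal (?F a i z) + real_of_ereal (?F j b z)) \<in> borel_measurable (PiM ?B (\<lambda>_. borel))"
      by (intro borel_measurable_add borel_measurable_real_of_ereal F) auto
  qed
  then show ?thesis unfolding comp_def eq[OF subs(1)] eq[OF subs(2)] by simp
qed

end

section \<open>Estimates under a regularly varying tail\<close>

definition edge_length :: "int \<times> int \<Rightarrow> nat" where
  "edge_length f = nat (snd f - fst f)"

lemma edge_length_pos: "f \<in> all_edges \<Longrightarrow> 1 \<le> edge_length f"
  and real_edge_length: "f \<in> all_edges \<Longrightarrow> real (edge_length f) = real_of_int (snd f - fst f)"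
  by (auto simp: edge_length_def)

lemma sum_edges_between_le:
  fixes g :: "nat \<Rightarrow> real"
  assumes "a \<le> b" "\<And>l. 0 \<le> g l"
  shows "(\<Sum>f\<in>edges_between a b. g (edge_length f)) \<le> real_of_int (b - a + 1) * (\<Sum>l\<in>{1..nat (b - a)}. g l)"
proof -
  let ?h = "\<lambda>(x, l). (x, x + int l)" and ?D = "{a..b} \<times> {1..nat (b - a)}"
  have "edges_between a b \<subseteq> ?h ` ?D"
  proof
    fix f assume "f \<in> edges_between a b"
    then have "f = ?h (fst f, edge_length f)" "(fst f, edge_length f) \<in> ?D"
      by (auto simp: edges_between_def edge_length_def)
    then show "f \<in> ?h ` ?D" by (rule image_eqI)
  qed
  then have "(\<Sum>f\<in>edges_between a b. g (edge_length f)) \<le> (\<Sum>f\<in>?h ` ?D. g (edge_length f))"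
    by (intro sum_mono2) (use assms in auto)
  also have "\<dots> = (\<Sum>(x, l)\<in>?D. g l)"
    by (subst sum.reindex) (auto simp: inj_on_def edge_length_def intro!: sum.cong)
  also have "\<dots> = real_of_int (b - a + 1) * (\<Sum>l\<in>{1..nat (b - a)}. g l)"
    using assms by (simp add: sum.cartesian_product[symmetric])
  finally show ?thesis .
qed

text \<open>An edge of length \<open>l\<close> over a given point can start at only \<open>l\<close>
  places, and there are two points.\<close>

lemma card_edges_crossing:
  assumes "finite F"
    and F: "\<And>x y. (x, y) \<in> F \<Longrightarrow> x < y \<and> (x \<le> q \<and> q < y \<or> x < q' \<and> q' \<le> y)"
  shows "card {f \<in> F. edge_length f = l} \<le> 2 * l"
proof -
  let ?h = "\<lambda>x. (x, x + int l)"
  have "{f \<in> F. edge_length f = l} \<subseteq> ?h ` {q - int l<..q} \<union> ?h ` {q' - int l..<q'}"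
  proof
    fix f assume f: "f \<in> {f \<in> F. edge_length f = l}"
    then have "f = ?h (fst f)" "fst f \<in> {q - int l<..q} \<or> fst f \<in> {q' - int l..<q'}"
      using F[of "fst f" "snd f"] by (auto simp: edge_length_def prod_eq_iff)
    then show "f \<in> ?h ` {q - int l<..q} \<union> ?h ` {q' - int l..<q'}" by blast
  qed
  then have "card {f \<in> F. edge_length f = l} \<le> card (?h ` {q - int l<..q} \<union> ?h ` {q' - int l..<q'})"
    by (intro card_mono) auto
  also have "\<dots> \<le> card {q - int l<..q} + card {q' - int l..<q'}"
    by (intro order_trans[OF card_Un_le] add_mono card_image_le) auto
  finally show ?thesis by simp
qed

lemma card_edges_between_length: "card {f \<in> edges_between 0 (int n). edge_length f = l} \<le> n + 1"
proof -
  have "{f \<in> edges_between 0 (int n). edge_length f = l} \<subseteq> (\<lambda>x. (x, x + int l)) ` {0..int n}"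
    by (auto simp: edges_between_def edge_length_def image_iff)
  then have "card {f \<in> edges_between 0 (int n). edge_length f = l} \<le> card ((\<lambda>x. (x, x + int l)) ` {0..int n})"
    by (intro card_mono) auto
  also have "\<dots> \<le> card {0..int n}" by (rule card_image_le) simp
  finally show ?thesis by simp
qed

section \<open>Tails and moments of a single weight\<close>

locale heavy_edge_lpp = random_edge_lpp +
  fixes s :: real
  assumes s_gt_2: "2 < s" and rv_tail: "regularly_varying_tail \<mu> s"
begin

definition G :: "real \<Rightarrow> real" where "G x = measure \<mu> {x<..}"

lemma real_distribution_law: "real_distribution \<mu>"
  using real_distribution_distr[of "v (0, 1)"] weights_law[of "(0, 1)"] v_measurable[of "(0, 1)"] by simp

sublocale law: real_distribution \<mu> by (rule real_distribution_law)

sublocale G: regularly_varying G s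
  using law.regularly_varying_tailI[OF _ rv_tail] s_gt_2 unfolding G_def[abs_def] by simp

lemma prob_heavy: "e \<in> all_edges \<Longrightarrow> prob {\<omega> \<in> space M. x < v e \<omega>} = G x"
  using measure_law[of e "{x<..}"] by (simp add: G_def)

text \<open>Passing to \<open>x / 2\<close> turns the closed half-line into an open one at the price
  of a constant.\<close>

lemma tail_bound:
  assumes "0 \<le> r" "r < s"
  obtains C where "0 < C" "\<And>x. 0 < x \<Longrightarrow> measure \<mu> {x..} \<le> C * x powr (- r)"
proof -
  obtain C where C: "0 < C" "\<And>x. 0 < x \<Longrightarrow> G x \<le> C * x powr (- r)"
    using G.upper_bound[OF assms] by metis
  have "measure \<mu> {x..} \<le> (C * 2 powr r) * x powr (- r)" if "0 < x" for x
  proof -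
    have "measure \<mu> {x..} \<le> G (x / 2)"
      unfolding G_def using that by (intro law.finite_measure_mono) auto
    also have "\<dots> \<le> C * (x / 2) powr (- r)" using C that by simp
    also have "\<dots> = (C * 2 powr r) * x powr (- r)"
      using that by (simp add: powr_divide powr_minus field_simps)
    finally show ?thesis .
  qed
  then show ?thesis using that[of "C * 2 powr r"] C by simp
qed

lemma integrable_square: "integrable \<mu> (\<lambda>x. x\<^sup>2)"
proof -
  obtain r where r: "2 < r" "r < s" using dense s_gt_2 by blast
  obtain C where "\<And>x. 0 < x \<Longrightarrow> G x \<le> C * x powr (- r)"
    using G.upper_bound[of r] r by auto
  then show ?thesis
    using law.integrable_square[OF r(1) _ weights_pos] unfolding G_def by blast
qed

definition V2 :: real where "V2 = (\<integral>x. x\<^sup>2 \<partial>\<mu>)"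

lemma V2_nonneg: "0 \<le> V2" by (simp add: V2_def)

lemma AE_weights_pos: "AE \<omega> in M. \<forall>e\<in>all_edges. 0 < v e \<omega>"
proof -
  have "countable (all_edges)" by (rule countableI_type)
  moreover have "AE \<omega> in M. 0 < v e \<omega>" if "e \<in> all_edges" for e
    using weights_pos that by (subst (asm) weights_law[symmetric, OF that], subst (asm) AE_distr_iff) auto
  ultimately show ?thesis using AE_ball_countable[of all_edges "\<lambda>\<omega> e. 0 < v e \<omega>"] by blast
qed

lemma indep_var_two_weights:
  assumes "e \<in> all_edges" "f \<in> all_edges" "e \<noteq> f"
  shows "indep_var borel (v e) borel (v f)"
proof -
  have "indep_var borel ((\<lambda>z. z (e, False)) \<circ> (\<lambda>\<omega>. \<lambda>k\<in>{(e, False)}. field k \<omega>)) borel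
      ((\<lambda>z. z (f, False)) \<circ> (\<lambda>\<omega>. \<lambda>k\<in>{(f, False)}. field k \<omega>))"
    by (rule indep_var_compose[OF indep_var_restrict[OF indep_vars_field]])
      (use assms in \<open>auto intro!: measurable_component_singleton\<close>)
  then show ?thesis by (simp add: comp_def)
qed

text \<open>This is the mean excess of an edge of length \<open>l\<close>.\<close>

definition cut_mean :: "nat \<Rightarrow> real" where
  "cut_mean l = (\<integral>x. (if real l < x then x else 0) \<partial>\<mu>)"

lemma integrable_cut: "integrable \<mu> (\<lambda>x. if real l < x then x else 0)"
proof (rule Bochner_Integration.integrable_bound[OF law.square_integrable_imp_integrable[OF _ integrable_square]])
  show "AE x in \<mu>. norm (if real l < x then x else 0) \<le> norm x" by auto
qed auto

lemma cut_mean_nonneg: "0 \<le> cut_mean l"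
  unfolding cut_mean_def by (rule integral_nonneg_AE) auto

text \<open>After interchanging sum and integral, \<open>x\<close> is counted once for every
  \<open>l < x\<close>, so at most \<open>x\<close> times. The second moment thus bounds the mean
  total excess of the edges leaving one vertex.\<close>

lemma sum_cut_mean_le: "(\<Sum>l\<in>{1..N}. cut_mean l) \<le> V2"
proof -
  have "(\<Sum>l\<in>{1..N}. cut_mean l) = (\<integral>x. (\<Sum>l\<in>{1..N}. if real l < x then x else 0) \<partial>\<mu>)"
    unfolding cut_mean_def by (rule Bochner_Integration.integral_sum[symmetric]) (rule integrable_cut)
  also have "\<dots> \<le> V2" unfolding V2_def
  proof (rule integral_mono_AE)
    have "(\<Sum>l\<in>{1..N}. if real l < x then x else 0) \<le> x\<^sup>2" if "0 < x" for x :: real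
    proof -
      have "(\<Sum>l\<in>{1..N}. if real l < x then x else 0) = x * real (card {l \<in> {1..N}. real l < x})"
        by (simp add: sum.If_cases Int_def)
      also have "\<dots> \<le> x * x"
      proof (rule mult_left_mono)
        have "{l \<in> {1..N}. real l < x} \<subseteq> {1..nat \<lfloor>x\<rfloor>}" by (auto simp: le_nat_floor)
        then have "card {l \<in> {1..N}. real l < x} \<le> nat \<lfloor>x\<rfloor>" using card_mono[of "{1..nat \<lfloor>x\<rfloor>}"] by force
        then show "real (card {l \<in> {1..N}. real l < x}) \<le> x" using that by linarith
      qed (use that in simp)
      finally show ?thesis by (simp add: power2_eq_square)
    qed
    then show "AE x in \<mu>. (\<Sum>l\<in>{1..N}. if real l < x then x else 0) \<le> x\<^sup>2"
      using weights_pos by (auto elim: eventually_mono)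
  qed (auto intro!: Bochner_Integration.integrable_sum integrable_cut integrable_square)
  finally show ?thesis .
qed

lemma excess_conv: "f \<in> all_edges \<Longrightarrow>
    excess (\<lambda>e. v e \<omega>) f = (if real (edge_length f) < v f \<omega> then v f \<omega> else 0)"
  by (simp add: excess_def real_edge_length)

lemma measurable_excess [measurable]:
  "f \<in> all_edges \<Longrightarrow> (\<lambda>\<omega>. excess (\<lambda>e. v e \<omega>) f) \<in> borel_measurable M"
  unfolding excess_def by measurable

lemma integrable_excess:
  assumes "f \<in> all_edges"
  shows "integrable M (\<lambda>\<omega>. excess (\<lambda>e. v e \<omega>) f)" "expectation (\<lambda>\<omega>. excess (\<lambda>e. v e \<omega>) f) = cut_mean (edge_length f)"
proof -
  have "integrable (distr M borel (v f)) (\<lambda>x. if real (edge_length f) < x then x else 0)"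
    using integrable_cut weights_law[OF assms] by simp
  then show "integrable M (\<lambda>\<omega>. excess (\<lambda>e. v e \<omega>) f)"
    using assms by (subst (asm) integrable_distr_eq) (auto simp: excess_conv)
  show "expectation (\<lambda>\<omega>. excess (\<lambda>e. v e \<omega>) f) = cut_mean (edge_length f)"
    unfolding cut_mean_def using assms
    by (subst weights_law[OF assms, symmetric], subst integral_distr) (auto simp: excess_conv)
qed

text \<open>Markov's inequality for the excess times the indicator of \<open>H < v e\<close>.
  Leaving out \<open>e\<close> makes these factors independent, so \<open>G H\<close> splits off as
  if by conditioning; each of the \<open>b - a + 1\<close> starting points contributes at most
  \<open>V2\<close>.\<close>

lemma prob_heavy_excess:
  assumes e: "e \<in> all_edges" and ab: "a \<le> b" and z: "0 < z"
  shows "prob {\<omega> \<in> space M. H < v e \<omega> \<and> z \<le> (\<Sum>f\<in>edges_between a b - {e}. excess (\<lambda>e. v e \<omega>) f)}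
    \<le> G H * (real_of_int (b - a + 1) * V2 / z)" (is "prob ?A \<le> _")
proof -
  let ?W = "edges_between a b - {e}"
  let ?I = "\<lambda>\<omega>. indicator {H<..} (v e \<omega>) :: real"
  let ?X = "\<lambda>f \<omega>. excess (\<lambda>e. v e \<omega>) f"
  have W: "f \<in> all_edges" "f \<noteq> e" if "f \<in> ?W" for f using that edges_between_subset by auto
  have [measurable]: "v e \<in> borel_measurable M" using e by (rule v_measurable)
  have [measurable]: "(\<lambda>\<omega>. \<Sum>f\<in>?W. ?X f \<omega>) \<in> borel_measurable M"
    using W by (intro borel_measurable_sum measurable_excess) auto
  have prod: "integrable M (\<lambda>\<omega>. ?I \<omega> * ?X f \<omega>) \<and> expectation (\<lambda>\<omega>. ?I \<omega> * ?X f \<omega>) = G H * cut_mean (edge_length f)"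
    if f: "f \<in> ?W" for f
  proof -
    have "indep_var borel ((\<lambda>x. indicator {H<..} x :: real) \<circ> v e) borel
        ((\<lambda>x. if real (edge_length f) < x then x else 0) \<circ> v f)"
      by (rule indep_var_compose[OF indep_var_two_weights]) (use e W[OF f] in auto)
    then have ind: "indep_var borel ?I borel (?X f)"
      using W(1)[OF f] by (simp add: comp_def excess_conv)
    have I: "integrable M ?I" by (rule integrable_const_bound[of _ 1]) auto
    have "?I \<omega> = indicator {\<omega> \<in> space M. H < v e \<omega>} \<omega>" if "\<omega> \<in> space M" for \<omega>
      using that by (simp add: indicator_def)
    then have "expectation ?I = expectation (indicator {\<omega> \<in> space M. H < v e \<omega>})"
      by (intro Bochner_Integration.integral_cong) auto
    then have "expectation ?I = G H" using prob_heavy[OF e, of H] by simp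
    then show ?thesis
      using indep_var_integrable[OF ind I] indep_var_lebesgue_integral[OF ind I] integrable_excess[OF W(1)[OF f]]
      by simp
  qed
  have "prob ?A \<le> prob {\<omega> \<in> space M. z \<le> ?I \<omega> * (\<Sum>f\<in>?W. ?X f \<omega>)}"
    by (rule finite_measure_mono) (auto simp: indicator_def)
  also have "\<dots> \<le> expectation (\<lambda>\<omega>. ?I \<omega> * (\<Sum>f\<in>?W. ?X f \<omega>)) / z"
  proof (rule integral_Markov_inequality_measure[where A = "{}"])
    show "integrable M (\<lambda>\<omega>. ?I \<omega> * (\<Sum>f\<in>?W. ?X f \<omega>))"
      unfolding sum_distrib_left using prod by (intro Bochner_Integration.integrable_sum) auto
    show "AE \<omega> in M. 0 \<le> ?I \<omega> * (\<Sum>f\<in>?W. ?X f \<omega>)"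
      using W excess_nonneg by (intro AE_I2 mult_nonneg_nonneg sum_nonneg) auto
  qed (use z in auto)
  also have "expectation (\<lambda>\<omega>. ?I \<omega> * (\<Sum>f\<in>?W. ?X f \<omega>)) = (\<Sum>f\<in>?W. G H * cut_mean (edge_length f))"
    unfolding sum_distrib_left using prod by (subst Bochner_Integration.integral_sum) auto
  also have "\<dots> \<le> G H * (real_of_int (b - a + 1) * V2)"
  proof -
    have "(\<Sum>f\<in>?W. cut_mean (edge_length f)) \<le> (\<Sum>f\<in>edges_between a b. cut_mean (edge_length f))"
      by (intro sum_mono2) (auto intro: cut_mean_nonneg)
    also have "\<dots> \<le> real_of_int (b - a + 1) * V2"
      using ab by (intro order_trans[OF sum_edges_between_le] mult_left_mono sum_cut_mean_le cut_mean_nonneg) auto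
    finally show ?thesis unfolding sum_distrib_left[symmetric]
      using G.nonneg by (intro mult_left_mono) auto
  qed
  finally show ?thesis using z by (simp add: divide_right_mono)
qed

section \<open>Long edges that are heavy enough for a geodesic\<close>

text \<open>The predicate fixes the order of quantifiers: one constant \<open>D\<close>, chosen for
  \<kappa> and \<open>r\<close>, serves all sets of edges and all scales, which later vary with
  \<open>n\<close>.\<close>

definition long_heavy_bound :: "real \<Rightarrow> real \<Rightarrow> real \<Rightarrow> bool" where
  "long_heavy_bound \<kappa> r D \<longleftrightarrow> (\<forall>F K c d B. finite F \<longrightarrow> F \<subseteq> all_edges \<longrightarrow> (\<forall>f\<in>F. K \<le> edge_length f) \<longrightarrow>
     1 \<le> K \<longrightarrow> (\<forall>l. real (card {f \<in> F. edge_length f = l}) \<le> c * real l powr d) \<longrightarrow> 0 \<le> c \<longrightarrow>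
     d + 1 + \<kappa> \<le> r \<longrightarrow> 0 < B \<longrightarrow>
     (\<Sum>f\<in>F. measure \<mu> {real (edge_length f) / (2 * B)..}) \<le> D * B powr r * c * real K powr (- (r - d - 1 - \<kappa>)))"

lemma sum_long_heavy_le:
  assumes "long_heavy_bound \<kappa> r D" "finite F" "F \<subseteq> all_edges" "\<And>f. f \<in> F \<Longrightarrow> K \<le> edge_length f" "1 \<le> K"
    "\<And>l. real (card {f \<in> F. edge_length f = l}) \<le> c * real l powr d" "0 \<le> c" "d + 1 + \<kappa> \<le> r" "0 < B"
  shows "(\<Sum>f\<in>F. measure \<mu> {real (edge_length f) / (2 * B)..}) \<le> D * B powr r * c * real K powr (- (r - d - 1 - \<kappa>))"
  using assms unfolding long_heavy_bound_def by blast

text \<open>The factor \<open>B powr r\<close> is the price for comparing an edge with a path whose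
  guaranteed weight is only its length divided by \<open>2 * B\<close>.\<close>

lemma long_heavy_boundE:
  assumes "0 < \<kappa>" "0 \<le> r" "r < s"
  obtains D where "0 < D" "long_heavy_bound \<kappa> r D"
proof -
  obtain C where C: "0 < C" "\<And>x. 0 < x \<Longrightarrow> measure \<mu> {x..} \<le> C * x powr (- r)"
    using tail_bound assms by metis
  let ?\<zeta> = "\<Sum>l. real l powr (- (1 + \<kappa>))"
  have "summable (\<lambda>l. real l powr (- (1 + \<kappa>)))" using assms by (simp add: summable_real_powr_iff)
  then have \<zeta>: "0 < ?\<zeta>" by (rule suminf_pos2[of _ 1]) auto
  let ?D = "C * 2 powr r * ?\<zeta>"
  have "(\<Sum>f\<in>F. measure \<mu> {real (edge_length f) / (2 * B)..}) \<le> ?D * B powr r * c * real K powr (- (r - d - 1 - \<kappa>))"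
    if F: "finite F" "F \<subseteq> all_edges" "\<forall>f\<in>F. K \<le> edge_length f" "1 \<le> K"
      "\<forall>l. real (card {f \<in> F. edge_length f = l}) \<le> c * real l powr d" "0 \<le> c" "d + 1 + \<kappa> \<le> r" "0 < B" for F K c d B
  proof -
    have "(\<Sum>f\<in>F. measure \<mu> {real (edge_length f) / (2 * B)..}) \<le> (\<Sum>f\<in>F. C * 2 powr r * B powr r * real (edge_length f) powr (- r))"
    proof (rule sum_mono)
      fix f assume "f \<in> F"
      then have pos: "0 < real (edge_length f)" using F(3,4) by force
      have "measure \<mu> {real (edge_length f) / (2 * B)..} \<le> C * (real (edge_length f) / (2 * B)) powr (- r)"
        using pos F by (intro C) auto
      also have "\<dots> = C * 2 powr r * B powr r * real (edge_length f) powr (- r)"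
        using pos F(8) by (simp add: powr_divide powr_mult powr_minus field_simps)
      finally show "measure \<mu> {real (edge_length f) / (2 * B)..} \<le> C * 2 powr r * B powr r * real (edge_length f) powr (- r)" .
    qed
    also have "\<dots> = C * 2 powr r * B powr r * (\<Sum>f\<in>F. real (edge_length f) powr (- r))"
      by (simp add: sum_distrib_left)
    also have "\<dots> \<le> C * 2 powr r * B powr r * (c * real K powr (- (r - d - 1 - \<kappa>)) * ?\<zeta>)"
      using C F assms by (intro mult_left_mono sum_powr_length_le) auto
    finally show ?thesis by (simp add: mult_ac)
  qed
  moreover have "0 < ?D" using C \<zeta> by simp
  ultimately show ?thesis using that[of ?D] unfolding long_heavy_bound_def by blast
qed

section \<open>Probability of linking\<close>

definition not_linked :: "nat \<Rightarrow> nat \<Rightarrow> 'a set" where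
  "not_linked n B = {\<omega> \<in> space M. \<not> linked (present_edges pr \<omega>) (\<lambda>e. v e \<omega>) (int n) (int B)}"

text \<open>For fixed ends, distinct midpoints use disjoint coordinates; there are at least
  \<open>B - 1\<close> midpoints, each succeeding with probability \<open>p\<^sup>2 * G 1\<close>.
  At most \<open>(n + 1)\<^sup>2\<close> pairs of ends enter the union bound.\<close>

lemma not_linked:
  assumes B: "1 \<le> B"
  shows "not_linked n B \<in> events" "prob (not_linked n B) \<le> (real n + 1)\<^sup>2 * (1 - p\<^sup>2 * G 1) ^ (B - 1)"
proof -
  let ?P = "{(i, j). 0 \<le> i \<and> j \<le> int n \<and> int B \<le> j - i}"
  have sub: "?P \<subseteq> {0..int n} \<times> {0..int n}" using B by auto
  then have fin: "finite ?P" by (rule finite_subset) simp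
  define K where "K = (\<lambda>(i :: int, j :: int) m. {((i, m), True), ((m, j), True), ((i, m), False)})"
  define S where "S = (\<lambda>k :: (int \<times> int) \<times> bool. if snd k then {1} else {1<..} :: real set)"
  define N where "N = (\<lambda>(i, j). {\<omega> \<in> space M. \<forall>m\<in>{i<..<j}. \<exists>k\<in>K (i, j) m. field k \<omega> \<notin> S k})"
  have Ksub: "K (i, j) m \<subseteq> all_edges \<times> UNIV" if "m \<in> {i<..<j}" for i j m
    using that by (auto simp: K_def)
  have S: "S k \<in> sets borel" for k by (simp add: S_def)
  have N_events: "N (i, j) \<in> events" for i j
  proof -
    have "N (i, j) = (\<Inter>m\<in>{i<..<j}. space M - {\<omega> \<in> space M. \<forall>k\<in>K (i, j) m. field k \<omega> \<in> S k}) \<inter> space M"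
      by (auto simp: N_def)
    moreover have "{\<omega> \<in> space M. \<forall>k\<in>K (i, j) m. field k \<omega> \<in> S k} \<in> events" if "m \<in> {i<..<j}" for m
      using Ksub[OF that] S
      by (intro sets_Collect_Ball_in[where N = "\<lambda>_. borel"] field_measurable) (auto simp: K_def)
    ultimately show ?thesis by (cases "{i<..<j} = {}") (auto intro!: sets.Int sets.finite_INT)
  qed
  have eq: "not_linked n B = (\<Union>ij\<in>?P. N ij)"
  proof (rule set_eqI)
    fix \<omega>
    have "(\<exists>k\<in>K (i, j) m. field k \<omega> \<notin> S k) \<longleftrightarrow> \<not> (pr (i, m) \<omega> \<and> pr (m, j) \<omega> \<and> 1 < v (i, m) \<omega>)" for i j m
      by (auto simp: K_def S_def)
    then show "\<omega> \<in> not_linked n B \<longleftrightarrow> \<omega> \<in> (\<Union>ij\<in>?P. N ij)"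
      unfolding not_linked_def linked_def N_def present_edges_def by (auto; force)
  qed
  show "not_linked n B \<in> events" unfolding eq using fin N_events by (intro sets.finite_UN) auto
  have q: "0 \<le> 1 - p\<^sup>2 * G 1" "1 - p\<^sup>2 * G 1 \<le> 1"
    using p_range G.le_1[of 1] G.nonneg[of 1] by (auto simp: power_le_one intro!: mult_le_one)
  have probN: "prob (N (i, j)) \<le> (1 - p\<^sup>2 * G 1) ^ (B - 1)" if "(i, j) \<in> ?P" for i j
  proof -
    have "prob (N (i, j)) = (\<Prod>m\<in>{i<..<j}. 1 - (\<Prod>k\<in>K (i, j) m. prob {\<omega> \<in> space M. field k \<omega> \<in> S k}))"
      unfolding N_def prod.case
      by (rule prob_blocks) (use Ksub S in \<open>auto simp: disjoint_family_on_def K_def\<close>)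
    also have "\<dots> = (\<Prod>m\<in>{i<..<j}. 1 - p\<^sup>2 * G 1)"
    proof (rule prod.cong)
      fix m assume m: "m \<in> {i<..<j}"
      have "(\<Prod>k\<in>K (i, j) m. prob {\<omega> \<in> space M. field k \<omega> \<in> S k}) = p * (p * G 1)"
        using m prob_present[of "(i, m)"] prob_present[of "(m, j)"] prob_heavy[of "(i, m)" 1]
        by (simp add: K_def S_def)
      then show "1 - (\<Prod>k\<in>K (i, j) m. prob {\<omega> \<in> space M. field k \<omega> \<in> S k}) = 1 - p\<^sup>2 * G 1"
        by (simp add: power2_eq_square)
    qed simp
    also have "\<dots> = (1 - p\<^sup>2 * G 1) ^ card {i<..<j}" by simp
    also have "\<dots> \<le> (1 - p\<^sup>2 * G 1) ^ (B - 1)"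
      using that q by (intro power_decreasing) auto
    finally show ?thesis .
  qed
  have "prob (not_linked n B) \<le> (\<Sum>ij\<in>?P. prob (N ij))"
    unfolding eq using fin N_events by (intro finite_measure_subadditive_finite) auto
  also have "\<dots> \<le> (\<Sum>ij\<in>?P. (1 - p\<^sup>2 * G 1) ^ (B - 1))"
    using probN by (intro sum_mono) auto
  also have "\<dots> = real (card ?P) * (1 - p\<^sup>2 * G 1) ^ (B - 1)" by simp
  also have "\<dots> \<le> (real n + 1)\<^sup>2 * (1 - p\<^sup>2 * G 1) ^ (B - 1)"
  proof (rule mult_right_mono)
    have "card ?P \<le> card ({0..int n} \<times> {0..int n})" using sub by (intro card_mono) auto
    also have "\<dots> = (n + 1) * (n + 1)" by (simp add: nat_add_distrib)
    finally show "real (card ?P) \<le> (real n + 1)\<^sup>2"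
      by (simp add: power2_eq_square algebra_simps flip: of_nat_le_iff[where 'a = real])
  qed (use q in simp)
  finally show "prob (not_linked n B) \<le> (real n + 1)\<^sup>2 * (1 - p\<^sup>2 * G 1) ^ (B - 1)" .
qed

end

section \<open>Upper bounds for the longest and the heaviest edge\<close>

lemma path_edges_nonempty: "is_path E i j xs \<Longrightarrow> i < j \<Longrightarrow> set (path_edges xs) \<noteq> {}"
  by (cases xs rule: remdups_adj.cases) (auto simp: is_path_def)

lemma longest_edge_le:
  assumes "is_path E i j xs" "i < j" "\<And>f. f \<in> set (path_edges xs) \<Longrightarrow> real_of_int (snd f - fst f) \<le> T"
  shows "real_of_int (longest_edge xs) \<le> T"
proof -
  have "longest_edge xs \<in> (\<lambda>(a, b). b - a) ` set (path_edges xs)"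
    unfolding longest_edge_def using path_edges_nonempty[OF assms(1,2)] by (intro Max_in) auto
  with assms(3) show ?thesis by (auto simp: case_prod_beta)
qed

lemma longest_edge_ge: "f \<in> set (path_edges xs) \<Longrightarrow> snd f - fst f \<le> longest_edge xs"
  unfolding longest_edge_def by (intro Max_ge) (auto simp: case_prod_beta)

lemma heaviest_edge_le:
  assumes "is_path E i j xs" "i < j" "\<And>f. f \<in> set (path_edges xs) \<Longrightarrow> wt f \<le> T"
  shows "heaviest_edge wt xs \<le> T"
  unfolding heaviest_edge_def using path_edges_nonempty[OF assms(1,2)] assms(3) by (intro Max.boundedI) auto

lemma heaviest_edge_ge: "f \<in> set (path_edges xs) \<Longrightarrow> wt f \<le> heaviest_edge wt xs"
  unfolding heaviest_edge_def by (intro Max_ge) auto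

section \<open>Powers of n rounded up to integers\<close>

definition scale :: "real \<Rightarrow> nat \<Rightarrow> nat" where "scale \<delta> n = nat \<lceil>real n powr \<delta>\<rceil>"

lemma scale_ge: "real n powr \<delta> \<le> real (scale \<delta> n)"
  unfolding scale_def by linarith

lemma scale_bounds:
  assumes "1 \<le> n" "0 \<le> \<delta>"
  shows "1 \<le> scale \<delta> n" "real (scale \<delta> n) \<le> 2 * real n powr \<delta>"
proof -
  have "1 \<le> real n powr \<delta>" using assms by (intro ge_one_powr_ge_zero) auto
  then show "1 \<le> scale \<delta> n" "real (scale \<delta> n) \<le> 2 * real n powr \<delta>"
    unfolding scale_def by linarith+
qed

lemma scale_mono: "1 \<le> n \<Longrightarrow> \<delta> \<le> \<delta>' \<Longrightarrow> scale \<delta> n \<le> scale \<delta>' n"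
  unfolding scale_def by (intro nat_mono ceiling_mono powr_mono) auto

lemma eventually_scale_le:
  assumes "0 \<le> \<delta>" "\<delta> < 1"
  shows "eventually (\<lambda>n. c * scale \<delta> n \<le> n) sequentially"
proof -
  have "eventually (\<lambda>n. real c * (2 * real n powr \<delta>) \<le> real n) sequentially"
    using assms by real_asymp
  then show ?thesis using eventually_ge_at_top[of 1]
  proof eventually_elim
    case (elim n)
    have "real c * real (scale \<delta> n) \<le> real c * (2 * real n powr \<delta>)"
      using scale_bounds[of n \<delta>] elim assms by (intro mult_left_mono) auto
    with elim have "real (c * scale \<delta> n) \<le> real n" by simp
    then show ?case by (simp only: of_nat_le_iff)
  qed
qed

lemma eventually_powr_le: "a < b \<Longrightarrow> eventually (\<lambda>n. c * real n powr a \<le> real n powr b) sequentially"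
  by real_asymp

lemma powr_neg_tendsto_0: "\<gamma> < 0 \<Longrightarrow> (\<lambda>n. c * real n powr \<gamma>) \<longlonglongrightarrow> 0"
  by real_asymp

context heavy_edge_lpp
begin

definition \<alpha> :: real where "\<alpha> = 1 / (s - 1)"

lemma \<alpha>_bounds: "0 < \<alpha>" "\<alpha> < 1" "\<alpha> * (s - 1) = 1"
  using s_gt_2 by (auto simp: \<alpha>_def field_simps)

text \<open>A fixed pair fails with probability of order at most
  \<open>exp (- c * n powr \<delta>)\<close>, which beats the quadratic number of pairs.\<close>

lemma not_linked_tendsto_0:
  assumes "0 < \<delta>"
  shows "(\<lambda>n. prob (not_linked n (scale \<delta> n))) \<longlonglongrightarrow> 0"
proof (rule Lim_null_comparison)
  define c where "c = p\<^sup>2 * G 1"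
  have c: "0 < c" "c \<le> 1"
    using p_range G.pos[of 1] G.le_1[of 1] by (auto simp: c_def power_le_one intro!: mult_le_one)
  show "(\<lambda>n. (real n + 1)\<^sup>2 * exp (- c * (real n powr \<delta> - 1))) \<longlonglongrightarrow> 0"
    using assms c by real_asymp
  show "eventually (\<lambda>n. norm (prob (not_linked n (scale \<delta> n))) \<le> (real n + 1)\<^sup>2 * exp (- c * (real n powr \<delta> - 1))) sequentially"
    using eventually_ge_at_top[of 1]
  proof eventually_elim
    case (elim n)
    have 1: "1 \<le> scale \<delta> n" using scale_bounds[OF elim] assms by simp
    have "(1 - c) ^ (scale \<delta> n - 1) \<le> exp (- c) ^ (scale \<delta> n - 1)"
      using c exp_ge_add_one_self[of "-c"] by (intro power_mono) auto
    also have "\<dots> = exp (- c * real (scale \<delta> n - 1))" by (simp add: exp_of_nat_mult[symmetric] mult_ac)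
    also have "\<dots> \<le> exp (- c * (real n powr \<delta> - 1))"
      using scale_ge[of n \<delta>] 1 c by (simp add: of_nat_diff)
    finally have "(real n + 1)\<^sup>2 * (1 - c) ^ (scale \<delta> n - 1) \<le> (real n + 1)\<^sup>2 * exp (- c * (real n powr \<delta> - 1))"
      by (intro mult_left_mono) auto
    from order_trans[OF not_linked(2)[OF 1, of n, folded c_def] this] show ?case
      unfolding real_norm_def abs_of_nonneg[OF measure_nonneg] .
  qed
qed

text \<open>With an explicit null set, almost sure positivity joins the exceptional events, and all
  reasoning outside them is pointwise.\<close>

lemma weights_pos_nullE:
  obtains N where "N \<in> events" "prob N = 0" "\<And>\<omega> e. \<omega> \<in> space M - N \<Longrightarrow> e \<in> all_edges \<Longrightarrow> 0 < v e \<omega>"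
proof -
  obtain N where N: "N \<in> null_sets M" "{\<omega> \<in> space M. \<not> (\<forall>e\<in>all_edges. 0 < v e \<omega>)} \<subseteq> N"
    using AE_weights_pos unfolding eventually_ae_filter by blast
  show ?thesis
  proof (rule that[of N])
    show "N \<in> events" "prob N = 0" using N(1) by (auto simp: measure_def null_sets_def)
    show "0 < v e \<omega>" if "\<omega> \<in> space M - N" "e \<in> all_edges" for \<omega> e using that N(2) by blast
  qed
qed

text \<open>At \<delta> = 0 the expression in the last condition equals
  \<open>- \<epsilon> * (s - 1)\<close>, as \<open>\<alpha> * (s - 1) = 1\<close>, so it stays
  negative for small \<delta>.\<close>

lemma upper_bound_exponent:
  assumes "0 < \<epsilon>"
  obtains \<delta> where "0 < \<delta>" "\<delta> < 1" "\<delta> < \<alpha>" "1 + 2 * \<delta> \<le> s"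
    "1 + \<delta> * (s - \<delta>) - (\<alpha> + \<epsilon>) * (s - 1 - 2 * \<delta>) < 0"
proof -
  have "((\<lambda>\<delta>. 1 + \<delta> * (s - \<delta>) - (\<alpha> + \<epsilon>) * (s - 1 - 2 * \<delta>)) \<longlongrightarrow>
      1 + 0 * (s - 0) - (\<alpha> + \<epsilon>) * (s - 1 - 2 * 0)) (at_right 0)"
    by (intro tendsto_intros)
  moreover have "1 + 0 * (s - 0) - (\<alpha> + \<epsilon>) * (s - 1 - 2 * 0) < 0"
    using \<alpha>_bounds s_gt_2 assms by (simp add: distrib_right)
  ultimately have "eventually (\<lambda>\<delta>. 1 + \<delta> * (s - \<delta>) - (\<alpha> + \<epsilon>) * (s - 1 - 2 * \<delta>) < 0) (at_right 0)"
    by (rule order_tendstoD(2))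
  moreover have "eventually (\<lambda>\<delta>. 0 < \<delta> \<and> \<delta> < min \<alpha> (1/2)) (at_right (0::real))"
    using \<alpha>_bounds eventually_at_right_real[of 0 "min \<alpha> (1/2)"] by (auto elim: eventually_mono)
  ultimately have "eventually (\<lambda>\<delta>. 1 + \<delta> * (s - \<delta>) - (\<alpha> + \<epsilon>) * (s - 1 - 2 * \<delta>) < 0 \<and>
      0 < \<delta> \<and> \<delta> < min \<alpha> (1/2)) (at_right 0)"
    by (rule eventually_conj)
  then obtain \<delta> where "1 + \<delta> * (s - \<delta>) - (\<alpha> + \<epsilon>) * (s - 1 - 2 * \<delta>) < 0" "0 < \<delta>" "\<delta> < min \<alpha> (1/2)"
    using eventually_happens trivial_limit_at_right_real by blast
  then show ?thesis using that[of \<delta>] s_gt_2 by auto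
qed

lemma weight_events:
  assumes "f \<in> all_edges"
  shows "{\<omega> \<in> space M. x \<le> v f \<omega>} \<in> events" "{\<omega> \<in> space M. x < v f \<omega>} \<in> events"
  using v_measurable[OF assms] by measurable

lemma prob_UN_weights_le:
  assumes "finite F" "F \<subseteq> all_edges" "\<And>f. S f \<in> sets borel"
  shows "prob (\<Union>f\<in>F. {\<omega> \<in> space M. v f \<omega> \<in> S f}) \<le> (\<Sum>f\<in>F. measure \<mu> (S f))"
proof -
  have "prob (\<Union>f\<in>F. {\<omega> \<in> space M. v f \<omega> \<in> S f}) \<le> (\<Sum>f\<in>F. prob {\<omega> \<in> space M. v f \<omega> \<in> S f})"
  proof (rule finite_measure_subadditive_finite)
    show "(\<lambda>f. {\<omega> \<in> space M. v f \<omega> \<in> S f}) ` F \<subseteq> events"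
    proof (rule image_subsetI)
      fix f assume "f \<in> F"
      then have "v f \<in> borel_measurable M" using assms(2) by (intro v_measurable) auto
      from measurable_sets[OF this assms(3)[of f]] show "{\<omega> \<in> space M. v f \<omega> \<in> S f} \<in> events"
        by (simp add: vimage_def Int_def conj_commute)
    qed
  qed fact
  also have "\<dots> = (\<Sum>f\<in>F. measure \<mu> (S f))"
    using assms by (intro sum.cong measure_law) auto
  finally show ?thesis .
qed

text \<open>In a linked environment with \<open>B \<le> T\<close>, the first union catches every
  geodesic edge of length at least \<open>T\<close>, and the second every remaining edge heavier
  than \<open>T\<close>.\<close>

definition too_heavy :: "nat \<Rightarrow> nat \<Rightarrow> real \<Rightarrow> 'a set" where
  "too_heavy n B T =
    (\<Union>f\<in>{f \<in> edges_between 0 (int n). T \<le> real (edge_length f)}. {\<omega> \<in> space M. real (edge_length f) / (2 * real B) \<le> v f \<omega>}) \<union>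
    (\<Union>f\<in>{f \<in> edges_between 0 (int n). real (edge_length f) \<le> T}. {\<omega> \<in> space M. T < v f \<omega>})"

lemma too_heavy_events: "too_heavy n B T \<in> events"
proof -
  have "f \<in> all_edges" if "f \<in> edges_between 0 (int n)" for f
    using that edges_between_subset by blast
  then show ?thesis unfolding too_heavy_def
    by (intro sets.Un sets.finite_UN weight_events) auto
qed

lemma too_heavy_tendsto_0:
  assumes \<epsilon>: "0 < \<epsilon>" and \<delta>: "0 < \<delta>" "1 + 2 * \<delta> \<le> s"
    and ex: "1 + \<delta> * (s - \<delta>) - (\<alpha> + \<epsilon>) * (s - 1 - 2 * \<delta>) < 0"
  shows "(\<lambda>n. prob (too_heavy n (scale \<delta> n) (real n powr (\<alpha> + \<epsilon>)))) \<longlonglongrightarrow> 0"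
proof -
  define r where "r = s - \<delta>"
  have r: "0 \<le> r" "r < s" "1 + \<delta> \<le> r" using \<delta> by (auto simp: r_def)
  obtain D where D: "0 < D" "long_heavy_bound \<delta> r D"
    using long_heavy_boundE[OF \<delta>(1) r(1,2)] by metis
  obtain C where C: "0 < C" "\<And>x. 0 < x \<Longrightarrow> G x \<le> C * x powr (- r)"
    using G.upper_bound[OF r(1,2)] by metis
  \<comment> \<open>Exponent of the first union: about \<open>n\<close> edges of each length, a tail
    of index \<open>r\<close> at the length divided by \<open>2 * B\<close>, and summation over
    lengths from \<open>T\<close> on.\<close>
  define \<gamma> where "\<gamma> = 1 + \<delta> * r - (\<alpha> + \<epsilon>) * (r - 1 - \<delta>)"
  have \<gamma>: "\<gamma> < 0" using ex by (simp add: \<gamma>_def r_def algebra_simps)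
  \<comment> \<open>Exponent of the second union: about \<open>n * T\<close> edges, each with tail
    \<open>T powr (- r)\<close>.\<close>
  define \<gamma>' where "\<gamma>' = 1 + (\<alpha> + \<epsilon>) * (1 - r)"
  have "\<gamma> - \<gamma>' = \<delta> * r + (\<alpha> + \<epsilon>) * \<delta>" by (simp add: \<gamma>'_def \<gamma>_def algebra_simps)
  moreover have "0 \<le> \<delta> * r" "0 \<le> (\<alpha> + \<epsilon>) * \<delta>" using \<alpha>_bounds(1) \<epsilon> \<delta> r by simp_all
  ultimately have "\<gamma>' \<le> \<gamma>" by linarith
  then have \<gamma>': "\<gamma>' < 0" using \<gamma> by simp
  have bound: "prob (too_heavy n (scale \<delta> n) (real n powr (\<alpha> + \<epsilon>)))
      \<le> (D * 2 powr r * 2) * real n powr \<gamma> + (2 * C) * real n powr \<gamma>'" if n: "1 \<le> n" for n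
  proof -
    define T where "T = real n powr (\<alpha> + \<epsilon>)"
    define B where "B = scale \<delta> n"
    have T: "1 \<le> T" unfolding T_def using n \<alpha>_bounds \<epsilon> by (intro ge_one_powr_ge_zero) auto
    have B: "1 \<le> B" "real B \<le> 2 * real n powr \<delta>" unfolding B_def using scale_bounds[OF n] \<delta> by auto
    let ?E = "edges_between 0 (int n)"
    let ?F1 = "{f \<in> ?E. T \<le> real (edge_length f)}" and ?F2 = "{f \<in> ?E. real (edge_length f) \<le> T}"
    have E: "f \<in> all_edges" if "f \<in> ?E" for f using that edges_between_subset by blast
    have ev: "{\<omega> \<in> space M. real (edge_length f) / (2 * real B) \<le> v f \<omega>} \<in> events"
      "{\<omega> \<in> space M. T < v f \<omega>} \<in> events" if "f \<in> ?E" for f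
      using weight_events[OF E[OF that]] by auto
    have "prob (\<Union>f\<in>?F1. {\<omega> \<in> space M. real (edge_length f) / (2 * real B) \<le> v f \<omega>})
        \<le> (\<Sum>f\<in>?F1. measure \<mu> {real (edge_length f) / (2 * real B)..})"
      using prob_UN_weights_le[of ?F1 "\<lambda>f. {real (edge_length f) / (2 * real B)..}"] edges_between_subset by auto
    also have "\<dots> \<le> D * real B powr r * (real n + 1) * real (nat \<lceil>T\<rceil>) powr (- (r - 0 - 1 - \<delta>))"
    proof (rule sum_long_heavy_le[OF D(2)])
      show "nat \<lceil>T\<rceil> \<le> edge_length f" if "f \<in> ?F1" for f using that by (simp add: nat_le_iff ceiling_le_iff)
      show "real (card {f \<in> ?F1. edge_length f = l}) \<le> (real n + 1) * real l powr 0" for l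
      \<comment> \<open>At \<open>l = 0\<close> the bound is 0, because \<open>0 powr 0 = 0\<close>;
        it holds since every edge has positive length.\<close>
      proof (cases "l = 0")
        case True
        then have "{f \<in> ?F1. edge_length f = l} = {}" using edge_length_pos[OF E] by force
        then show ?thesis by (simp only:) simp
      next
        case False
        have "card {f \<in> ?F1. edge_length f = l} \<le> card {f \<in> ?E. edge_length f = l}"
          by (intro card_mono) auto
        also note card_edges_between_length
        finally show ?thesis using False by simp
      qed
      show "1 \<le> nat \<lceil>T\<rceil>" using T by linarith
    qed (use B r edges_between_subset in auto)
    also have "\<dots> \<le> D * (2 * real n powr \<delta>) powr r * (2 * real n) * T powr (- (r - 0 - 1 - \<delta>))"
    proof -
      have "real B powr r \<le> (2 * real n powr \<delta>) powr r" using B r by (intro powr_mono2) auto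
      moreover have "real (nat \<lceil>T\<rceil>) powr (- (r - 0 - 1 - \<delta>)) \<le> T powr (- (r - 0 - 1 - \<delta>))"
        by (intro powr_mono2') (use T r in linarith)+
      ultimately show ?thesis using D(1) n by (intro mult_mono) simp_all
    qed
    also have "\<dots> = (D * 2 powr r * 2) * (real n powr (\<delta> * r) * real n powr 1 * real n powr ((\<alpha> + \<epsilon>) * (- (r - 1 - \<delta>))))"
      using n by (simp add: powr_mult powr_powr T_def)
    also have "\<dots> = (D * 2 powr r * 2) * real n powr \<gamma>"
      by (simp only: powr_add[symmetric]) (simp add: \<gamma>_def algebra_simps)
    finally have 1: "prob (\<Union>f\<in>?F1. {\<omega> \<in> space M. real (edge_length f) / (2 * real B) \<le> v f \<omega>})
        \<le> (D * 2 powr r * 2) * real n powr \<gamma>" .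
    have "prob (\<Union>f\<in>?F2. {\<omega> \<in> space M. T < v f \<omega>}) \<le> (\<Sum>f\<in>?F2. G T)"
      using prob_UN_weights_le[of ?F2 "\<lambda>_. {T<..}"] edges_between_subset by (auto simp: G_def)
    also have "\<dots> = (\<Sum>f\<in>?E. if real (edge_length f) \<le> T then G T else 0)"
      by (rule sum.inter_filter) simp
    also have "\<dots> \<le> real_of_int (int n - 0 + 1) * (\<Sum>l\<in>{1..nat (int n - 0)}. if real l \<le> T then G T else 0)"
      by (rule sum_edges_between_le) (simp_all add: G.nonneg)
    also have "\<dots> = (real n + 1) * (\<Sum>l\<in>{1..n}. if real l \<le> T then G T else 0)" by simp
    also have "\<dots> \<le> (2 * real n) * (T * (C * T powr (- r)))"
    proof (rule mult_mono)
      have "(\<Sum>l\<in>{1..n}. if real l \<le> T then G T else 0) = real (card {l \<in> {1..n}. real l \<le> T}) * G T"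
        by (simp add: sum.If_cases Int_def)
      also have "\<dots> \<le> T * (C * T powr (- r))"
      proof (rule mult_mono)
        have "{l \<in> {1..n}. real l \<le> T} \<subseteq> {1..nat \<lfloor>T\<rfloor>}" by (auto simp: le_nat_floor)
        then have "card {l \<in> {1..n}. real l \<le> T} \<le> nat \<lfloor>T\<rfloor>" using card_mono[of "{1..nat \<lfloor>T\<rfloor>}"] by force
        then show "real (card {l \<in> {1..n}. real l \<le> T}) \<le> T" using T by linarith
      qed (use C(2)[of T] T G.nonneg in auto)
      finally show "(\<Sum>l\<in>{1..n}. if real l \<le> T then G T else 0) \<le> T * (C * T powr (- r))" .
      show "0 \<le> (\<Sum>l\<in>{1..n}. if real l \<le> T then G T else 0)" by (intro sum_nonneg) (simp add: G.nonneg)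
    qed (use n in auto)
    also have "\<dots> = (2 * C) * (real n powr 1 * (T powr 1 * T powr (- r)))" using T n by simp
    also have "\<dots> = (2 * C) * real n powr \<gamma>'"
      by (simp only: powr_add[symmetric] T_def powr_powr) (simp add: \<gamma>'_def algebra_simps)
    finally have 2: "prob (\<Union>f\<in>?F2. {\<omega> \<in> space M. T < v f \<omega>}) \<le> (2 * C) * real n powr \<gamma>'" .
    have "prob (too_heavy n B T) \<le> prob (\<Union>f\<in>?F1. {\<omega> \<in> space M. real (edge_length f) / (2 * real B) \<le> v f \<omega>})
        + prob (\<Union>f\<in>?F2. {\<omega> \<in> space M. T < v f \<omega>})"
      unfolding too_heavy_def by (intro measure_Un_le sets.finite_UN ev) auto
    with 1 2 show ?thesis by (simp add: T_def B_def)
  qed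
  show ?thesis
  proof (rule Lim_null_comparison)
    show "eventually (\<lambda>n. norm (prob (too_heavy n (scale \<delta> n) (real n powr (\<alpha> + \<epsilon>))))
      \<le> (D * 2 powr r * 2) * real n powr \<gamma> + (2 * C) * real n powr \<gamma>') sequentially"
      unfolding real_norm_def abs_of_nonneg[OF measure_nonneg]
      by (rule eventually_sequentiallyI[of 1]) (rule bound)
    show "(\<lambda>n. (D * 2 powr r * 2) * real n powr \<gamma> + (2 * C) * real n powr \<gamma>') \<longlonglongrightarrow> 0"
      by (intro tendsto_add_zero powr_neg_tendsto_0 \<gamma> \<gamma>')
  qed
qed

text \<open>The bounds hold for all geodesics at once outside one measurable event, so that any
  choice of a geodesic inherits them.\<close>

lemma geodesic_upper_bound:
  assumes \<epsilon>: "0 < \<epsilon>" and \<eta>: "0 < \<eta>"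
  shows "eventually (\<lambda>n. \<exists>X\<in>events. prob X < \<eta> \<and> (\<forall>\<omega>\<in>space M - X.
       (\<exists>xs. is_path (present_edges pr \<omega>) 0 (int n) xs) \<and>
       (\<forall>xs. is_geodesic (present_edges pr \<omega>) (\<lambda>e. v e \<omega>) 0 (int n) xs \<longrightarrow>
          real_of_int (longest_edge xs) \<le> real n powr (\<alpha> + \<epsilon>) \<and>
          heaviest_edge (\<lambda>e. v e \<omega>) xs \<le> real n powr (\<alpha> + \<epsilon>)))) sequentially"
proof -
  obtain \<delta> where \<delta>: "0 < \<delta>" "\<delta> < 1" "\<delta> < \<alpha>" "1 + 2 * \<delta> \<le> s"
    "1 + \<delta> * (s - \<delta>) - (\<alpha> + \<epsilon>) * (s - 1 - 2 * \<delta>) < 0"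
    using upper_bound_exponent[OF \<epsilon>] by metis
  obtain N where N: "N \<in> events" "prob N = 0" "\<And>\<omega> e. \<omega> \<in> space M - N \<Longrightarrow> e \<in> all_edges \<Longrightarrow> 0 < v e \<omega>"
    using weights_pos_nullE by metis
  define B where "B = scale \<delta>"
  define T where "T n = real n powr (\<alpha> + \<epsilon>)" for n
  \<comment> \<open>At \<open>n = 0\<close> the scale is 0, where the measurability of
    \<open>not_linked\<close> is not provided; the empty set keeps \<open>X n\<close> an event for
    every \<open>n\<close>.\<close>
  define X where "X n = (if n = 0 then {} else N \<union> (not_linked n (B n) \<union> too_heavy n (B n) (T n)))" for n
  have B1: "1 \<le> B n" if "1 \<le> n" for n using scale_bounds[OF that] \<delta> by (simp add: B_def)
  have ev: "X n \<in> events" for n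
    using N not_linked(1)[OF B1, of n] too_heavy_events by (auto simp: X_def)
  have "prob (X n) \<le> prob (not_linked n (B n)) + prob (too_heavy n (B n) (T n))" for n
  proof (cases "n = 0")
    case False
    then have nl: "not_linked n (B n) \<in> events" using not_linked(1)[OF B1, of n] by simp
    have "prob (X n) \<le> prob N + prob (not_linked n (B n) \<union> too_heavy n (B n) (T n))"
      using measure_Un_le[OF N(1) sets.Un[OF nl too_heavy_events]] False by (simp add: X_def)
    also have "\<dots> \<le> prob N + (prob (not_linked n (B n)) + prob (too_heavy n (B n) (T n)))"
      using nl too_heavy_events by (intro add_left_mono measure_Un_le)
    finally show ?thesis using N by simp
  qed (simp add: X_def)
  moreover have "(\<lambda>n. prob (not_linked n (B n)) + prob (too_heavy n (B n) (T n))) \<longlonglongrightarrow> 0"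
    using tendsto_add[OF not_linked_tendsto_0[OF \<delta>(1)] too_heavy_tendsto_0[OF \<epsilon> \<delta>(1,4,5)]]
    by (simp add: B_def T_def)
  ultimately have lim: "(\<lambda>n. prob (X n)) \<longlonglongrightarrow> 0"
    by (intro Lim_null_comparison[of "\<lambda>n. prob (X n)"] always_eventually allI) simp_all
  have "eventually (\<lambda>n. 1 * B n \<le> n) sequentially" unfolding B_def
    using \<delta> by (intro eventually_scale_le) auto
  \<comment> \<open>\<open>T n\<close> dominates \<open>B n\<close>, so edges longer than
    \<open>T n\<close> are long enough to be compared with a linking path.\<close>
  moreover have "eventually (\<lambda>n. 2 * real n powr \<delta> \<le> T n) sequentially" unfolding T_def
    using \<delta> \<epsilon> by (intro eventually_powr_le) auto
  ultimately have good: "eventually (\<lambda>n. \<forall>\<omega>\<in>space M - X n. (\<exists>xs. is_path (present_edges pr \<omega>) 0 (int n) xs) \<and>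
     (\<forall>xs. is_geodesic (present_edges pr \<omega>) (\<lambda>e. v e \<omega>) 0 (int n) xs \<longrightarrow>
        real_of_int (longest_edge xs) \<le> real n powr (\<alpha> + \<epsilon>) \<and>
        heaviest_edge (\<lambda>e. v e \<omega>) xs \<le> real n powr (\<alpha> + \<epsilon>))) sequentially"
    using eventually_ge_at_top[of 1]
  proof eventually_elim
    case (elim n)
    show ?case
    proof
      fix \<omega> assume \<omega>: "\<omega> \<in> space M - X n"
      let ?E = "present_edges pr \<omega>" and ?wt = "\<lambda>e. v e \<omega>"
      have \<omega>': "\<omega> \<in> space M" "\<omega> \<in> space M - N" "\<omega> \<notin> not_linked n (B n)" "\<omega> \<notin> too_heavy n (B n) (T n)"
        using \<omega> elim by (auto simp: X_def)
      have pos: "\<And>e. e \<in> all_edges \<Longrightarrow> 0 < v e \<omega>" using N(3)[OF \<omega>'(2)] .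
      have l: "linked ?E ?wt (int n) (int (B n))" using \<omega>' by (auto simp: not_linked_def)
      have BT: "real (B n) \<le> T n"
        using scale_bounds[of n \<delta>] elim \<delta> by (simp add: B_def)
      have "\<exists>xs. is_path ?E 0 (int n) xs"
        by (rule linked_path[OF l pos, of 0 "int n"]) (use elim B1[of n] in auto)
      moreover have "real_of_int (longest_edge xs) \<le> T n \<and> heaviest_edge ?wt xs \<le> T n"
        if g: "is_geodesic ?E ?wt 0 (int n) xs" for xs
      proof -
        have p: "is_path ?E 0 (int n) xs" using g by (simp add: is_geodesic_def)
        have short: "real (edge_length f) < T n" if f: "f \<in> set (path_edges xs)" for f
        proof (rule ccontr)
          assume T: "\<not> real (edge_length f) < T n"
          have fE: "f \<in> edges_between 0 (int n)" using path_edges_between[OF p f] .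
          then have len: "real (edge_length f) = real_of_int (snd f - fst f)" "f \<in> all_edges"
            using edges_between_subset real_edge_length by blast+
          then have "int (B n) \<le> snd f - fst f" using BT T by linarith
          then have "real_of_int (snd f - fst f) / (2 * real_of_int (int (B n))) \<le> v f \<omega>"
            using linked_geodesic_edge[OF l pos _ g, of "fst f" "snd f"] f B1[of n] elim by simp
          then have "real (edge_length f) / (2 * real (B n)) \<le> v f \<omega>" using len by simp
          then have "\<omega> \<in> too_heavy n (B n) (T n)"
            unfolding too_heavy_def using fE T \<omega>'(1) by (intro UnI1 UN_I[of f]) simp_all
          with \<omega>' show False by simp
        qed
        have light: "v f \<omega> \<le> T n" if f: "f \<in> set (path_edges xs)" for f
        proof (rule ccontr)
          assume "\<not> v f \<omega> \<le> T n"
          then have "\<omega> \<in> too_heavy n (B n) (T n)"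
            unfolding too_heavy_def using path_edges_between[OF p f] short[OF f] \<omega>'(1)
            by (intro UnI2 UN_I[of f]) simp_all
          with \<omega>' show False by simp
        qed
        have "real_of_int (snd f - fst f) \<le> T n" if f: "f \<in> set (path_edges xs)" for f
          using short[OF f] path_edges_between[OF p f] edges_between_subset real_edge_length[of f] by fastforce
        then show ?thesis
          using longest_edge_le[OF p] heaviest_edge_le[OF p] light elim by auto
      qed
      ultimately show "(\<exists>xs. is_path ?E 0 (int n) xs) \<and> (\<forall>xs. is_geodesic ?E ?wt 0 (int n) xs \<longrightarrow>
        real_of_int (longest_edge xs) \<le> real n powr (\<alpha> + \<epsilon>) \<and>
        heaviest_edge ?wt xs \<le> real n powr (\<alpha> + \<epsilon>))"
        by (simp add: T_def)
    qed
  qed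
  show ?thesis using order_tendstoD(2)[OF lim \<eta>] good
    by eventually_elim (use ev in blast)
qed

end

section \<open>Heavy edges which every geodesic uses\<close>

text \<open>About \<open>n * K\<close>, of order \<open>n powr (1 + \<beta>)\<close>, candidates are
  available, while \<open>K powr r\<close>, of order \<open>n powr (\<beta> * r)\<close>, are
  required.\<close>

lemma eventually_scale_count:
  assumes "0 \<le> \<beta>" "\<beta> < 1" and r: "\<beta> * r < 1 + \<beta>" "0 \<le> r" and c: "0 \<le> c"
  shows "eventually (\<lambda>n. c * real (scale \<beta> n) powr r + 1 \<le> real ((n - 6 * scale \<beta> n) * scale \<beta> n)) sequentially"
proof -
  have "eventually (\<lambda>n. (2 * (c * 2 powr r + 1)) * real n powr (max 0 (\<beta> * r)) \<le> real n powr (1 + \<beta>)) sequentially"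
    using assms by (intro eventually_powr_le) auto
  moreover have "eventually (\<lambda>n. 12 * scale \<beta> n \<le> n) sequentially"
    using assms by (intro eventually_scale_le) auto
  ultimately show ?thesis using eventually_ge_at_top[of 1]
  proof eventually_elim
    case (elim n)
    have K: "1 \<le> scale \<beta> n" "real (scale \<beta> n) \<le> 2 * real n powr \<beta>" using scale_bounds[of n \<beta>] elim assms by auto
    have "0 \<le> \<beta> * r" using assms by simp
    have one: "1 \<le> real n powr (\<beta> * r)" using elim \<open>0 \<le> \<beta> * r\<close> by (intro ge_one_powr_ge_zero) auto
    have "c * real (scale \<beta> n) powr r + 1 \<le> c * (2 * real n powr \<beta>) powr r + real n powr (\<beta> * r)"
      using K c one r by (intro add_mono mult_left_mono powr_mono2) auto
    also have "\<dots> = (c * 2 powr r + 1) * real n powr (\<beta> * r)"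
      by (simp add: powr_mult powr_powr algebra_simps)
    also have "\<dots> \<le> real n powr (1 + \<beta>) / 2" using elim(1) \<open>0 \<le> \<beta> * r\<close> by (simp add: max_def algebra_simps)
    also have "\<dots> = (real n / 2) * real n powr \<beta>" using elim by (simp add: powr_add)
    also have "\<dots> \<le> real (n - 6 * scale \<beta> n) * real (scale \<beta> n)"
      using elim scale_ge[of n \<beta>] by (intro mult_mono) (auto simp: of_nat_diff)
    finally show ?case by simp
  qed
qed

text \<open>Candidates are parametrized by their starting point and by the length beyond
  \<open>K\<close>; margins of \<open>2 * K\<close> at both ends keep the vicinity inside
  \<open>[0, n]\<close>.\<close>

lemma card_candidate_edges:
  fixes K :: nat
  assumes "6 * K \<le> n"
  shows "(n - 6 * K) * K \<le> card {(i, j). 2 * int K \<le> i \<and> int K \<le> j - i \<and> j - i < 2 * int K \<and> j + 2 * int K \<le> int n}"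
    (is "_ \<le> card ?P")
proof -
  let ?h = "\<lambda>(i, d). (i, i + int K + d)" and ?D = "{2 * int K..<int n - 4 * int K} \<times> {0..<int K}"
  have "card (?h ` ?D) = (n - 6 * K) * K"
    using assms by (subst card_image) (auto simp: inj_on_def nat_diff_distrib card_cartesian_product)
  moreover have "card (?h ` ?D) \<le> card ?P"
  proof (rule card_mono)
    show "finite ?P" by (rule finite_subset[of _ "{0..int n} \<times> {0..int n}"]) auto
    show "?h ` ?D \<subseteq> ?P" by auto
  qed
  ultimately show ?thesis by simp
qed

context heavy_edge_lpp
begin

text \<open>The two ways in which a heavy edge \<open>e\<close> may fail to be used: a long edge may jump over the
  boundary of its vicinity, or the other edges of the vicinity may be too heavy.\<close>

definition crossing :: "nat \<Rightarrow> nat \<Rightarrow> int \<times> int \<Rightarrow> (int \<times> int) set" where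
  "crossing n K e = {(x, y). (x, y) \<in> edges_between 0 (int n) \<and> int K \<le> y - x \<and>
     (x \<le> fst e - int K \<and> fst e - int K < y \<or> x < snd e + int K \<and> snd e + int K \<le> y)}"

text \<open>Heaviness of \<open>e\<close> is part of the event, so its probability carries the
  factor \<open>G H\<close>. Summing over the candidates then yields their expected number of heavy
  weights in place of their number.\<close>

definition blocked :: "nat \<Rightarrow> nat \<Rightarrow> nat \<Rightarrow> real \<Rightarrow> int \<times> int \<Rightarrow> 'a set" where
  "blocked n K B H e = (\<Union>f\<in>crossing n K e. {\<omega> \<in> space M. H < v e \<omega> \<and> real (edge_length f) / (2 * real B) \<le> v f \<omega>})"

definition rivalled :: "nat \<Rightarrow> real \<Rightarrow> real \<Rightarrow> int \<times> int \<Rightarrow> 'a set" where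
  "rivalled K H z e = {\<omega> \<in> space M. H < v e \<omega> \<and>
     z \<le> (\<Sum>f\<in>edges_between (fst e - 2 * int K) (snd e + 2 * int K) - {e}. excess (\<lambda>e. v e \<omega>) f)}"

definition none_heavy :: "real \<Rightarrow> (int \<times> int) set \<Rightarrow> 'a set" where
  "none_heavy H S = {\<omega> \<in> space M. \<forall>e\<in>S. \<not> (pr e \<omega> \<and> H < v e \<omega>)}"

lemma crossing_subset: "crossing n K e \<subseteq> edges_between 0 (int n)"
  by (auto simp: crossing_def)

lemma finite_crossing: "finite (crossing n K e)"
  using crossing_subset finite_edges_between by (rule finite_subset)

lemma crossing_all_edges: "f \<in> crossing n K e \<Longrightarrow> f \<in> all_edges"
  using crossing_subset edges_between_subset by blast

lemma pair_events:
  assumes "e \<in> all_edges" "f \<in> all_edges"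
  shows "{\<omega> \<in> space M. H < v e \<omega> \<and> x \<le> v f \<omega>} \<in> events"
  using v_measurable[OF assms(1)] v_measurable[OF assms(2)] by measurable

lemma blocked_events: "e \<in> all_edges \<Longrightarrow> blocked n K B H e \<in> events"
  unfolding blocked_def using finite_crossing crossing_all_edges
  by (intro sets.finite_UN pair_events) auto

lemma rivalled_events: 
  assumes "e \<in> all_edges" shows "rivalled K H z e \<in> events"
proof -
  have [measurable]: "v e \<in> borel_measurable M" using assms by (rule v_measurable)
  have [measurable]: "(\<lambda>\<omega>. \<Sum>f\<in>edges_between (fst e - 2 * int K) (snd e + 2 * int K) - {e}. excess (\<lambda>e. v e \<omega>) f)
      \<in> borel_measurable M"
    using edges_between_subset by (intro borel_measurable_sum measurable_excess) blast
  show ?thesis unfolding rivalled_def by measurable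
qed

text \<open>Up to \<open>2 * l\<close> edges of length \<open>l\<close> cross one of the two
  boundaries. This linear count raises the exponent by one, so a tail index above 2 is what makes
  the sum small. None of these edges is \<open>e\<close>, hence the product.\<close>

lemma prob_blocked:
  assumes D: "long_heavy_bound \<kappa> r D" "2 + \<kappa> \<le> r" and e: "e \<in> all_edges" and K: "1 \<le> K" "1 \<le> B"
  shows "prob (blocked n K B H e) \<le> G H * (D * real B powr r * 2 * real K powr (- (r - 2 - \<kappa>)))"
proof -
  have neq: "f \<noteq> e" if "f \<in> crossing n K e" for f
    using that e K by (auto simp: crossing_def)
  have "prob (blocked n K B H e)
      \<le> (\<Sum>f\<in>crossing n K e. prob {\<omega> \<in> space M. H < v e \<omega> \<and> real (edge_length f) / (2 * real B) \<le> v f \<omega>})"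
    unfolding blocked_def using finite_crossing crossing_all_edges e
    by (intro finite_measure_subadditive_finite image_subsetI pair_events) auto
  also have "\<dots> = (\<Sum>f\<in>crossing n K e. G H * measure \<mu> {real (edge_length f) / (2 * real B)..})"
  proof (rule sum.cong)
    fix f assume f: "f \<in> crossing n K e"
    show "prob {\<omega> \<in> space M. H < v e \<omega> \<and> real (edge_length f) / (2 * real B) \<le> v f \<omega>}
        = G H * measure \<mu> {real (edge_length f) / (2 * real B)..}"
      using prob_two_weights[of e f "{H<..}" "{real (edge_length f) / (2 * real B)..}"]
        crossing_all_edges[OF f] neq[OF f] e by (simp add: G_def)
  qed simp
  also have "\<dots> = G H * (\<Sum>f\<in>crossing n K e. measure \<mu> {real (edge_length f) / (2 * real B)..})"
    by (simp add: sum_distrib_left)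
  also have "\<dots> \<le> G H * (D * real B powr r * 2 * real K powr (- (r - 1 - 1 - \<kappa>)))"
  proof (intro mult_left_mono sum_long_heavy_le[OF D(1)])
    show "finite (crossing n K e)" by (rule finite_crossing)
    show "crossing n K e \<subseteq> all_edges" using crossing_all_edges by blast
    show "K \<le> edge_length f" if "f \<in> crossing n K e" for f
      using that by (auto simp: crossing_def edge_length_def)
    show "real (card {f \<in> crossing n K e. edge_length f = l}) \<le> 2 * real l powr 1" for l
    proof -
      have "card {f \<in> crossing n K e. edge_length f = l} \<le> 2 * l"
        by (rule card_edges_crossing[OF finite_crossing, where q = "fst e - int K" and q' = "snd e + int K"])
          (auto simp: crossing_def edges_between_def)
      then have "real (card {f \<in> crossing n K e. edge_length f = l}) \<le> real (2 * l)" by (simp only: of_nat_le_iff)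
      then show ?thesis by simp
    qed
  qed (use K D G.nonneg in auto)
  also have "- (r - 1 - 1 - \<kappa>) = - (r - 2 - \<kappa>)" by simp
  finally show ?thesis .
qed

lemma prob_rivalled:
  assumes e: "e \<in> all_edges" "snd e - fst e < 2 * int K" and z: "0 < z"
  shows "prob (rivalled K H z e) \<le> G H * (6 * real K * V2 / z)"
proof -
  let ?w = "real_of_int (snd e + 2 * int K - (fst e - 2 * int K) + 1)"
  have "prob (rivalled K H z e) \<le> G H * (?w * V2 / z)"
    unfolding rivalled_def using e z by (intro prob_heavy_excess) auto
  also have "\<dots> \<le> G H * (6 * real K * V2 / z)"
  proof -
    \<comment> \<open>The length is an integer below \<open>2 * K\<close>, which leaves room for the
      additional 1.\<close>
    have "snd e + 2 * int K - (fst e - 2 * int K) + 1 \<le> 6 * int K" using e by linarith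
    then have "?w \<le> 6 * real K" by linarith
    then show ?thesis using z V2_nonneg G.nonneg
      by (intro mult_left_mono divide_right_mono mult_right_mono) auto
  qed
  finally show ?thesis .
qed

lemma none_heavy:
  assumes S: "finite S" "S \<subseteq> all_edges"
  shows "none_heavy H S \<in> events" "prob (none_heavy H S) = (1 - p * G H) ^ card S"
proof -
  define K where "K e = {(e, True), (e, False)}" for e :: "int \<times> int"
  define A where "A = (\<lambda>k :: (int \<times> int) \<times> bool. if snd k then {1} else {H<..} :: real set)"
  have eq: "none_heavy H S = {\<omega> \<in> space M. \<forall>e\<in>S. \<exists>k\<in>K e. field k \<omega> \<notin> A k}"
    by (auto simp: none_heavy_def K_def A_def)
  have "prob (none_heavy H S) = (\<Prod>e\<in>S. 1 - (\<Prod>k\<in>K e. prob {\<omega> \<in> space M. field k \<omega> \<in> A k}))"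
    unfolding eq using S by (intro prob_blocks) (auto simp: K_def A_def disjoint_family_on_def)
  also have "\<dots> = (\<Prod>e\<in>S. 1 - p * G H)"
  proof (rule prod.cong)
    fix e assume "e \<in> S"
    then have "e \<in> all_edges" using S by auto
    from prob_present[OF this] prob_heavy[OF this, of H]
    show "1 - (\<Prod>k\<in>K e. prob {\<omega> \<in> space M. field k \<omega> \<in> A k}) = 1 - p * G H"
      by (simp add: K_def A_def)
  qed simp
  finally show "prob (none_heavy H S) = (1 - p * G H) ^ card S" by simp
  have ev: "{\<omega> \<in> space M. \<not> (pr e \<omega> \<and> H < v e \<omega>)} \<in> events" if "e \<in> S" for e
  proof -
    have "e \<in> all_edges" using S that by auto
    note [measurable] = v_measurable[OF this] pr_measurable[OF this]
    show ?thesis by measurable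
  qed
  show "none_heavy H S \<in> events"
    unfolding none_heavy_def by (rule sets.sets_Collect_finite_All) (use S ev in auto)
qed

text \<open>The threshold \<open>H\<close> covers \<open>6 * K\<close> for the total length of the
  vicinity and \<open>z\<close> for the excess of its other edges.\<close>

lemma geodesic_uses_heavy_edge:
  assumes \<omega>: "\<omega> \<in> space M" and pos: "\<And>e. e \<in> all_edges \<Longrightarrow> 0 < v e \<omega>"
    and l: "\<omega> \<notin> not_linked n B" and B: "1 \<le> B" "B \<le> K"
    and g: "is_geodesic (present_edges pr \<omega>) (\<lambda>e. v e \<omega>) 0 (int n) xs"
    and e: "2 * int K \<le> i" "int K \<le> j - i" "j - i < 2 * int K" "j + 2 * int K \<le> int n"
    and heavy: "pr (i, j) \<omega>" "H < v (i, j) \<omega>" and H: "6 * real K + z \<le> H"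
    and nb: "\<omega> \<notin> blocked n K B H (i, j)" and nr: "\<omega> \<notin> rivalled K H z (i, j)"
  shows "(i, j) \<in> set (path_edges xs)"
proof (rule geodesic_uses_edge[where K = "int K" and B = "int B", OF _ pos _ _ g])
  show "linked (present_edges pr \<omega>) (\<lambda>e. v e \<omega>) (int n) (int B)"
    using l \<omega> by (auto simp: not_linked_def)
  show "(i, j) \<in> present_edges pr \<omega>" using heavy by (simp add: present_edges_def)
  fix x y assume xy: "0 \<le> x" "y \<le> int n" "int K \<le> y - x"
    "x \<le> i - int K \<and> i - int K < y \<or> x < j + int K \<and> j + int K \<le> y"
  have "x < y" using xy B by linarith
  then have "(x, y) \<in> crossing n K (i, j)" using xy by (auto simp: crossing_def edges_between_def)
  then have "v (x, y) \<omega> < real (edge_length (x, y)) / (2 * real B)"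
    using nb heavy \<omega> unfolding blocked_def by (auto simp: not_le)
  then show "v (x, y) \<omega> < real_of_int (y - x) / (2 * real_of_int (int B))"
    using real_edge_length[of "(x, y)"] \<open>x < y\<close> by simp
next
  have eq: "{(x, y). i - 2 * int K \<le> x \<and> x < y \<and> y \<le> j + 2 * int K} = edges_between (i - 2 * int K) (j + 2 * int K)"
    by (simp add: edges_between_def)
  have "(\<Sum>f\<in>edges_between (i - 2 * int K) (j + 2 * int K) - {(i, j)}. excess (\<lambda>e. v e \<omega>) f) < z"
    using nr heavy \<omega> by (auto simp: rivalled_def not_le)
  moreover have "real_of_int (j - i + 4 * int K) \<le> 6 * real K" using e by linarith
  ultimately show "real_of_int (j - i + 4 * int K) +
      (\<Sum>f\<in>{(x, y). i - 2 * int K \<le> x \<and> x < y \<and> y \<le> j + 2 * int K} - {(i, j)}. excess (\<lambda>e. v e \<omega>) f) < v (i, j) \<omega>"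
    unfolding eq using heavy H by linarith
qed (use B e in auto)

section \<open>Choice of the constants and of the candidate edges\<close>

text \<open>Serves the lower bounds on both edges as well as the fluctuations. For the latter it
  matters that \<Lambda> does not depend on \<open>n\<close>: it bounds the cost of summing over
  \<open>S\<close>.\<close>

lemma geodesic_heavy_edges:
  assumes \<beta>: "0 < \<beta>" "\<beta> < \<alpha>" and \<eta>: "0 < \<eta>"
  obtains \<Lambda> H where "0 < \<Lambda>" "\<And>n. real n powr \<beta> \<le> H n"
    "eventually (\<lambda>n. \<exists>S X. S \<subseteq> edges_between 0 (int n) \<and>
       (\<forall>f\<in>S. real n powr \<beta> \<le> real (edge_length f)) \<and> real (card S) * G (H n) \<le> \<Lambda> \<and>
       X \<in> events \<and> prob X \<le> \<eta> \<and>
       (\<forall>\<omega>\<in>space M - X. (\<exists>xs. is_path (present_edges pr \<omega>) 0 (int n) xs) \<and>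
          (\<forall>xs. is_geodesic (present_edges pr \<omega>) (\<lambda>e. v e \<omega>) 0 (int n) xs \<longrightarrow>
             (\<exists>f\<in>S. f \<in> set (path_edges xs) \<and> H n < v f \<omega>)))) sequentially"
proof -
  have \<beta>1: "\<beta> < 1" using \<beta> \<alpha>_bounds by simp
  \<comment> \<open>\<theta> is the expected number of heavy weights aimed at: no candidate is both
    heavy and present with probability at most \<open>exp (- p * \<theta>)\<close>, hence at most
    \<open>\<eta> / 4\<close>.\<close>
  define \<theta> where "\<theta> = max 1 (ln (4 / \<eta>) / p)"
  have \<theta>: "1 \<le> \<theta>" "exp (- p * \<theta>) \<le> \<eta> / 4"
  proof -
    have "ln (4 / \<eta>) \<le> p * \<theta>" using p_range by (simp add: \<theta>_def max_def field_simps)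
    then have "exp (- (p * \<theta>)) \<le> exp (- ln (4 / \<eta>))" by simp
    also have "\<dots> = \<eta> / 4" using \<eta> by (simp add: exp_minus)
    finally show "exp (- p * \<theta>) \<le> \<eta> / 4" by simp
  qed (simp add: \<theta>_def)
  \<comment> \<open>With \<open>z = a * K\<close>, Markov's bound summed over \<open>S\<close> is at
    most \<open>(\<theta> + 1) * (6 * V2 / a)\<close>, which this \<open>a\<close> makes at most
    \<open>\<eta> / 4\<close>. The 6 in \<open>A\<close> pays for the length of the
    vicinity.\<close>
  define a where "a = 1 + 24 * (\<theta> + 1) * V2 / \<eta>"
  define A where "A = 6 + a"
  have a: "1 \<le> a" "(\<theta> + 1) * (6 * V2 / a) \<le> \<eta> / 4"
  proof -
    show "1 \<le> a" using \<theta> V2_nonneg \<eta> by (simp add: a_def)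
    have "24 * (\<theta> + 1) * V2 / \<eta> \<le> a" by (simp add: a_def)
    then have "24 * (\<theta> + 1) * V2 \<le> a * \<eta>" using \<eta> by (simp add: field_simps)
    then show "(\<theta> + 1) * (6 * V2 / a) \<le> \<eta> / 4" using \<open>1 \<le> a\<close> by (simp add: field_simps)
  qed
  \<comment> \<open>\<open>r\<close> lies between 2 and \<open>s\<close>; half of the surplus
    \<open>r - 2\<close> is spent on convergence, and the other half leaves
    \<open>K powr (- \<kappa>)\<close> for the crossing edges.\<close>
  define r where "r = (2 + s) / 2"
  define \<kappa> where "\<kappa> = (r - 2) / 2"
  have r: "2 < r" "r < s" "0 < \<kappa>" "r - 2 - \<kappa> = \<kappa>" using s_gt_2 by (auto simp: r_def \<kappa>_def field_simps)
  obtain D where D: "0 < D" "long_heavy_bound \<kappa> r D" using long_heavy_boundE[of \<kappa> r] r by auto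
  \<comment> \<open>Linking costs \<open>B powr r\<close>, about
    \<open>n powr (\<delta> * r)\<close>, which must stay below the gain
    \<open>K powr \<kappa>\<close>, about \<open>n powr (\<beta> * \<kappa>)\<close>. The bound
    \<delta> \<le> \<beta> gives \<open>B \<le> K\<close>.\<close>
  define \<delta> where "\<delta> = min (\<beta> / 2) (\<beta> * \<kappa> / (2 * r))"
  have \<delta>: "0 < \<delta>" "\<delta> \<le> \<beta>" using \<beta> r by (auto simp: \<delta>_def)
  have \<delta>r: "\<delta> * r - \<beta> * \<kappa> < 0"
  proof -
    have "\<delta> * r \<le> \<beta> * \<kappa> / (2 * r) * r" using r by (intro mult_right_mono) (auto simp: \<delta>_def)
    also have "\<dots> = \<beta> * \<kappa> / 2" using r by simp
    also have "\<dots> < \<beta> * \<kappa>" using \<beta> r by simp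
    finally show ?thesis by simp
  qed
  \<comment> \<open>The midpoint between \<open>s\<close> and \<open>1 + 1 / \<beta>\<close>; the
    former is smaller because \<open>\<beta> * (s - 1) < 1\<close>.\<close>
  define r' where "r' = (s + (1 + 1 / \<beta>)) / 2"
  have "\<beta> * (s - 1) < 1"
    using mult_strict_right_mono[OF \<beta>(2), of "s - 1"] \<alpha>_bounds s_gt_2 by simp
  then have "s < 1 + 1 / \<beta>" using \<beta> by (simp add: field_simps)
  then have r': "s < r'" "r' < 1 + 1 / \<beta>" by (auto simp: r'_def)
  then have \<beta>r': "\<beta> * r' < 1 + \<beta>" using \<beta> mult_strict_left_mono[OF r'(2) \<beta>(1)] by (simp add: distrib_left)
  obtain c where c: "0 < c" "\<And>x. 1 \<le> x \<Longrightarrow> c * x powr (- r') \<le> G x" using G.lower_bound[OF r'(1)] by metis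
  define K where "K = scale \<beta>"
  define B where "B = scale \<delta>"
  define H where "H n = A * real (K n)" for n
  define \<Lambda> where "\<Lambda> = \<theta> + 1"
  define block where "block n = D * real (B n) powr r * 2 * real (K n) powr (- (r - 2 - \<kappa>))" for n
  have block0: "block \<longlonglongrightarrow> 0"
  proof (rule Lim_null_comparison)
    show "(\<lambda>n. (D * 2 powr r * 2) * real n powr (\<delta> * r - \<beta> * \<kappa>)) \<longlonglongrightarrow> 0"
      by (rule powr_neg_tendsto_0[OF \<delta>r])
    show "eventually (\<lambda>n. norm (block n) \<le> (D * 2 powr r * 2) * real n powr (\<delta> * r - \<beta> * \<kappa>)) sequentially"
      using eventually_ge_at_top[of 1]
    proof eventually_elim
      case (elim n)
      have "real (B n) powr r \<le> (2 * real n powr \<delta>) powr r"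
        unfolding B_def using scale_bounds[OF elim] \<delta> r by (intro powr_mono2) auto
      moreover have "real (K n) powr (- \<kappa>) \<le> (real n powr \<beta>) powr (- \<kappa>)"
        unfolding K_def using scale_ge[of n \<beta>] elim r by (intro powr_mono2') auto
      ultimately have "D * real (B n) powr r * 2 * real (K n) powr (- \<kappa>)
          \<le> D * (2 * real n powr \<delta>) powr r * 2 * (real n powr \<beta>) powr (- \<kappa>)"
        using D by (intro mult_mono) auto
      also have "\<dots> = (D * 2 powr r * 2) * (real n powr (\<delta> * r) * real n powr (\<beta> * (- \<kappa>)))"
        by (simp add: powr_mult powr_powr)
      also have "\<dots> = (D * 2 powr r * 2) * real n powr (\<delta> * r - \<beta> * \<kappa>)"
        by (simp only: powr_add[symmetric]) simp
      finally show ?case using D r(4) by (simp add: block_def)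
    qed
  qed
  have ev1: "eventually (\<lambda>n. prob (not_linked n (B n)) < \<eta> / 4) sequentially"
    unfolding B_def using \<eta> by (intro order_tendstoD(2)[OF not_linked_tendsto_0[OF \<delta>(1)]]) auto
  have ev2: "eventually (\<lambda>n. block n < \<eta> / (4 * \<Lambda>)) sequentially"
    using \<eta> \<theta> by (intro order_tendstoD(2)[OF block0]) (auto simp: \<Lambda>_def)
  have ev3: "eventually (\<lambda>n. (\<theta> / c * A powr r') * real (K n) powr r' + 1 \<le> real ((n - 6 * K n) * K n)) sequentially"
    unfolding K_def using \<beta> \<beta>1 \<beta>r' r' s_gt_2 c \<theta> by (intro eventually_scale_count) auto
  have ev4: "eventually (\<lambda>n. 6 * K n \<le> n) sequentially"
    unfolding K_def using \<beta> \<beta>1 by (intro eventually_scale_le) auto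
  show ?thesis
  proof (rule that[of \<Lambda> H])
    show "0 < \<Lambda>" using \<theta> by (simp add: \<Lambda>_def)
    show "real n powr \<beta> \<le> H n" for n
    proof -
      have "real n powr \<beta> \<le> 1 * real (K n)" using scale_ge by (simp add: K_def)
      also have "\<dots> \<le> H n" unfolding H_def using a by (intro mult_right_mono) (auto simp: A_def)
      finally show ?thesis .
    qed
    show "eventually (\<lambda>n. \<exists>S X. S \<subseteq> edges_between 0 (int n) \<and>
       (\<forall>f\<in>S. real n powr \<beta> \<le> real (edge_length f)) \<and> real (card S) * G (H n) \<le> \<Lambda> \<and>
       X \<in> events \<and> prob X \<le> \<eta> \<and>
       (\<forall>\<omega>\<in>space M - X. (\<exists>xs. is_path (present_edges pr \<omega>) 0 (int n) xs) \<and>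
          (\<forall>xs. is_geodesic (present_edges pr \<omega>) (\<lambda>e. v e \<omega>) 0 (int n) xs \<longrightarrow>
             (\<exists>f\<in>S. f \<in> set (path_edges xs) \<and> H n < v f \<omega>)))) sequentially"
      using ev1 ev2 ev3 ev4 eventually_ge_at_top[of 1]
    proof eventually_elim
      case (elim n)
      let ?K = "K n" and ?B = "B n" and ?H = "H n"
      have K1: "1 \<le> ?K" and B1: "1 \<le> ?B" and BK: "?B \<le> ?K"
        unfolding K_def B_def using scale_bounds[OF elim(5)] scale_mono[OF elim(5)] \<beta> \<delta> by auto
      have H1: "1 \<le> ?H"
      proof -
        have "1 * 1 \<le> A * real ?K" using K1 a by (intro mult_mono) (auto simp: A_def)
        then show ?thesis by (simp add: H_def)
      qed
      have GH: "0 < G ?H" by (rule G.pos)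
      define P where "P = {(i, j). 2 * int ?K \<le> i \<and> int ?K \<le> j - i \<and> j - i < 2 * int ?K \<and> j + 2 * int ?K \<le> int n}"
      \<comment> \<open>Rounding up puts \<open>N * G ?H\<close> between \<theta> and
        \<open>\<theta> + 1\<close>: enough heavy weights on average, but boundedly many.\<close>
      define N where "N = nat \<lceil>\<theta> / G ?H\<rceil>"
      have N: "\<theta> \<le> real N * G ?H" "real N * G ?H \<le> \<Lambda>"
      proof -
        have "\<theta> / G ?H \<le> real N" unfolding N_def by linarith
        then show "\<theta> \<le> real N * G ?H" using GH by (simp add: field_simps)
        have "0 \<le> \<theta> / G ?H" using \<theta> GH by simp
        then have "real N \<le> \<theta> / G ?H + 1" unfolding N_def by linarith
        then have "real N * G ?H \<le> (\<theta> / G ?H + 1) * G ?H" using GH by (intro mult_right_mono) auto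
        also have "\<dots> = \<theta> + G ?H" using GH by (simp add: field_simps)
        finally show "real N * G ?H \<le> \<Lambda>" using G.le_1[of ?H] by (simp add: \<Lambda>_def)
      qed
      have "N \<le> card P"
      proof -
        have "\<theta> / G ?H \<le> \<theta> / (c * ?H powr (- r'))"
          using c(2)[OF H1] c(1) \<theta> H1 GH by (intro divide_left_mono) auto
        also have "\<dots> = (\<theta> / c * A powr r') * real ?K powr r'"
        proof -
          have "?H powr r' = A powr r' * real ?K powr r'" by (simp add: H_def powr_mult)
          moreover have "0 < ?H powr r'" using H1 by simp
          ultimately show ?thesis by (simp add: powr_minus_divide)
        qed
        finally have "\<theta> / G ?H + 1 \<le> real ((n - 6 * ?K) * ?K)" using elim(3) by linarith
        moreover have "real N \<le> \<theta> / G ?H + 1" unfolding N_def using \<theta> GH by (smt (verit) divide_nonneg_pos of_nat_ceiling of_nat_nat real_nat_ceiling_ge ceiling_correct zero_le_ceiling)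
        ultimately have "real N \<le> real ((n - 6 * ?K) * ?K)" by linarith
        then have "N \<le> (n - 6 * ?K) * ?K" by (simp only: of_nat_le_iff)
        also have "\<dots> \<le> card P" unfolding P_def by (rule card_candidate_edges) (use elim in simp)
        finally show ?thesis .
      qed
      then obtain S where S: "S \<subseteq> P" "card S = N" "finite S"
        by (rule obtain_subset_with_card_n)
      have PE: "P \<subseteq> edges_between 0 (int n)" using K1 by (auto simp: P_def edges_between_def)
      have Sall: "S \<subseteq> all_edges" using S PE edges_between_subset by blast
      obtain X0 where X0: "X0 \<in> events" "prob X0 = 0" "\<And>\<omega> e. \<omega> \<in> space M - X0 \<Longrightarrow> e \<in> all_edges \<Longrightarrow> 0 < v e \<omega>"
        using weights_pos_nullE by metis
      define z where "z = a * real ?K"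
      have z: "0 < z" using a K1 by (simp add: z_def)
      define X1 where "X1 = not_linked n ?B"
      define X2 where "X2 = none_heavy ?H S"
      define X3 where "X3 = (\<Union>e\<in>S. blocked n ?K ?B ?H e)"
      define X4 where "X4 = (\<Union>e\<in>S. rivalled ?K ?H z e)"
      have X1: "X1 \<in> events" "prob X1 \<le> \<eta> / 4"
        unfolding X1_def using not_linked(1)[OF B1] elim(1) by auto
      have X2: "X2 \<in> events" "prob X2 \<le> \<eta> / 4"
      proof -
        show "X2 \<in> events" unfolding X2_def using none_heavy(1)[OF S(3) Sall] .
        have "p * G ?H \<le> 1" using p_range G.le_1[of ?H] GH by (intro mult_le_one) auto
        then have "prob X2 \<le> exp (- (p * G ?H)) ^ N"
          unfolding X2_def none_heavy(2)[OF S(3) Sall] S(2)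
          using exp_ge_add_one_self[of "- (p * G ?H)"] by (intro power_mono) auto
        also have "\<dots> = exp (- p * (real N * G ?H))" by (simp add: exp_of_nat_mult[symmetric] mult_ac)
        also have "\<dots> \<le> exp (- p * \<theta>)" using N(1) p_range by simp
        finally show "prob X2 \<le> \<eta> / 4" using \<theta>(2) by linarith
      qed
      have X3: "X3 \<in> events" "prob X3 \<le> \<eta> / 4"
      proof -
        show "X3 \<in> events" unfolding X3_def using S(3) Sall by (intro sets.finite_UN blocked_events) auto
        have "prob X3 \<le> (\<Sum>e\<in>S. prob (blocked n ?K ?B ?H e))"
          unfolding X3_def using S(3) Sall by (intro finite_measure_subadditive_finite image_subsetI blocked_events) auto
        also have "\<dots> \<le> (\<Sum>e\<in>S. G ?H * block n)"
          unfolding block_def using Sall D r K1 B1 by (intro sum_mono prob_blocked) auto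
        also have "\<dots> = (real N * G ?H) * block n" using S by simp
        also have "\<dots> \<le> \<Lambda> * (\<eta> / (4 * \<Lambda>))"
          using N(2) elim(2) \<theta> D by (intro mult_mono) (auto simp: \<Lambda>_def block_def)
        also have "\<dots> = \<eta> / 4" using \<theta>(1) by (simp add: \<Lambda>_def field_simps)
        finally show "prob X3 \<le> \<eta> / 4" .
      qed
      have X4: "X4 \<in> events" "prob X4 \<le> \<eta> / 4"
      proof -
        show "X4 \<in> events" unfolding X4_def using S(3) Sall by (intro sets.finite_UN rivalled_events) auto
        have "prob X4 \<le> (\<Sum>e\<in>S. prob (rivalled ?K ?H z e))"
          unfolding X4_def using S(3) Sall by (intro finite_measure_subadditive_finite image_subsetI rivalled_events) auto
        also have "\<dots> \<le> (\<Sum>e\<in>S. G ?H * (6 * real ?K * V2 / z))"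
          using Sall S(1) z by (intro sum_mono prob_rivalled) (auto simp: P_def)
        also have "\<dots> = (real N * G ?H) * (6 * V2 / a)" using S K1 by (simp add: z_def)
        also have "\<dots> \<le> \<Lambda> * (6 * V2 / a)"
          using N(2) V2_nonneg a by (intro mult_right_mono) auto
        finally show "prob X4 \<le> \<eta> / 4" using a(2) by (simp add: \<Lambda>_def)
      qed
      define X where "X = X0 \<union> (X1 \<union> (X2 \<union> (X3 \<union> X4)))"
      have X: "X \<in> events" using X0 X1 X2 X3 X4 by (simp add: X_def)
      have "prob X \<le> prob X0 + prob (X1 \<union> (X2 \<union> (X3 \<union> X4)))"
        unfolding X_def using X0 X1 X2 X3 X4 by (intro measure_Un_le) auto
      also have "prob (X1 \<union> (X2 \<union> (X3 \<union> X4))) \<le> prob X1 + prob (X2 \<union> (X3 \<union> X4))"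
        using X0 X1 X2 X3 X4 by (intro measure_Un_le) auto
      also have "prob (X2 \<union> (X3 \<union> X4)) \<le> prob X2 + prob (X3 \<union> X4)"
        using X0 X1 X2 X3 X4 by (intro measure_Un_le) auto
      also have "prob (X3 \<union> X4) \<le> prob X3 + prob X4"
        using X0 X1 X2 X3 X4 by (intro measure_Un_le) auto
      finally have probX: "prob X \<le> \<eta>" using X0(2) X1(2) X2(2) X3(2) X4(2) by simp
      have len: "real n powr \<beta> \<le> real (edge_length f)" if "f \<in> S" for f
      proof -
        have "?K \<le> edge_length f" using that S(1) by (auto simp: P_def edge_length_def)
        then show ?thesis using scale_ge[of n \<beta>] by (simp add: K_def)
      qed
      have main: "(\<exists>xs. is_path (present_edges pr \<omega>) 0 (int n) xs) \<and>
          (\<forall>xs. is_geodesic (present_edges pr \<omega>) (\<lambda>e. v e \<omega>) 0 (int n) xs \<longrightarrow>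
             (\<exists>f\<in>S. f \<in> set (path_edges xs) \<and> ?H < v f \<omega>))" if \<omega>: "\<omega> \<in> space M - X" for \<omega>
      proof
        have \<omega>': "\<omega> \<in> space M" "\<omega> \<in> space M - X0" "\<omega> \<notin> X1" "\<omega> \<notin> X2" "\<omega> \<notin> X3" "\<omega> \<notin> X4"
          using \<omega> by (auto simp: X_def)
        have pos: "\<And>e. e \<in> all_edges \<Longrightarrow> 0 < v e \<omega>" using X0(3)[OF \<omega>'(2)] .
        have l: "linked (present_edges pr \<omega>) (\<lambda>e. v e \<omega>) (int n) (int ?B)"
          using \<omega>'(1,3) by (auto simp: X1_def not_linked_def)
        show "\<exists>xs. is_path (present_edges pr \<omega>) 0 (int n) xs"
          by (rule linked_path[OF l pos, of 0 "int n"]) (use elim(4) B1 BK in auto)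
        obtain e where e: "e \<in> S" "pr e \<omega>" "?H < v e \<omega>"
          using \<omega>'(1,4) by (auto simp: X2_def none_heavy_def)
        obtain i j where ij: "e = (i, j)" by (cases e)
        have eP: "2 * int ?K \<le> i" "int ?K \<le> j - i" "j - i < 2 * int ?K" "j + 2 * int ?K \<le> int n"
          using e(1) S(1) ij by (auto simp: P_def)
        show "\<forall>xs. is_geodesic (present_edges pr \<omega>) (\<lambda>e. v e \<omega>) 0 (int n) xs \<longrightarrow>
             (\<exists>f\<in>S. f \<in> set (path_edges xs) \<and> ?H < v f \<omega>)"
        proof (intro allI impI bexI[OF _ e(1)] conjI e(3))
          fix xs assume g: "is_geodesic (present_edges pr \<omega>) (\<lambda>e. v e \<omega>) 0 (int n) xs"
          have "(i, j) \<in> set (path_edges xs)"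
          proof (rule geodesic_uses_heavy_edge[OF \<omega>'(1) pos _ B1 BK g eP])
            show "6 * real ?K + z \<le> ?H" by (simp add: z_def H_def A_def distrib_right)
            show "\<omega> \<notin> not_linked n ?B" using \<omega>' by (simp add: X1_def)
            show "\<omega> \<notin> blocked n ?K ?B ?H (i, j)" using \<omega>'(5) e(1) ij by (auto simp: X3_def)
            show "\<omega> \<notin> rivalled ?K ?H z (i, j)" using \<omega>'(6) e(1) ij by (auto simp: X4_def)
          qed (use e ij in auto)
          then show "e \<in> set (path_edges xs)" using ij by simp
        qed
      qed
      show ?case
      proof (intro exI[of _ S] exI[of _ X] conjI ballI)
        show "S \<subseteq> edges_between 0 (int n)" using S(1) PE by blast
        show "real (card S) * G ?H \<le> \<Lambda>" using N(2) S(2) by simp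
      qed (use len X probX main in auto)
    qed
  qed
qed

end

section \<open>Fluctuations\<close>

lemma log_ratio_bound:
  fixes x a e :: real
  assumes "2 \<le> n" "real n powr (a - e) \<le> x" "x \<le> real n powr (a + e)"
  shows "\<bar>ln x / ln (real n) - a\<bar> \<le> e"
proof -
  have n: "0 < ln (real n)" "0 < real n" using assms by auto
  have "0 < x" using assms(2) n by (smt (verit) powr_gt_zero)
  then have "(a - e) * ln (real n) \<le> ln x" "ln x \<le> (a + e) * ln (real n)"
    using assms n by (auto simp: ln_powr[symmetric] simp del: ln_powr)
  then have "a - e \<le> ln x / ln (real n)" "ln x / ln (real n) \<le> a + e"
    using n by (auto simp: field_simps)
  then show ?thesis by linarith
qed

text \<open>A path uses an edge at most once, so all edges of the window together dominate it; a
  missing path yields the default value 0. This crude bound is for integrability.\<close>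

lemma abs_max_weight_le:
  "\<bar>real_of_ereal (max_weight E wt i j)\<bar> \<le> (\<Sum>e\<in>edges_between i j. \<bar>wt e\<bar>)"
proof (cases "\<exists>xs. is_path E i j xs")
  case True
  then obtain xs where xs: "is_geodesic E wt i j xs" using geodesic_exists by metis
  then have p: "is_path E i j xs" by (simp add: is_geodesic_def)
  have d: "distinct (path_edges xs)"
    using is_path_bounds(1)[OF p] strict_sorted_iff by (intro distinct_path_edges) auto
  have "\<bar>path_weight wt xs\<bar> = \<bar>\<Sum>e\<in>set (path_edges xs). wt e\<bar>"
    using d by (simp add: path_weight_def sum_list_distinct_conv_sum_set)
  also have "\<dots> \<le> (\<Sum>e\<in>set (path_edges xs). \<bar>wt e\<bar>)" by (rule sum_abs)
  also have "\<dots> \<le> (\<Sum>e\<in>edges_between i j. \<bar>wt e\<bar>)"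
    using path_edges_between[OF p] by (intro sum_mono2) auto
  finally show ?thesis using xs unfolding is_geodesic_def by (metis real_of_ereal.simps(1))
next
  case False
  then have "max_weight E wt i j = - \<infinity>" by (simp add: max_weight_def bot_ereal_def)
  then show ?thesis by (simp add: sum_nonneg)
qed

lemma integrable_uniform_measure:
  fixes f :: "'a \<Rightarrow> real"
  assumes f: "integrable M f" and A: "A \<in> sets M" "emeasure M A \<noteq> 0"
  shows "integrable (uniform_measure M A) f"
proof (rule integrableI_bounded)
  have "f \<in> borel_measurable M" using f by simp
  then show "f \<in> borel_measurable (uniform_measure M A)" by (simp cong: measurable_cong_sets)
  have "(\<integral>\<^sup>+ x. ennreal (norm (f x)) \<partial>uniform_measure M A)
      = (\<integral>\<^sup>+ x. ennreal (norm (f x)) * indicator A x \<partial>M) / emeasure M A"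
    using A f by (intro nn_integral_uniform_measure) auto
  also have "\<dots> \<le> (\<integral>\<^sup>+ x. ennreal (norm (f x)) \<partial>M) / emeasure M A"
    by (intro divide_right_mono_ennreal nn_integral_mono) (auto simp: indicator_def)
  also have "\<dots> < \<infinity>"
    using f A by (auto simp: integrable_iff_bounded ennreal_divide_eq_top_iff less_top[symmetric])
  finally show "(\<integral>\<^sup>+ x. ennreal (norm (f x)) \<partial>uniform_measure M A) < \<infinity>" .
qed

text \<open>These properties refute a Gaussian limit: continuity gives convergence of distribution
  functions at every point, and the limit has mass in \<open>(0, 1]\<close>.\<close>

lemma normal_cdf_increment:
  assumes "0 < \<sigma>"
  defines "N \<equiv> density lborel (\<lambda>x. ennreal (normal_density 0 \<sigma> x))"
  shows "isCont (cdf N) x" "0 < cdf N 1 - cdf N 0"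
proof -
  interpret N: prob_space N unfolding N_def by (rule prob_space_normal_density[OF assms(1)])
  interpret N: real_distribution N by unfold_locales (simp add: N_def)
  have "emeasure N {x} = (\<integral>\<^sup>+ y. ennreal (normal_density 0 \<sigma> y) * indicator {x} y \<partial>lborel)"
    unfolding N_def by (subst emeasure_density) auto
  also have "\<dots> = 0"
    by (subst nn_integral_0_iff_AE) (auto intro: AE_mp[OF AE_lborel_singleton[of x]])
  finally have "measure N {x} = 0" by (simp add: measure_def)
  then show "isCont (cdf N) x" by (simp add: N.isCont_cdf)
  have "emeasure N {0<..1} \<noteq> 0"
  proof
    assume "emeasure N {0<..1} = 0"
    then have "(\<integral>\<^sup>+ y. ennreal (normal_density 0 \<sigma> y) * indicator {0<..1} y \<partial>lborel) = 0"
      unfolding N_def by (subst (asm) emeasure_density) auto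
    then have "AE y in lborel. ennreal (normal_density 0 \<sigma> y) * indicator {0<..1} y = 0"
      by (subst (asm) nn_integral_0_iff_AE) auto
    then have "AE y in lborel. y \<notin> {0<..1::real}"
    proof eventually_elim
      case (elim y)
      then show ?case using normal_density_pos[OF assms(1), of 0 y] by (auto simp: indicator_def split: if_splits)
    qed
    then have "emeasure lborel {0<..1::real} = 0"
      by (subst (asm) AE_iff_measurable[of "{0<..1}"]) auto
    then show False by simp
  qed
  then have "0 < measure N {0<..1}" by (simp add: N.emeasure_eq_measure zero_less_measure_iff)
  then show "0 < cdf N 1 - cdf N 0" using N.cdf_diff_eq[of 0 1] by simp
qed

context heavy_edge_lpp
begin

section \<open>Anticoncentration of the passage time\<close>

text \<open>The part of the window above \<open>H\<close> is short relative to its position, so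
  regular variation applies at \<open>u\<close>, and \<open>G u \<le> G H\<close> brings the bound
  back to \<open>H\<close>.\<close>

lemma weight_interval_le:
  assumes \<epsilon>: "\<And>x. x0 \<le> x \<Longrightarrow> G x - G ((1 + \<epsilon>) * x) \<le> \<tau> * G x"
    and H: "x0 \<le> H" "0 \<le> H" and h: "0 < h" "2 * h \<le> \<epsilon> * H" and \<tau>: "0 \<le> \<tau>" "0 < \<epsilon>" and e: "e \<in> all_edges"
  shows "prob {\<omega> \<in> space M. H < v e \<omega> \<and> y \<le> r + v e \<omega> \<and> r + v e \<omega> \<le> y + h} \<le> \<tau> * G H"
proof -
  \<comment> \<open>Subtracting \<open>h\<close> puts \<open>u\<close> strictly below the window
    even if its left end \<open>y - r\<close> is attained; what lies above \<open>u\<close> then has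
    length at most \<open>2 * h\<close>.\<close>
  define u where "u = max H (y - r - h)"
  have u: "H \<le> u" "x0 \<le> u" "0 \<le> u" using H by (auto simp: u_def)
  have "2 * h \<le> \<epsilon> * u" using h(2) mult_left_mono[OF u(1), of \<epsilon>] \<tau> by linarith
  then have u': "u + 2 * h \<le> (1 + \<epsilon>) * u" by (simp add: distrib_right)
  have ev: "{\<omega> \<in> space M. v e \<omega> \<in> {u<..} - {(1 + \<epsilon>) * u<..}} \<in> events"
    using measurable_sets[OF v_measurable[OF e], of "{u<..} - {(1 + \<epsilon>) * u<..}"]
    by (simp add: vimage_def Int_def conj_commute)
  have "prob {\<omega> \<in> space M. H < v e \<omega> \<and> y \<le> r + v e \<omega> \<and> r + v e \<omega> \<le> y + h}
      \<le> prob {\<omega> \<in> space M. v e \<omega> \<in> {u<..} - {(1 + \<epsilon>) * u<..}}"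
  proof (rule finite_measure_mono[OF _ ev], rule subsetI)
    fix \<omega> assume "\<omega> \<in> {\<omega> \<in> space M. H < v e \<omega> \<and> y \<le> r + v e \<omega> \<and> r + v e \<omega> \<le> y + h}"
    then have \<omega>: "\<omega> \<in> space M" "H < v e \<omega>" "y - r \<le> v e \<omega>" "v e \<omega> \<le> y - r + h" by auto
    have "u < v e \<omega>" using \<omega> h by (auto simp: u_def)
    moreover have "y - r - h \<le> u" by (simp add: u_def)
    then have "v e \<omega> \<le> (1 + \<epsilon>) * u" using \<omega>(4) u' by linarith
    ultimately show "\<omega> \<in> {\<omega> \<in> space M. v e \<omega> \<in> {u<..} - {(1 + \<epsilon>) * u<..}}" using \<omega>(1) by simp
  qed
  also have "\<dots> = measure \<mu> ({u<..} - {(1 + \<epsilon>) * u<..})" using e by (intro measure_law) auto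
  also have "\<dots> = G u - G ((1 + \<epsilon>) * u)"
  proof -
    have "u \<le> (1 + \<epsilon>) * u" using u \<tau> by (simp add: distrib_right)
    then show ?thesis unfolding G_def by (intro law.finite_measure_Diff) auto
  qed
  also have "\<dots> \<le> \<tau> * G u" by (rule \<epsilon>[OF u(2)])
  also have "\<dots> \<le> \<tau> * G H" using G.antimono[OF u(1)] \<tau> by (intro mult_left_mono) auto
  finally show ?thesis .
qed

text \<open>Uniformity in \<open>y\<close> lets the window be placed later at conditional means and
  at arbitrary centrings.\<close>

lemma prob_interval_small:
  assumes \<beta>: "\<beta> < \<alpha>" and \<eta>: "0 < \<eta>"
  shows "eventually (\<lambda>n. \<forall>y. prob {\<omega> \<in> space M. max_path_weight v pr 0 (int n) \<omega>
    \<in> {ereal y..ereal (y + real n powr \<beta>)}} \<le> \<eta>) sequentially"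
proof -
  \<comment> \<open>\<beta>' exceeds both \<beta> and 0, so that the window is small compared with
    \<open>H n\<close> and \<open>H n\<close> tends to infinity, even for negative \<beta>.\<close>
  define \<beta>' where "\<beta>' = (max \<beta> 0 + \<alpha>) / 2"
  have \<beta>': "0 < \<beta>'" "\<beta>' < \<alpha>" "\<beta> < \<beta>'" using \<beta> \<alpha>_bounds by (auto simp: \<beta>'_def)
  have \<eta>2: "0 < \<eta> / 2" using \<eta> by simp
  show ?thesis
  proof (rule geodesic_heavy_edges[OF \<beta>'(1,2) \<eta>2])
    fix \<Lambda> H
    assume \<Lambda>: "0 < \<Lambda>" and H: "\<And>n. real n powr \<beta>' \<le> H n"
      and ev: "eventually (\<lambda>n. \<exists>S X. S \<subseteq> edges_between 0 (int n) \<and>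
       (\<forall>f\<in>S. real n powr \<beta>' \<le> real (edge_length f)) \<and> real (card S) * G (H n) \<le> \<Lambda> \<and>
       X \<in> events \<and> prob X \<le> \<eta> / 2 \<and>
       (\<forall>\<omega>\<in>space M - X. (\<exists>xs. is_path (present_edges pr \<omega>) 0 (int n) xs) \<and>
          (\<forall>xs. is_geodesic (present_edges pr \<omega>) (\<lambda>e. v e \<omega>) 0 (int n) xs \<longrightarrow>
             (\<exists>f\<in>S. f \<in> set (path_edges xs) \<and> H n < v f \<omega>)))) sequentially"
    \<comment> \<open>Summed over \<open>S\<close>, the concentration bounds give
      \<open>\<tau> * \<Lambda> = \<eta> / 2\<close>.\<close>
    define \<tau> where "\<tau> = \<eta> / (2 * \<Lambda>)"
    have \<tau>: "0 < \<tau>" using \<eta> \<Lambda> by (simp add: \<tau>_def)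
    obtain \<epsilon> x0 where \<epsilon>: "0 < \<epsilon>" "\<And>x. x0 \<le> x \<Longrightarrow> G x - G ((1 + \<epsilon>) * x) \<le> \<tau> * G x"
      using G.small_increments[OF \<tau>] by metis
    have "eventually (\<lambda>n. 2 / \<epsilon> * real n powr \<beta> \<le> real n powr \<beta>') sequentially"
      using \<beta>' by (intro eventually_powr_le) auto
    moreover have "eventually (\<lambda>n. x0 * real n powr 0 \<le> real n powr \<beta>') sequentially"
      using \<beta>' by (intro eventually_powr_le) auto
    ultimately show ?thesis using ev eventually_ge_at_top[of 1]
    proof eventually_elim
      case (elim n)
      then obtain S X where SX: "S \<subseteq> edges_between 0 (int n)" "real (card S) * G (H n) \<le> \<Lambda>"
        "X \<in> events" "prob X \<le> \<eta> / 2"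
        and main: "\<And>\<omega>. \<omega> \<in> space M - X \<Longrightarrow> (\<exists>xs. is_path (present_edges pr \<omega>) 0 (int n) xs) \<and>
          (\<forall>xs. is_geodesic (present_edges pr \<omega>) (\<lambda>e. v e \<omega>) 0 (int n) xs \<longrightarrow>
             (\<exists>f\<in>S. f \<in> set (path_edges xs) \<and> H n < v f \<omega>))" by blast
      have S: "finite S" "S \<subseteq> all_edges"
        using SX(1) edges_between_subset by (auto intro: finite_subset[OF _ finite_edges_between])
      define h where "h = real n powr \<beta>"
      have h: "0 < h" "2 * h \<le> \<epsilon> * H n" "x0 \<le> H n" "0 \<le> H n"
      proof -
        show "0 < h" using elim(4) by (simp add: h_def)
        show "x0 \<le> H n" using elim(2,4) H[of n] by simp
        show "0 \<le> H n" using H[of n] powr_ge_zero[of "real n" \<beta>'] by linarith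
        have "2 * h = \<epsilon> * (2 / \<epsilon> * real n powr \<beta>)" using \<epsilon> by (simp add: h_def)
        also have "\<dots> \<le> \<epsilon> * H n" using \<epsilon>(1) elim(1) H[of n] by (intro mult_left_mono) auto
        finally show "2 * h \<le> \<epsilon> * H n" .
      qed
      define R where "R f = (\<lambda>\<omega>. real_of_ereal (max_path_weight v pr 0 (fst f) \<omega>)
          + real_of_ereal (max_path_weight v pr (snd f) (int n) \<omega>))" for f
      have R [measurable]: "R f \<in> borel_measurable M" for f unfolding R_def by measurable
      define Q where "Q y f = {\<omega> \<in> space M. H n < v f \<omega> \<and> y \<le> R f \<omega> + v f \<omega> \<and> R f \<omega> + v f \<omega> \<le> y + h}" for y f
      have Q: "Q y f \<in> events" "prob (Q y f) \<le> \<tau> * G (H n)" if "f \<in> S" for y f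
      proof -
        have f: "f \<in> all_edges" using that S by auto
        note [measurable] = v_measurable[OF f]
        show "Q y f \<in> events" unfolding Q_def by measurable
        have "fst f < snd f" using f by (simp add: case_prod_beta)
        from indep_var_weight_rest[OF this, of 0 "int n"] have ind: "indep_var borel (v f) borel (R f)"
          by (simp only: R_def prod.collapse)
        show "prob (Q y f) \<le> \<tau> * G (H n)"
          unfolding Q_def
        proof (rule indep_sum_concentration[OF ind])
          show "0 \<le> \<tau> * G (H n)" using \<tau> G.nonneg[of "H n"] by simp
          show "prob {\<omega> \<in> space M. H n < v f \<omega> \<and> y \<le> r + v f \<omega> \<and> r + v f \<omega> \<le> y + h} \<le> \<tau> * G (H n)" for r
            by (rule weight_interval_le[OF \<epsilon>(2) h(3,4,1,2) less_imp_le[OF \<tau>] \<epsilon>(1) f])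
        qed
      qed
      show ?case
      proof
        fix y
        let ?I = "{\<omega> \<in> space M. max_path_weight v pr 0 (int n) \<omega> \<in> {ereal y..ereal (y + real n powr \<beta>)}}"
        \<comment> \<open>\<open>Q y f\<close> forgets that \<open>f\<close> lies on the geodesic
          and keeps what the decomposition implies, a statement about the independent variables
          \<open>v f\<close> and \<open>R f\<close>.\<close>
        have "?I \<subseteq> X \<union> (\<Union>f\<in>S. Q y f)"
        proof
          fix \<omega> assume \<omega>: "\<omega> \<in> ?I"
          show "\<omega> \<in> X \<union> (\<Union>f\<in>S. Q y f)"
          proof (cases "\<omega> \<in> X")
            case False
            with \<omega> have \<omega>X: "\<omega> \<in> space M - X" by simp
            obtain xs where g: "is_geodesic (present_edges pr \<omega>) (\<lambda>e. v e \<omega>) 0 (int n) xs"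
              using main[OF \<omega>X] geodesic_exists by metis
            then obtain f where f: "f \<in> S" "f \<in> set (path_edges xs)" "H n < v f \<omega>"
              using main[OF \<omega>X] by blast
            have "max_path_weight v pr 0 (int n) \<omega> = ereal (R f \<omega> + v f \<omega>)"
              using max_weight_through_edge[OF g, of "fst f" "snd f"] f(2)
              by (simp add: R_def max_path_weight_def)
            then have "\<omega> \<in> Q y f" using \<omega> f by (simp add: Q_def h_def)
            then show ?thesis using f by blast
          qed simp
        qed
        then have "prob ?I \<le> prob (X \<union> (\<Union>f\<in>S. Q y f))"
          using SX(3) Q(1) S by (intro finite_measure_mono) (auto intro!: sets.finite_UN)
        also have "\<dots> \<le> prob X + prob (\<Union>f\<in>S. Q y f)"
          using SX(3) Q(1) S by (intro measure_Un_le sets.finite_UN) auto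
        also have "prob (\<Union>f\<in>S. Q y f) \<le> (\<Sum>f\<in>S. prob (Q y f))"
          using Q(1) S by (intro finite_measure_subadditive_finite image_subsetI) auto
        also have "\<dots> \<le> (\<Sum>f\<in>S. \<tau> * G (H n))" using Q(2) by (intro sum_mono) auto
        also have "\<dots> = \<tau> * (real (card S) * G (H n))" by simp
        also have "\<dots> \<le> \<tau> * \<Lambda>" using SX(2) \<tau> by (intro mult_left_mono) auto
        also have "\<dots> = \<eta> / 2" using \<Lambda> by (simp add: \<tau>_def)
        finally show "prob ?I \<le> \<eta>" using SX(4) by simp
      qed
    qed
  qed
qed

lemma fluctuations:
  assumes "\<beta> < \<alpha>"
  shows "(\<lambda>n. prob {\<omega> \<in> space M. max_path_weight v pr 0 (int n) \<omega>
    \<in> {ereal (y n)..ereal (y n + real n powr \<beta>)}}) \<longlonglongrightarrow> 0"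
proof (rule order_tendstoI)
  fix \<eta> :: real assume \<eta>: "0 < \<eta>"
  show "eventually (\<lambda>n. prob {\<omega> \<in> space M. max_path_weight v pr 0 (int n) \<omega>
    \<in> {ereal (y n)..ereal (y n + real n powr \<beta>)}} < \<eta>) sequentially"
    using prob_interval_small[OF assms half_gt_zero[OF \<eta>]]
  proof eventually_elim
    case (elim n)
    from spec[OF elim, of "y n"] \<eta> show ?case by linarith
  qed
qed (auto intro!: always_eventually intro: less_le_trans)

section \<open>Convergence of the exponents in probability\<close>

lemma geodesic_exponents:
  assumes \<gamma>: "geodesic_choice M v pr \<gamma>" and \<epsilon>: "0 < \<epsilon>" and \<eta>: "0 < \<eta>"
  shows "eventually (\<lambda>n. \<exists>X\<in>events. prob X < \<eta> \<and> (\<forall>\<omega>\<in>space M - X.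
      \<bar>ln (real_of_int (longest_edge (\<gamma> n \<omega>))) / ln (real n) - \<alpha>\<bar> \<le> \<epsilon> \<and>
      \<bar>ln (heaviest_edge (\<lambda>e. v e \<omega>) (\<gamma> n \<omega>)) / ln (real n) - \<alpha>\<bar> \<le> \<epsilon>)) sequentially"
proof -
  \<comment> \<open>The maximum keeps \<beta> positive when \<epsilon> is large.\<close>
  define \<beta> where "\<beta> = max (\<alpha> - \<epsilon>) (\<alpha> / 2)"
  have \<beta>: "0 < \<beta>" "\<beta> < \<alpha>" "\<alpha> - \<epsilon> \<le> \<beta>" using \<alpha>_bounds \<epsilon> by (auto simp: \<beta>_def)
  have \<eta>2: "0 < \<eta> / 2" using \<eta> by simp
  show ?thesis
  proof (rule geodesic_heavy_edges[OF \<beta>(1,2) \<eta>2])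
    fix \<Lambda> H
    assume H: "\<And>n. real n powr \<beta> \<le> H n"
      and ev2: "eventually (\<lambda>n. \<exists>S X. S \<subseteq> edges_between 0 (int n) \<and>
       (\<forall>f\<in>S. real n powr \<beta> \<le> real (edge_length f)) \<and> real (card S) * G (H n) \<le> \<Lambda> \<and>
       X \<in> events \<and> prob X \<le> \<eta> / 2 \<and>
       (\<forall>\<omega>\<in>space M - X. (\<exists>xs. is_path (present_edges pr \<omega>) 0 (int n) xs) \<and>
          (\<forall>xs. is_geodesic (present_edges pr \<omega>) (\<lambda>e. v e \<omega>) 0 (int n) xs \<longrightarrow>
             (\<exists>f\<in>S. f \<in> set (path_edges xs) \<and> H n < v f \<omega>)))) sequentially"
    show ?thesis using geodesic_upper_bound[OF \<epsilon> \<eta>2] ev2 eventually_ge_at_top[of 2]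
    proof eventually_elim
      case (elim n)
      from elim(1) obtain X1 where X1: "X1 \<in> events" "prob X1 < \<eta> / 2"
        and up: "\<And>\<omega>. \<omega> \<in> space M - X1 \<Longrightarrow> \<exists>xs. is_path (present_edges pr \<omega>) 0 (int n) xs"
          "\<And>\<omega> xs. \<omega> \<in> space M - X1 \<Longrightarrow> is_geodesic (present_edges pr \<omega>) (\<lambda>e. v e \<omega>) 0 (int n) xs \<Longrightarrow>
          real_of_int (longest_edge xs) \<le> real n powr (\<alpha> + \<epsilon>) \<and> heaviest_edge (\<lambda>e. v e \<omega>) xs \<le> real n powr (\<alpha> + \<epsilon>)"
        by blast
      from elim(2) obtain S X2 where S: "S \<subseteq> edges_between 0 (int n)"
        "\<And>f. f \<in> S \<Longrightarrow> real n powr \<beta> \<le> real (edge_length f)" and X2: "X2 \<in> events" "prob X2 \<le> \<eta> / 2"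
        and main: "\<And>\<omega> xs. \<omega> \<in> space M - X2 \<Longrightarrow> is_geodesic (present_edges pr \<omega>) (\<lambda>e. v e \<omega>) 0 (int n) xs
           \<Longrightarrow> \<exists>f\<in>S. f \<in> set (path_edges xs) \<and> H n < v f \<omega>" by blast
      have "AE \<omega> in M. (\<exists>xs. is_path (present_edges pr \<omega>) 0 (int n) xs) \<longrightarrow>
         is_geodesic (present_edges pr \<omega>) (\<lambda>e. v e \<omega>) 0 (int n) (\<gamma> n \<omega>)"
        using \<gamma> by (simp add: geodesic_choice_def)
      then obtain X0 where X0: "X0 \<in> null_sets M" "{\<omega> \<in> space M. \<not> ((\<exists>xs. is_path (present_edges pr \<omega>) 0 (int n) xs) \<longrightarrow>
         is_geodesic (present_edges pr \<omega>) (\<lambda>e. v e \<omega>) 0 (int n) (\<gamma> n \<omega>))} \<subseteq> X0"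
        unfolding eventually_ae_filter by blast
      have X0': "X0 \<in> events" "prob X0 = 0" using X0(1) by (auto simp: measure_def null_sets_def)
      show ?case
      proof (intro bexI[of _ "X0 \<union> (X1 \<union> X2)"] conjI ballI)
        show "X0 \<union> (X1 \<union> X2) \<in> events" using X0' X1 X2(1) by auto
        have "prob (X0 \<union> (X1 \<union> X2)) \<le> prob X0 + prob (X1 \<union> X2)"
          using X0' X1 X2(1) by (intro measure_Un_le) auto
        also have "prob (X1 \<union> X2) \<le> prob X1 + prob X2"
          using X1 X2(1) by (intro measure_Un_le) auto
        finally show "prob (X0 \<union> (X1 \<union> X2)) < \<eta>" using X0'(2) X1(2) X2(2) by simp
      next
        fix \<omega> assume \<omega>: "\<omega> \<in> space M - (X0 \<union> (X1 \<union> X2))"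
        let ?wt = "\<lambda>e. v e \<omega>"
        have g: "is_geodesic (present_edges pr \<omega>) ?wt 0 (int n) (\<gamma> n \<omega>)"
          using X0(2) \<omega> up(1)[of \<omega>] by blast
        obtain f where f: "f \<in> S" "f \<in> set (path_edges (\<gamma> n \<omega>))" "H n < v f \<omega>"
          using main[OF _ g] \<omega> by blast
        have fall: "f \<in> all_edges" using f(1) S(1) edges_between_subset by blast
        have low: "real n powr (\<alpha> - \<epsilon>) \<le> real n powr \<beta>"
          using elim(3) \<beta>(3) by (intro powr_mono) auto
        have "real n powr \<beta> \<le> real_of_int (longest_edge (\<gamma> n \<omega>))"
          using S(2)[OF f(1)] real_edge_length[OF fall] longest_edge_ge[OF f(2)] by linarith
        moreover have "real n powr \<beta> \<le> heaviest_edge ?wt (\<gamma> n \<omega>)"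
          using H[of n] f(3) heaviest_edge_ge[OF f(2), of ?wt] by linarith
        ultimately show "\<bar>ln (real_of_int (longest_edge (\<gamma> n \<omega>))) / ln (real n) - \<alpha>\<bar> \<le> \<epsilon>"
          "\<bar>ln (heaviest_edge ?wt (\<gamma> n \<omega>)) / ln (real n) - \<alpha>\<bar> \<le> \<epsilon>"
          using log_ratio_bound[OF elim(3)] up(2)[OF _ g] \<omega> low order_trans by blast+
      qed
    qed
  qed
qed

text \<open>The deviation event is compared by monotonicity with the covering event
  \<open>X\<close>, so measurability is asked of \<open>X\<close> alone.\<close>

lemma converges_in_probI:
  assumes "\<And>\<epsilon> \<eta>. 0 < \<epsilon> \<Longrightarrow> 0 < \<eta> \<Longrightarrow>
    eventually (\<lambda>n. \<exists>X\<in>events. prob X < \<eta> \<and> (\<forall>\<omega>\<in>space M - X. \<bar>Y n \<omega> - c\<bar> \<le> \<epsilon>)) sequentially"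
  shows "converges_in_prob M Y c"
  unfolding converges_in_prob_def
proof (intro allI impI order_tendstoI)
  fix \<epsilon> \<eta> :: real assume "0 < \<epsilon>" "0 < \<eta>"
  from assms[OF this] show "eventually (\<lambda>n. prob {\<omega> \<in> space M. \<epsilon> < \<bar>Y n \<omega> - c\<bar>} < \<eta>) sequentially"
  proof eventually_elim
    case (elim n)
    then obtain X where X: "X \<in> events" "prob X < \<eta>" "\<And>\<omega>. \<omega> \<in> space M - X \<Longrightarrow> \<bar>Y n \<omega> - c\<bar> \<le> \<epsilon>" by blast
    then have "prob {\<omega> \<in> space M. \<epsilon> < \<bar>Y n \<omega> - c\<bar>} \<le> prob X"
      by (intro finite_measure_mono) force+
    with X show ?case by simp
  qed
qed (auto intro!: always_eventually intro: less_le_trans)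

section \<open>Variance and Gaussian limits\<close>

text \<open>Cauchy-Schwarz over the finitely many edges of the window; Chebyshev's inequality below
  asks for a second moment.\<close>

lemma integrable_max_path_weight_sq:
  "integrable M (\<lambda>\<omega>. (real_of_ereal (max_path_weight v pr i j \<omega>))\<^sup>2)"
proof (rule Bochner_Integration.integrable_bound)
  have sq: "integrable M (\<lambda>\<omega>. (v e \<omega>)\<^sup>2)" if "e \<in> edges_between i j" for e
  proof -
    have e: "e \<in> all_edges" using that edges_between_subset by blast
    have "integrable (distr M borel (v e)) (\<lambda>x. x\<^sup>2)" using integrable_square weights_law[OF e] by simp
    then show ?thesis using v_measurable[OF e] by (subst (asm) integrable_distr_eq) auto
  qed
  then show "integrable M (\<lambda>\<omega>. (\<Sum>e\<in>edges_between i j. (v e \<omega>)\<^sup>2) * card (edges_between i j))"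
    by (intro integrable_mult_left Bochner_Integration.integrable_sum) auto
  show "AE \<omega> in M. norm ((real_of_ereal (max_path_weight v pr i j \<omega>))\<^sup>2)
      \<le> norm ((\<Sum>e\<in>edges_between i j. (v e \<omega>)\<^sup>2) * card (edges_between i j))"
  proof (rule AE_I2)
    fix \<omega>
    have "(real_of_ereal (max_path_weight v pr i j \<omega>))\<^sup>2 \<le> (\<Sum>e\<in>edges_between i j. \<bar>v e \<omega>\<bar>)\<^sup>2"
      unfolding max_path_weight_def
      by (rule abs_le_square_iff[THEN iffD1]) (use abs_max_weight_le[of _ "\<lambda>e. v e \<omega>" i j] in \<open>auto intro: order_trans\<close>)
    also have "\<dots> \<le> (\<Sum>e\<in>edges_between i j. \<bar>v e \<omega>\<bar>\<^sup>2) * card (edges_between i j)"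
      by (rule sum_squared_le_sum_of_squares)
    finally show "norm ((real_of_ereal (max_path_weight v pr i j \<omega>))\<^sup>2)
      \<le> norm ((\<Sum>e\<in>edges_between i j. (v e \<omega>)\<^sup>2) * card (edges_between i j))"
      by (simp add: sum_nonneg)
  qed
qed measurable

lemma finite_weight_prob:
  "eventually (\<lambda>n. 3/4 \<le> prob {\<omega> \<in> space M. \<bar>max_path_weight v pr 0 (int n) \<omega>\<bar> \<noteq> \<infinity>}) sequentially"
proof -
  have "eventually (\<lambda>n. \<exists>X\<in>events. prob X < 1/4 \<and> (\<forall>\<omega>\<in>space M - X.
       \<exists>xs. is_path (present_edges pr \<omega>) 0 (int n) xs)) sequentially"
    using geodesic_upper_bound[of 1 "1/4"] by (rule eventually_mono) auto
  then show ?thesis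
  proof eventually_elim
    case (elim n)
    then obtain X where X: "X \<in> events" "prob X < 1/4"
      "\<And>\<omega>. \<omega> \<in> space M - X \<Longrightarrow> \<exists>xs. is_path (present_edges pr \<omega>) 0 (int n) xs" by blast
    let ?A = "{\<omega> \<in> space M. \<bar>max_path_weight v pr 0 (int n) \<omega>\<bar> \<noteq> \<infinity>}"
    have "space M - X \<subseteq> ?A"
    proof
      fix \<omega> assume \<omega>: "\<omega> \<in> space M - X"
      then obtain xs where "is_geodesic (present_edges pr \<omega>) (\<lambda>e. v e \<omega>) 0 (int n) xs"
        using X(3) geodesic_exists by metis
      then have "max_path_weight v pr 0 (int n) \<omega> = ereal (path_weight (\<lambda>e. v e \<omega>) xs)"
        by (simp add: is_geodesic_def max_path_weight_def)
      then show "\<omega> \<in> ?A" using \<omega> by simp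
    qed
    moreover have "?A \<in> events" by measurable
    ultimately have "prob (space M - X) \<le> prob ?A" by (rule finite_measure_mono)
    then show ?case using prob_compl[OF X(1)] X(2) by simp
  qed
qed

text \<open>A window of length \<open>n powr \<beta>\<close> around the conditional mean has small
  mass, so deviations of this order have probability bounded below, and Chebyshev's inequality turns
  them into variance.\<close>

lemma variance_diverges:
  assumes "s < 3"
  shows "filterlim (\<lambda>n. ereal_variance M (max_path_weight v pr 0 (int n)) / real n) at_top sequentially"
proof -
  \<comment> \<open>For \<open>s < 3\<close> there is room between 1/2 and \<alpha>.\<close>
  define \<beta> where "\<beta> = (1/2 + \<alpha>) / 2"
  have "1/2 < \<alpha>" using assms s_gt_2 by (simp add: \<alpha>_def field_simps)
  then have \<beta>: "1/2 < \<beta>" "\<beta> < \<alpha>" by (auto simp: \<beta>_def)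
  have lim: "filterlim (\<lambda>n. real n powr (2 * \<beta> - 1) / 8) at_top sequentially"
    using \<beta>(1) by real_asymp
  show ?thesis
  proof (rule filterlim_at_top_mono[OF lim])
    have "eventually (\<lambda>n. \<forall>y. prob {\<omega> \<in> space M. max_path_weight v pr 0 (int n) \<omega>
      \<in> {ereal y..ereal (y + real n powr \<beta>)}} \<le> 1/4) sequentially"
      using \<beta>(2) by (intro prob_interval_small) auto
    then show "eventually (\<lambda>n. real n powr (2 * \<beta> - 1) / 8
        \<le> ereal_variance M (max_path_weight v pr 0 (int n)) / real n) sequentially"
      using finite_weight_prob eventually_ge_at_top[of 1]
    proof eventually_elim
      case (elim n)
      let ?X = "max_path_weight v pr 0 (int n)"
      define A where "A = {\<omega> \<in> space M. \<bar>?X \<omega>\<bar> \<noteq> \<infinity>}"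
      define f where "f = (\<lambda>\<omega>. real_of_ereal (?X \<omega>))"
      have A: "A \<in> events" unfolding A_def by measurable
      have pA: "3/4 \<le> prob A" using elim(2) by (simp add: A_def)
      then have eA: "emeasure M A \<noteq> 0" by (simp add: emeasure_eq_measure)
      have f [measurable]: "f \<in> borel_measurable M" unfolding f_def by measurable
      let ?P = "uniform_measure M A"
      interpret P: prob_space ?P using eA by (intro prob_space_uniform_measure) (simp_all add: emeasure_eq_measure)
      define a where "a = real n powr \<beta> / 2"
      have a: "0 < a" using elim(3) by (simp add: a_def)
      define m where "m = P.expectation f"
      have fP: "f \<in> borel_measurable ?P" using f by (simp cong: measurable_cong_sets)
      have int: "integrable ?P (\<lambda>\<omega>. (f \<omega>)\<^sup>2)"
        unfolding f_def by (rule integrable_uniform_measure[OF integrable_max_path_weight_sq A eA])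
      have cheb: "P.prob {\<omega> \<in> space ?P. a \<le> \<bar>f \<omega> - m\<bar>} \<le> P.variance f / a\<^sup>2"
        unfolding m_def by (rule P.Chebyshev_inequality[OF fP int a])
      let ?F = "{\<omega> \<in> space M. a \<le> \<bar>f \<omega> - m\<bar>}"
      have F: "?F \<in> events" by measurable
      have I: "{\<omega> \<in> space M. ?X \<omega> \<in> {ereal (m - a)..ereal (m - a + real n powr \<beta>)}} \<in> events" by measurable
      have "A - ?F \<subseteq> {\<omega> \<in> space M. ?X \<omega> \<in> {ereal (m - a)..ereal (m - a + real n powr \<beta>)}}"
      proof
        fix \<omega> assume \<omega>: "\<omega> \<in> A - ?F"
        then have "?X \<omega> = ereal (f \<omega>)" by (auto simp: A_def f_def ereal_real)
        then show "\<omega> \<in> {\<omega> \<in> space M. ?X \<omega> \<in> {ereal (m - a)..ereal (m - a + real n powr \<beta>)}}"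
        proof -
          have "\<omega> \<in> space M" "\<bar>f \<omega> - m\<bar> < a" using \<omega> by (auto simp: A_def)
          moreover have "m - a + real n powr \<beta> = m + a" by (simp add: a_def)
          ultimately show ?thesis using \<open>?X \<omega> = ereal (f \<omega>)\<close> by (auto simp: abs_less_iff)
        qed
      qed
      from finite_measure_mono[OF this I] have "prob (A - ?F) \<le> 1/4"
        using elim(1)[rule_format, of "m - a"] by linarith
      moreover have "prob A \<le> prob (A \<inter> ?F) + prob (A - ?F)"
        using measure_Un_le[of "A \<inter> ?F" M "A - ?F"] A F by (simp add: Int_Diff_Un)
      \<comment> \<open>Finiteness has probability at least 3/4 and the window at most 1/4, so 1/2
        is left for large deviations; conditioning divides by \<open>prob A\<close> and only
        increases it.\<close>
      ultimately have "1/2 \<le> prob (A \<inter> ?F)" using pA by linarith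
      also have "\<dots> \<le> prob (A \<inter> ?F) / prob A"
        using pA by (simp add: le_divide_eq mult_left_le)
      also have "\<dots> = P.prob ?F"
        using A F eA by (simp add: measure_uniform_measure emeasure_eq_measure)
      also have "\<dots> \<le> P.variance f / a\<^sup>2" using cheb by simp
      finally have "a\<^sup>2 / 2 \<le> P.variance f" using a by (simp add: field_simps)
      moreover have "ereal_variance M ?X = P.variance f"
        unfolding ereal_variance_def A_def f_def ..
      moreover have "a\<^sup>2 / 2 = real n * (real n powr (2 * \<beta> - 1) / 8)"
        using elim(3) by (simp add: a_def power2_eq_square powr_diff powr_add[symmetric] field_simps)
      ultimately show ?case using elim(3) by (simp add: field_simps)
    qed
  qed
qed

text \<open>A Gaussian limit would keep mass close to \<open>c > 0\<close> in a window of length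
  \<open>\<kappa> * sqrt n\<close>, whatever the centring; this length is below the scale of the
  fluctuations.\<close>

lemma no_gaussian_limit:
  assumes "s < 3" "0 < \<kappa>" "0 < t"
  shows "\<not> gaussian_limit_at M v pr a \<kappa> t"
proof
  assume "gaussian_limit_at M v pr a \<kappa> t"
  define N where "N = density lborel (\<lambda>x. ennreal (normal_density 0 (sqrt t) x))"
  let ?X = "\<lambda>n. max_path_weight v pr 0 \<lfloor>real n * t\<rfloor>"
  let ?S = "\<lambda>n x. {\<omega> \<in> space M. (?X n \<omega> - ereal (a n)) / ereal (\<kappa> * sqrt (real n)) \<le> ereal x}"
  have N: "isCont (cdf N) x" "0 < cdf N 1 - cdf N 0" for x
    unfolding N_def using normal_cdf_increment[of "sqrt t"] assms by auto
  have lim: "(\<lambda>n. prob (?S n x)) \<longlonglongrightarrow> cdf N x" for x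
    using \<open>gaussian_limit_at M v pr a \<kappa> t\<close> N(1)
    unfolding gaussian_limit_at_def weak_conv_def N_def by blast
  define c where "c = cdf N 1 - cdf N 0"
  have "eventually (\<lambda>n. c / 2 < prob (?S n 1) - prob (?S n 0)) sequentially"
    using N(2) by (intro order_tendstoD(1)[OF tendsto_diff[OF lim[of 1] lim[of 0]]]) (simp add: c_def)
  moreover
  define \<beta> where "\<beta> = (1/2 + \<alpha>) / 2"
  have "1/2 < \<alpha>" using assms s_gt_2 by (simp add: \<alpha>_def field_simps)
  then have \<beta>: "1/2 < \<beta>" "\<beta> < \<alpha>" by (auto simp: \<beta>_def)
  let ?m = "\<lambda>n. nat \<lfloor>real n * t\<rfloor>"
  have "filterlim ?m at_top sequentially"
    using assms(3) by real_asymp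
  then have "eventually (\<lambda>n. \<forall>y. prob {\<omega> \<in> space M. max_path_weight v pr 0 (int (?m n)) \<omega>
      \<in> {ereal y..ereal (y + real (?m n) powr \<beta>)}} \<le> c / 2) sequentially"
    by (rule eventually_compose_filterlim[OF prob_interval_small[OF \<beta>(2) half_gt_zero[OF N(2), folded c_def]]])
  moreover have "eventually (\<lambda>n. \<kappa> * sqrt (real n) \<le> real (?m n) powr \<beta>) sequentially"
    using assms \<beta>(1) by real_asymp
  ultimately have "eventually (\<lambda>n. False) sequentially"
    using eventually_ge_at_top[of 1]
  proof eventually_elim
    case (elim n)
    have m: "int (?m n) = \<lfloor>real n * t\<rfloor>" using assms by simp
    let ?I = "{\<omega> \<in> space M. ?X n \<omega> \<in> {ereal (a n)..ereal (a n + real (?m n) powr \<beta>)}}"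
    have I: "?I \<in> events" by measurable
    have \<sigma>: "0 < \<kappa> * sqrt (real n)" using assms elim(4) by simp
    have S: "?S n x \<in> events" for x by measurable
    have "?S n 0 \<subseteq> ?S n 1" using order_trans[of _ "ereal 0" "ereal 1"] by auto
    then have "prob (?S n 1) - prob (?S n 0) = prob (?S n 1 - ?S n 0)"
      using S by (intro finite_measure_Diff[symmetric]) auto
    also have "\<dots> \<le> prob ?I"
    proof (rule finite_measure_mono[OF _ I], rule subsetI)
      fix \<omega> assume \<omega>: "\<omega> \<in> ?S n 1 - ?S n 0"
      show "\<omega> \<in> ?I"
      proof (cases "?X n \<omega>")
        case (real x)
        have nz: "\<kappa> * sqrt (real n) \<noteq> 0" by (rule less_imp_neq[OF \<sigma>, symmetric])
        have eq: "(ereal x - ereal (a n)) / ereal (\<kappa> * sqrt (real n)) = ereal ((x - a n) / (\<kappa> * sqrt (real n)))"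
          by (simp only: ereal_minus(1) ereal_divide nz if_False)
        have "\<omega> \<in> space M" "ereal ((x - a n) / (\<kappa> * sqrt (real n))) \<le> ereal 1"
          "\<not> ereal ((x - a n) / (\<kappa> * sqrt (real n))) \<le> ereal 0"
          using \<omega> unfolding mem_Collect_eq Diff_iff real eq by blast+
        then have "\<omega> \<in> space M" "(x - a n) / (\<kappa> * sqrt (real n)) \<le> 1" "0 < (x - a n) / (\<kappa> * sqrt (real n))"
          by (simp_all only: ereal_less_eq(3) not_le)
        moreover from this have "x - a n \<le> \<kappa> * sqrt (real n)" "0 < x - a n"
          by (simp_all only: pos_divide_le_eq[OF \<sigma>] pos_less_divide_eq[OF \<sigma>] mult_1 mult_zero_left)
        ultimately show ?thesis using elim(3) by (simp add: real)
      next
        \<comment> \<open>Infinite values lie outside the difference: \<open>\<infinity>\<close>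
          violates the bound 1, and \<open>- \<infinity>\<close> satisfies the bound 0.\<close>
        case PInf
        then show ?thesis using \<omega> \<sigma> by auto
      next
        case MInf
        then show ?thesis using \<omega> \<sigma> by auto
      qed
    qed
    also have "\<dots> \<le> c / 2" using elim(2) m by simp
    finally show False using elim(1) by simp
  qed
  then show False by simp
qed

end

theorem theorem2p5:
  fixes M :: "'a measure" and p s :: real and \<mu> :: "real measure"
    and v :: "int \<times> int \<Rightarrow> 'a \<Rightarrow> real" and pr :: "int \<times> int \<Rightarrow> 'a \<Rightarrow> bool"
  assumes "random_edge_lpp M p \<mu> v pr"
    and "s > 2"
    and "regularly_varying_tail \<mu> s"
  shows
    "(\<forall>\<gamma>. geodesic_choice M v pr \<gamma> \<longrightarrow>
        converges_in_prob M
          (\<lambda>n \<omega>. ln (real_of_int (longest_edge (\<gamma> n \<omega>))) / ln (real n)) (1 / (s - 1)) \<and>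
        converges_in_prob M
          (\<lambda>n \<omega>. ln (heaviest_edge (\<lambda>e. v e \<omega>) (\<gamma> n \<omega>)) / ln (real n)) (1 / (s - 1)))
     \<and> (\<forall>\<beta> < 1 / (s - 1). \<forall>y :: nat \<Rightarrow> real.
          (\<lambda>n. measure M {\<omega> \<in> space M.
             max_path_weight v pr 0 (int n) \<omega> \<in> {ereal (y n) .. ereal (y n + real n powr \<beta>)}}) \<longlonglongrightarrow> 0)
     \<and> (s < 3 \<longrightarrow>
          filterlim (\<lambda>n. ereal_variance M (max_path_weight v pr 0 (int n)) / real n) at_top sequentially
          \<and> (\<forall>C \<kappa> t. (AE \<omega> in M. (\<lambda>n. max_path_weight v pr 0 (int n) \<omega> / ereal (real n)) \<longlonglongrightarrow> ereal C) \<longrightarrow>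
               \<kappa> > 0 \<longrightarrow> t > 0 \<longrightarrow>
               \<not> gaussian_limit_at M v pr (\<lambda>n. C * real n * t) \<kappa> t)
          \<and> (\<forall>a \<kappa> t. \<kappa> > 0 \<longrightarrow> t > 0 \<longrightarrow> \<not> gaussian_limit_at M v pr a \<kappa> t))"
proof -
  interpret random_edge_lpp M p \<mu> v pr by fact
  interpret heavy_edge_lpp M p \<mu> v pr s by unfold_locales fact+
  have conv: "converges_in_prob M (\<lambda>n \<omega>. ln (real_of_int (longest_edge (\<gamma> n \<omega>))) / ln (real n)) \<alpha>"
    "converges_in_prob M (\<lambda>n \<omega>. ln (heaviest_edge (\<lambda>e. v e \<omega>) (\<gamma> n \<omega>)) / ln (real n)) \<alpha>"
    if "geodesic_choice M v pr \<gamma>" for \<gamma>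
  proof -
    show "converges_in_prob M (\<lambda>n \<omega>. ln (real_of_int (longest_edge (\<gamma> n \<omega>))) / ln (real n)) \<alpha>"
      by (rule converges_in_probI, drule (1) geodesic_exponents[OF that], erule eventually_mono) blast
    show "converges_in_prob M (\<lambda>n \<omega>. ln (heaviest_edge (\<lambda>e. v e \<omega>) (\<gamma> n \<omega>)) / ln (real n)) \<alpha>"
      by (rule converges_in_probI, drule (1) geodesic_exponents[OF that], erule eventually_mono) blast
  qed
  show ?thesis
    using conv fluctuations variance_diverges no_gaussian_limit unfolding \<alpha>_def by simp
qed

end
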